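(* Fix $1<p<\infty$. Let $f_0,f_1\in W^{1,p}(\mathbb{R}^n)$ be two distinct, non-negative, symmetric decreasing functions with unit mass, and let $f_t$, $0\le t\le1$, be the height function interpolation between $f_0$ and $f_1$. Then $$t\mapsto[f_t]_{W^{1,p}(\mathbb{R}^n)}^p=\int_{\mathbb{R}^n}|\nabla f_t|^p\,dx$$ is convex if $p\ge 2n/(n+1)$. Consequently, when $p\ge2n/(n+1)$, $$\max_{t\in[0,1]}[f_t]_{W^{1,p}(\mathbb{R}^n)}^p\le\max\left\{[f_0]_{W^{1,p}(\mathbb{R}^n)}^p,[f_1]_{W^{1,p}(\mathbb{R}^n)}^p\right\}.$$
   Context: Symmetric decreasing means $f(x)=\Phi(|x|)$ with $\Phi$ non-increasing; unit mass means $\int_{\mathbb{R}^n}f\,dx=1$. Height function: for a non-negative symmetric decreasing $f$ of unit mass, the height function $H:(0,1)\to(0,\|f\|_{L^\infty(\mathbb{R}^n)})$ is defined implicitly by $\int_{\mathbb{R}^n}\min\{f(x),H(m)\}\,dx=m$ for $m\in(0,1)$. It is continuous, strictly increasing and convex, and determines $f$ through $$f(x)=\int_0^1\chi_{B(0,(c_nH'(m))^{-1/n})}(x)\,H'(m)\,dm,$$ where $c_n$ is the volume of the unit ball of $\mathbb{R}^n$. Height function interpolation: if $H_0,H_1$ are the height functions of $f_0,f_1$, set $H_t=(1-t)H_0+tH_1$ for $t\in[0,1]$; $f_t$ is the symmetric decreasing function of unit mass whose height function is $H_t$, i.e. given by the displayed formula with $H$ replaced by $H_t$. *)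

theory Defs
  imports "HOL-Probability.Essential_Supremum" "HOL-Analysis.Analysis"
begin

text \<open>Elements of Sobolev spaces are represented by functions on \<open>real ^ 'n\<close> that are only
  meaningful up to Lebesgue null sets, so pointwise conditions are imposed almost everywhere.\<close>

primrec Ck :: "nat \<Rightarrow> (real ^ 'n \<Rightarrow> real) \<Rightarrow> bool" where
  "Ck 0 \<phi> \<longleftrightarrow> continuous_on UNIV \<phi>"
| "Ck (Suc k) \<phi> \<longleftrightarrow> \<phi> differentiable_on UNIV \<and>
     (\<forall>i. Ck k (\<lambda>x. frechet_derivative \<phi> (at x) (axis i 1)))"

definition test_function :: "(real ^ 'n \<Rightarrow> real) \<Rightarrow> bool" where
  "test_function \<phi> \<longleftrightarrow> (\<forall>k. Ck k \<phi>) \<and> compact (closure {x. \<phi> x \<noteq> 0})"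

definition locally_integrable :: "(real ^ 'n \<Rightarrow> 'b::{banach, second_countable_topology}) \<Rightarrow> bool" where
  "locally_integrable f \<longleftrightarrow> (\<forall>K. compact K \<longrightarrow> set_integrable lebesgue K f)"

definition has_weak_gradient :: "(real ^ 'n \<Rightarrow> real) \<Rightarrow> (real ^ 'n \<Rightarrow> real ^ 'n) \<Rightarrow> bool" where
  "has_weak_gradient f g \<longleftrightarrow> locally_integrable f \<and> locally_integrable g \<and>
     (\<forall>\<phi>. test_function \<phi> \<longrightarrow> (\<forall>i.
        (LINT x|lebesgue. f x * frechet_derivative \<phi> (at x) (axis i 1))
          = - (LINT x|lebesgue. g x $ i * \<phi> x)))"

text \<open>A weak gradient is unique up to null sets, so the choice below does not affect integrals.\<close>

definition weak_gradient :: "(real ^ 'n \<Rightarrow> real) \<Rightarrow> real ^ 'n \<Rightarrow> real ^ 'n" where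
  "weak_gradient f = (SOME g. has_weak_gradient f g)"

text \<open>The \<open>p\<close>-th power of the seminorm, \<open>\<integral> |\<nabla>f|\<^sup>p\<close>; it is infinite when there is no weak gradient.\<close>

definition sobolev_energy :: "real \<Rightarrow> (real ^ 'n \<Rightarrow> real) \<Rightarrow> ennreal" where
  "sobolev_energy p f =
     (if \<exists>g. has_weak_gradient f g
      then \<integral>\<^sup>+ x. ennreal (norm (weak_gradient f x) powr p) \<partial>lebesgue
      else \<infinity>)"

definition sobolev_W1 :: "real \<Rightarrow> (real ^ 'n \<Rightarrow> real) set" where
  "sobolev_W1 p = {f. f \<in> borel_measurable lebesgue \<and>
     integrable lebesgue (\<lambda>x. \<bar>f x\<bar> powr p) \<and>
     (\<exists>g. has_weak_gradient f g \<and> integrable lebesgue (\<lambda>x. norm (g x) powr p))}"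

text \<open>The profile is required to be real-valued on the open half-line only, so that functions
  which are unbounded at the origin are included.\<close>

definition symmetric_decreasing :: "(real ^ 'n \<Rightarrow> real) \<Rightarrow> bool" where
  "symmetric_decreasing f \<longleftrightarrow>
     (\<exists>\<Phi>. antimono_on {0<..} \<Phi> \<and> (AE x in lebesgue. f x = \<Phi> (norm x)))"

definition unit_mass :: "(real ^ 'n \<Rightarrow> real) \<Rightarrow> bool" where
  "unit_mass f \<longleftrightarrow> integrable lebesgue f \<and> (LINT x|lebesgue. f x) = 1"

text \<open>Only the values for \<open>0 < m < 1\<close> are meaningful.\<close>

definition height :: "(real ^ 'n \<Rightarrow> real) \<Rightarrow> real \<Rightarrow> real" where
  "height f m = (THE h. 0 < h \<and> ereal h < esssup lebesgue (\<lambda>x. ereal \<bar>f x\<bar>) \<and>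
     (LINT x|lebesgue. min (f x) h) = m)"

text \<open>The function with a given height function \<open>H\<close>. Since \<open>H\<close> is convex on \<open>(0,1)\<close>, the derivative
  exists off a countable set. At the origin, where the true value may be infinite, the integral
  may take its default value \<open>0\<close>.\<close>

definition from_height :: "(real \<Rightarrow> real) \<Rightarrow> real ^ 'n \<Rightarrow> real" where
  "from_height H x =
     (LINT m:{0<..<1}|lebesgue.
        indicator (ball 0 ((measure lebesgue (ball (0 :: real ^ 'n) 1) * deriv H m)
                             powr (- 1 / real CARD('n)))) x * deriv H m)"

definition height_interpolation ::
    "(real ^ 'n \<Rightarrow> real) \<Rightarrow> (real ^ 'n \<Rightarrow> real) \<Rightarrow> real \<Rightarrow> real ^ 'n \<Rightarrow> real" where
  "height_interpolation f0 f1 t =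
     from_height (\<lambda>m. (1 - t) * height f0 m + t * height f1 m)"

end

theory Submission
  imports Defs "HOL-Probability.Probability_Measure"
begin

text \<open>Write \<open>T x = 1 / (c\<^sub>n |x|\<^sup>n)\<close>. The derivative \<open>u = H'\<close> of a height function is positive and increasing on
  \<open>(0,1)\<close>, and \<open>f x = \<integral> u m dm\<close> over those \<open>m\<close> with \<open>u m < T x\<close>. If \<open>\<rho>\<close> is the density of the law of \<open>u\<close> under
  Lebesgue measure on \<open>(0,1)\<close>, then \<open>\<nabla>f = - n T\<^sup>2 \<rho>(T) x / |x|\<^sup>2\<close>, and since \<open>T\<close> pushes Lebesgue measure to \<open>dy / y\<^sup>2\<close>,
  the energy is a constant times \<open>\<integral> y\<^sup>a \<rho>(y)\<^sup>p dy\<close> with \<open>a = 2p - 2 + p/n\<close>. Height function interpolation is linear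
  interpolation of \<open>u\<close>, that is, displacement interpolation between the laws: \<open>u\<^sub>0\<close> and \<open>u\<^sub>1\<close> are monotone Lipschitz
  functions \<open>L\<^sub>0\<close>, \<open>L\<^sub>1\<close> of \<open>u\<^sub>t\<close>, so \<open>1/\<rho>\<^sub>t = (1-t)/\<rho>\<^sub>0(L\<^sub>0) + t/\<rho>\<^sub>1(L\<^sub>1)\<close> almost everywhere. The energy
  \<open>\<integral> u\<^sup>a (1/\<rho>(u))\<^bsup>1-p\<^esup> dm\<close> is therefore convex, because \<open>X\<^sup>a Y\<^bsup>1-p\<^esup>\<close> is jointly convex for \<open>a \<ge> p\<close>, and \<open>a \<ge> p\<close>
  means \<open>p \<ge> 2n/(n+1)\<close>.\<close>

section \<open>Smooth test functions\<close>

text \<open>The data are Sobolev functions known up to null sets, so the profile has no pointwise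
  derivative to start from. Every passage between \<open>f\<close> and \<open>\<rho>\<close> is made
  by duality with test functions, and the two directions are asymmetric. A weak gradient of
  \<open>f\<close> yields a density of the law of the slope, with an inequality: the energy of the
  density is at most that of \<open>f\<close>, since the estimate sees the gradient through its
  radial component. A density of finite energy yields a weak gradient of the superposition of balls,
  with an equality. This is enough because the functions reconstructed at the end points enter only
  through upper bounds by the energies of \<open>f0\<close> and \<open>f1\<close>.

  The factors \<open>L0\<close> and \<open>L1\<close> are merely Lipschitz. Their derivatives are
  represented by Radon-Nikodym densities of their Stieltjes measures; these measures, weighted by
  \<open>s0\<close> and \<open>s1\<close>, add up to Lebesgue measure, which replaces
  differentiating the identity \<open>s0 * L0 y + s1 * L1 y = y\<close>.\<close>

lemma Ck_if_closed_under_partials: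
  fixes S :: "(real ^ 'n \<Rightarrow> real) set"
  assumes "\<And>\<phi>. \<phi> \<in> S \<Longrightarrow> \<phi> differentiable_on UNIV"
    and "\<And>\<phi> i. \<phi> \<in> S \<Longrightarrow> (\<lambda>x. frechet_derivative \<phi> (at x) (axis i 1)) \<in> S"
    and "\<phi> \<in> S"
  shows "Ck k \<phi>"
  using assms(3)
proof (induction k arbitrary: \<phi>)
  case 0
  then show ?case using assms(1) differentiable_imp_continuous_on by auto
next
  case (Suc k)
  then show ?case using assms(1,2) by auto
qed

text \<open>With \<open>P = 1\<close> this is the standard function that is flat at 0. The
  polynomial is carried along because differentiation multiplies exp(-1/y) by polynomials in 1/y, so
  the whole family is stable under derivatives.\<close>

definition flat_exp :: "real poly \<Rightarrow> real \<Rightarrow> real" where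
  "flat_exp P y = (if y > 0 then poly P (1 / y) * exp (- (1 / y)) else 0)"

text \<open>The free power \<open>k\<close> is what the induction on \<open>P\<close> consumes: the
  step P = a + z Q moves one factor z into the power. The limit is applied at z = 1/h.\<close>

lemma power_mult_poly_mult_exp_tendsto_0:
  fixes P :: "real poly"
  shows "((\<lambda>z. z ^ k * poly P z * exp (- z)) \<longlongrightarrow> 0) at_top"
proof (induction P arbitrary: k)
  case 0
  then show ?case by simp
next
  case (pCons a P)
  have "((\<lambda>z::real. z ^ k * exp (- z)) \<longlongrightarrow> 0) at_top"
    using tendsto_power_div_exp_0[of k] by (simp add: exp_minus divide_inverse)
  then have "((\<lambda>z. a * (z ^ k * exp (- z)) + z ^ Suc k * poly P z * exp (- z)) \<longlongrightarrow> a * 0 + 0) at_top"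
    by (intro tendsto_intros pCons.IH)
  then show ?case by (simp add: algebra_simps)
qed

text \<open>In the variable z = 1/y the chain rule gives z^2 (P(z) - P'(z)) exp(-z). At 0 the
  difference quotient from the right is z P(z) exp(-z), which decays, and from the left it
  vanishes.\<close>

lemma flat_exp_has_derivative:
  "(flat_exp P has_real_derivative flat_exp ([:0, 0, 1:] * (P - pderiv P)) y) (at y)"
proof -
  consider "y > 0" | "y < 0" | "y = 0" by linarith
  then show ?thesis
  proof cases
    case 1
    have "((\<lambda>y. poly P (1 / y) * exp (- (1 / y))) has_real_derivative
        flat_exp ([:0, 0, 1:] * (P - pderiv P)) y) (at y)"
      using 1 by (auto intro!: derivative_eq_intros DERIV_chain2[OF poly_DERIV]
          simp: flat_exp_def algebra_simps power2_eq_square divide_simps)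
    then show ?thesis
      by (rule has_field_derivative_transform_within_open[where S="{0<..}"])
        (use 1 in \<open>auto simp: flat_exp_def\<close>)
  next
    case 2
    have "((\<lambda>y. 0) has_real_derivative 0) (at y)" by simp
    then have "(flat_exp P has_real_derivative 0) (at y)"
      by (rule has_field_derivative_transform_within_open[where S="{..<0}"])
        (use 2 in \<open>auto simp: flat_exp_def\<close>)
    then show ?thesis using 2 by (simp add: flat_exp_def)
  next
    case 3
    have "((\<lambda>h. (1/h) ^ 1 * poly P (1/h) * exp (- (1/h))) \<longlongrightarrow> 0) (at_right 0)"
      using filterlim_compose[OF power_mult_poly_mult_exp_tendsto_0[of 1 P] filterlim_inverse_at_top_right]
      by (simp add: inverse_eq_divide)
    then have r: "((\<lambda>h. flat_exp P h / h) \<longlongrightarrow> 0) (at_right 0)"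
      by (rule Lim_transform_eventually)
        (auto simp: flat_exp_def eventually_at_filter)
    have "((\<lambda>h::real. 0::real) \<longlongrightarrow> 0) (at_left 0)" by simp
    then have l: "((\<lambda>h. flat_exp P h / h) \<longlongrightarrow> 0) (at_left 0)"
      by (rule Lim_transform_eventually) (auto simp: flat_exp_def eventually_at_filter)
    have "((\<lambda>h. (flat_exp P (0 + h) - flat_exp P 0) / h) \<longlongrightarrow> 0) (at 0)"
      using l r by (simp add: filterlim_split_at_real flat_exp_def[of P 0])
    then have "(flat_exp P has_real_derivative 0) (at 0)" by (simp add: DERIV_def)
    then show ?thesis using 3 by (simp add: flat_exp_def)
  qed
qed

text \<open>The class is generated by closure rules so that smoothness of every order reduces to one
  check, namely that partial derivatives stay inside it. The rule \<open>flat\<close> admits every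
  \<open>P\<close> since differentiating \<open>flat_exp P\<close> replaces \<open>P\<close> by
  another polynomial.\<close>

inductive_set smooth_functions :: "(real ^ 'n \<Rightarrow> real) set" where
  const: "(\<lambda>x. c) \<in> smooth_functions"
| coord: "(\<lambda>x. x $ i) \<in> smooth_functions"
| add: "\<phi> \<in> smooth_functions \<Longrightarrow> \<psi> \<in> smooth_functions \<Longrightarrow> (\<lambda>x. \<phi> x + \<psi> x) \<in> smooth_functions"
| mult: "\<phi> \<in> smooth_functions \<Longrightarrow> \<psi> \<in> smooth_functions \<Longrightarrow> (\<lambda>x. \<phi> x * \<psi> x) \<in> smooth_functions"
| flat: "\<phi> \<in> smooth_functions \<Longrightarrow> (\<lambda>x. flat_exp P (\<phi> x)) \<in> smooth_functions"

lemma smooth_functions_derivative: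
  fixes \<phi> :: "real ^ 'n \<Rightarrow> real"
  assumes "\<phi> \<in> smooth_functions"
  shows "(\<forall>x. \<phi> differentiable (at x)) \<and>
    (\<forall>i. (\<lambda>x. frechet_derivative \<phi> (at x) (axis i 1)) \<in> smooth_functions)"
  using assms
proof induction
  case (const c)
  then show ?case by (auto simp: smooth_functions.const)
next
  case (coord j)
  have d: "((\<lambda>x. x $ j) has_derivative (\<lambda>h. h $ j)) (at x)" for x :: "real ^ 'n"
    by (rule bounded_linear_imp_has_derivative[OF bounded_linear_vec_nth])
  then have "frechet_derivative (\<lambda>x. x $ j) (at x) = (\<lambda>h. h $ j)" for x :: "real ^ 'n"
    by (rule frechet_derivative_at[symmetric])
  then show ?case using d by (auto simp: differentiable_def smooth_functions.const)
next
  case (add \<phi> \<psi>)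
  have "((\<lambda>x. \<phi> x + \<psi> x) has_derivative
      (\<lambda>h. frechet_derivative \<phi> (at x) h + frechet_derivative \<psi> (at x) h)) (at x)" for x
    using add.IH by (intro has_derivative_add) (auto simp: frechet_derivative_works[symmetric])
  then have "frechet_derivative (\<lambda>x. \<phi> x + \<psi> x) (at x) =
      (\<lambda>h. frechet_derivative \<phi> (at x) h + frechet_derivative \<psi> (at x) h)" for x
    by (rule frechet_derivative_at[symmetric])
  then show ?case using add.IH by (simp add: smooth_functions.add differentiable_add)
next
  case (mult \<phi> \<psi>)
  have "((\<lambda>x. \<phi> x * \<psi> x) has_derivative
      (\<lambda>h. \<phi> x * frechet_derivative \<psi> (at x) h + frechet_derivative \<phi> (at x) h * \<psi> x)) (at x)" for x
    using mult.IH by (intro has_derivative_mult) (auto simp: frechet_derivative_works[symmetric])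
  then have "frechet_derivative (\<lambda>x. \<phi> x * \<psi> x) (at x) =
      (\<lambda>h. \<phi> x * frechet_derivative \<psi> (at x) h + frechet_derivative \<phi> (at x) h * \<psi> x)" for x
    by (rule frechet_derivative_at[symmetric])
  then show ?case using mult by (simp add: smooth_functions.add smooth_functions.mult differentiable_mult)
next
  case (flat \<phi> P)
  let ?Q = "[:0, 0, 1:] * (P - pderiv P)"
  have d: "((\<lambda>x. flat_exp P (\<phi> x)) has_derivative
      (\<lambda>h. flat_exp ?Q (\<phi> x) * frechet_derivative \<phi> (at x) h)) (at x)" for x
  proof -
    have "(flat_exp P has_derivative (*) (flat_exp ?Q (\<phi> x))) (at (\<phi> x))"
      using flat_exp_has_derivative has_field_derivative_def by blast
    moreover have "(\<phi> has_derivative frechet_derivative \<phi> (at x)) (at x)"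
      using flat.IH frechet_derivative_works by blast
    ultimately show ?thesis using has_derivative_compose[of \<phi> _ x UNIV] by blast
  qed
  then have "frechet_derivative (\<lambda>x. flat_exp P (\<phi> x)) (at x) =
      (\<lambda>h. flat_exp ?Q (\<phi> x) * frechet_derivative \<phi> (at x) h)" for x
    by (rule frechet_derivative_at[symmetric])
  then show ?case using flat d
    by (auto intro: smooth_functions.mult smooth_functions.flat simp: differentiable_def simp del: mult_pCons_left)
qed

lemma Ck_smooth_functions: "\<phi> \<in> smooth_functions \<Longrightarrow> Ck k \<phi>"
  by (rule Ck_if_closed_under_partials[of smooth_functions])
    (use smooth_functions_derivative in \<open>auto simp: differentiable_on_def intro: differentiable_at_imp_differentiable_on\<close>)

lemma test_functionI:
  assumes "\<phi> \<in> smooth_functions" and "bounded {x. \<phi> x \<noteq> 0}"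
  shows "test_function \<phi>"
  using assms by (auto simp: test_function_def Ck_smooth_functions)

lemma smooth_functions_sum:
  "finite A \<Longrightarrow> (\<And>i. i \<in> A \<Longrightarrow> \<phi> i \<in> smooth_functions) \<Longrightarrow> (\<lambda>x. \<Sum>i\<in>A. \<phi> i x) \<in> smooth_functions"
  by (induction A rule: finite_induct) (simp_all add: smooth_functions.const smooth_functions.add smooth_functions.mult)

lemma smooth_functions_prod:
  "finite A \<Longrightarrow> (\<And>i. i \<in> A \<Longrightarrow> \<phi> i \<in> smooth_functions) \<Longrightarrow> (\<lambda>x. \<Prod>i\<in>A. \<phi> i x) \<in> smooth_functions"
  by (induction A rule: finite_induct) (simp_all add: smooth_functions.const smooth_functions.add smooth_functions.mult)

lemma smooth_functions_norm2: "(\<lambda>x :: real ^ 'n. (norm x)\<^sup>2) \<in> smooth_functions"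
proof -
  have "(\<lambda>x :: real ^ 'n. (norm x)\<^sup>2) = (\<lambda>x. \<Sum>i\<in>UNIV. x $ i * x $ i)"
    by (simp add: power2_norm_eq_inner inner_vec_def)
  then show ?thesis by (simp add: smooth_functions_sum smooth_functions.mult smooth_functions.coord)
qed

text \<open>For y > 0 the value exp(-1/((k+1) y)) tends to 1, so these bumps converge pointwise to
  the indicator of the open interval while staying between 0 and 1. Dominated convergence uses them
  in this form.\<close>

definition bump :: "nat \<Rightarrow> real \<Rightarrow> real \<Rightarrow> real \<Rightarrow> real" where
  "bump k a b q = flat_exp 1 (real (Suc k) * (q - a)) * flat_exp 1 (real (Suc k) * (b - q))"

lemma flat_exp_1_bounds: "0 \<le> flat_exp 1 y" "flat_exp 1 y \<le> 1"
  by (auto simp: flat_exp_def)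

lemma bump_bounds: "0 \<le> bump k a b q" "bump k a b q \<le> 1"
  by (auto simp: bump_def flat_exp_1_bounds mult_le_one)

lemma bump_eq_0: "q \<notin> {a<..<b} \<Longrightarrow> bump k a b q = 0"
  by (auto simp: bump_def flat_exp_def zero_less_mult_iff)

lemma flat_exp_1_tendsto: "(\<lambda>k. flat_exp 1 (real (Suc k) * y)) \<longlonglongrightarrow> indicator {0<..} y"
proof (cases "y > 0")
  case True
  have "(\<lambda>k. exp (- (1 / y * (1 / real (Suc k))))) \<longlonglongrightarrow> exp (- (1 / y * 0))"
    by (intro tendsto_intros) (use LIMSEQ_inverse_real_of_nat in \<open>simp add: inverse_eq_divide\<close>)
  moreover have "flat_exp 1 (real (Suc k) * y) = exp (- (1 / y * (1 / real (Suc k))))" for k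
    using True by (simp add: flat_exp_def mult.commute del: of_nat_Suc)
  ultimately show ?thesis using True by simp
next
  case False
  then have "flat_exp 1 (real (Suc k) * y) = 0" for k
    by (auto simp: flat_exp_def zero_less_mult_iff)
  then show ?thesis using False by simp
qed

lemma bump_tendsto: "(\<lambda>k. bump k a b q) \<longlonglongrightarrow> indicator {a<..<b} q"
proof -
  have "(\<lambda>k. bump k a b q) \<longlonglongrightarrow> indicator {0<..} (q - a) * indicator {0<..} (b - q)"
    unfolding bump_def by (intro tendsto_mult flat_exp_1_tendsto)
  moreover have "indicator {0<..} (q - a) * indicator {0<..} (b - q) = (indicator {a<..<b} q :: real)"
    by (auto simp: indicator_def)
  ultimately show ?thesis by simp
qed

lemma bump_compose_smooth: "\<phi> \<in> smooth_functions \<Longrightarrow> (\<lambda>x. bump k a b (\<phi> x)) \<in> smooth_functions"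
proof -
  assume \<phi>: "\<phi> \<in> smooth_functions"
  have *: "(\<lambda>x. bump k a b (\<phi> x)) = (\<lambda>x. flat_exp 1 (real (Suc k) * (\<phi> x + - a))
      * flat_exp 1 (real (Suc k) * (b + (- 1) * \<phi> x)))"
    by (simp add: bump_def)
  show ?thesis unfolding * by (intro smooth_functions.intros \<phi>)
qed

text \<open>The bump is composed with the square of the norm, a polynomial in the coordinates, so
  that the product is smooth at the origin too. These are the components of the radial fields
  against which the weak gradient is tested.\<close>

lemma test_function_radial: "test_function (\<lambda>x :: real ^ 'n. x $ i * bump k a b ((norm x)\<^sup>2))"
proof (rule test_functionI)
  show "(\<lambda>x :: real ^ 'n. x $ i * bump k a b ((norm x)\<^sup>2)) \<in> smooth_functions"
    by (intro smooth_functions.intros bump_compose_smooth smooth_functions_norm2)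
  have "norm x \<le> sqrt \<bar>b\<bar>" if "bump k a b ((norm x)\<^sup>2) \<noteq> 0" for x :: "real ^ 'n"
  proof (rule real_le_rsqrt)
    have "(norm x)\<^sup>2 \<in> {a<..<b}" using bump_eq_0 that by blast
    then show "(norm x)\<^sup>2 \<le> \<bar>b\<bar>" by auto
  qed
  then show "bounded {x :: real ^ 'n. x $ i * bump k a b ((norm x)\<^sup>2) \<noteq> 0}"
    by (intro boundedI[where B="sqrt \<bar>b\<bar>"]) auto
qed

lemma test_function_box:
  "test_function (\<lambda>x :: real ^ 'n. \<Prod>i\<in>UNIV. bump k (a $ i) (b $ i) (x $ i))"
proof (rule test_functionI)
  show "(\<lambda>x :: real ^ 'n. \<Prod>i\<in>UNIV. bump k (a $ i) (b $ i) (x $ i)) \<in> smooth_functions"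
    by (intro smooth_functions_prod bump_compose_smooth smooth_functions.intros) auto
  have "x \<in> box a b" if "(\<Prod>i\<in>UNIV. bump k (a $ i) (b $ i) (x $ i)) \<noteq> 0" for x :: "real ^ 'n"
  proof -
    have "bump k (a $ i) (b $ i) (x $ i) \<noteq> 0" for i using that by simp
    then have "x $ i \<in> {a $ i<..<b $ i}" for i using bump_eq_0 by blast
    then show ?thesis by (auto simp: mem_box_cart)
  qed
  then show "bounded {x :: real ^ 'n. (\<Prod>i\<in>UNIV. bump k (a $ i) (b $ i) (x $ i)) \<noteq> 0}"
    by (intro bounded_subset[OF bounded_box[of a b]]) auto
qed

lemma bump_C1: obtains b' where "\<And>q. (bump k a b has_real_derivative b' q) (at q)" and "continuous_on UNIV b'"
proof -
  let ?Q = "[:0, 0, 1:] * (1 - pderiv 1) :: real poly"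
  define b' where "b' = (\<lambda>q. flat_exp ?Q (real (Suc k) * (q - a)) * real (Suc k) * flat_exp 1 (real (Suc k) * (b - q))
     + flat_exp 1 (real (Suc k) * (q - a)) * (flat_exp ?Q (real (Suc k) * (b - q)) * - real (Suc k)))"
  have "(bump k a b has_real_derivative b' q) (at q)" for q
    unfolding bump_def b'_def
    by (rule derivative_eq_intros DERIV_chain2[OF flat_exp_has_derivative] refl | simp)+
  moreover have c: "continuous_on UNIV (flat_exp P)" for P
    by (rule continuous_at_imp_continuous_on, rule ballI, rule DERIV_isCont, rule flat_exp_has_derivative)
  have "continuous_on UNIV b'"
    unfolding b'_def
    by (intro continuous_on_add continuous_on_mult continuous_on_const continuous_on_diff continuous_on_id
        continuous_on_compose2[OF c] subset_UNIV)
  ultimately show ?thesis using that[of b'] by simp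
qed

lemma test_function_continuous: "test_function \<phi> \<Longrightarrow> continuous_on UNIV \<phi>"
  using Ck.simps(1) unfolding test_function_def by blast

lemma test_function_borel: "test_function \<phi> \<Longrightarrow> \<phi> \<in> borel_measurable borel"
  by (rule borel_measurable_continuous_onI[OF test_function_continuous])

lemma test_function_lebesgue: "test_function \<phi> \<Longrightarrow> \<phi> \<in> borel_measurable lebesgue"
  using test_function_borel by (intro measurable_completion) (simp add: measurable_lborel1)

section \<open>Push-forward along the inverse volume\<close>

text \<open>Countable additivity of the signed set function that \<open>g\<close> induces through
  \<open>X\<close>; it is the union step of the Dynkin induction that follows.\<close>

lemma integral_indicator_UN:
  fixes X :: "'a \<Rightarrow> real" and g :: "'a \<Rightarrow> real"
  assumes [measurable]: "X \<in> borel_measurable M" "\<And>i::nat. A i \<in> sets borel"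
    and disj: "disjoint_family A" and g: "integrable M g"
  shows "(LINT x|M. indicator (\<Union>i. A i) (X x) * g x) = (\<Sum>i. LINT x|M. indicator (A i) (X x) * g x)"
proof -
  let ?B = "\<lambda>i. X -` A i \<inter> space M"
  have *: "(LINT x|M. indicator C (X x) * g x) = (LINT x:X -` C \<inter> space M|M. g x)" for C
    unfolding set_lebesgue_integral_def
    by (intro Bochner_Integration.integral_cong) (auto simp: indicator_def)
  have "(LINT x:(\<Union>i. ?B i)|M. g x) = (\<Sum>i. LINT x:?B i|M. g x)"
  proof (rule lebesgue_integral_countable_add)
    show "?B i \<in> sets M" for i by measurable
    show "i \<noteq> j \<Longrightarrow> ?B i \<inter> ?B j = {}" for i j
      using disj by (fastforce simp: disjoint_family_on_def)
    show "set_integrable M (\<Union>i. ?B i) g"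
      using g unfolding set_integrable_def by (intro integrable_mult_indicator) auto
  qed
  moreover have "(\<Union>i. ?B i) = X -` (\<Union>i. A i) \<inter> space M" by auto
  ultimately show ?thesis by (simp add: *)
qed

text \<open>The weights may change sign, so both sides are signed measures on (a, b). The pi-lambda
  argument is therefore run on the integrals themselves; its complement step uses the equality on
  the full interval.\<close>

lemma signed_pushforward_Int:
  fixes \<alpha> :: "'a \<Rightarrow> real" and X :: "'a \<Rightarrow> real" and \<beta> :: "'b \<Rightarrow> real" and Y :: "'b \<Rightarrow> real"
  assumes [measurable]: "X \<in> borel_measurable M" "\<alpha> \<in> borel_measurable M"
      "Y \<in> borel_measurable N" "\<beta> \<in> borel_measurable N"
    and iM: "integrable M (\<lambda>x. indicator {a<..<b} (X x) * \<alpha> x)"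
    and iN: "integrable N (\<lambda>y. indicator {a<..<b} (Y y) * \<beta> y)"
    and eq: "\<And>c d. a \<le> c \<Longrightarrow> d \<le> b \<Longrightarrow> c < d \<Longrightarrow>
      (LINT x|M. indicator {c<..<d} (X x) * \<alpha> x) = (LINT y|N. indicator {c<..<d} (Y y) * \<beta> y)"
    and A: "A \<in> sets borel"
  shows "(LINT x|M. indicator A (X x) * (indicator {a<..<b} (X x) * \<alpha> x))
    = (LINT y|N. indicator A (Y y) * (indicator {a<..<b} (Y y) * \<beta> y))"
proof (cases "a < b")
  case False
  then show ?thesis by simp
next
  case True
  have iMA: "integrable M (\<lambda>x. indicator A (X x) * (indicator {a<..<b} (X x) * \<alpha> x))"
    if [measurable]: "A \<in> sets borel" for A
    by (rule Bochner_Integration.integrable_bound[OF iM]) (auto simp: indicator_def)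
  have iNA: "integrable N (\<lambda>x. indicator A (Y x) * (indicator {a<..<b} (Y x) * \<beta> x))"
    if [measurable]: "A \<in> sets borel" for A
    by (rule Bochner_Integration.integrable_bound[OF iN]) (auto simp: indicator_def)
  let ?E = "range (\<lambda>(c, d). {c<..<d::real})"
  have E: "sets borel = sigma_sets UNIV ?E"
    unfolding borel_eq_box[where 'a=real] box_real by (rule sets_measure_of) auto
  have "Int_stable ?E"
    by (auto simp: Int_stable_def)
  moreover have "?E \<subseteq> Pow UNIV" by auto
  moreover have "A \<in> sigma_sets UNIV ?E" using A E by simp
  ultimately show ?thesis
  proof (induction rule: sigma_sets_induct_disjoint)
    case (basic A)
    then obtain c d where A: "A = {c<..<d}" by auto
    have *: "indicator A z * (indicator {a<..<b} z * w) = indicator {max a c<..<min b d} z * w" for z w :: real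
      by (auto simp: A indicator_def)
    show ?case
      unfolding * using eq[of "max a c" "min b d"] by (cases "max a c < min b d") auto
  next
    case empty
    then show ?case by simp
  next
    case (compl A)
    then have [measurable]: "A \<in> sets borel" using E by simp
    have *: "indicator (UNIV - A) z * w = w - indicator A z * w" for z w :: real
      by (auto simp: indicator_def)
    show ?case
      unfolding * using compl.IH eq[of a b] True iM iN iMA[of A] iNA[of A] by simp
  next
    case (union A)
    then have [measurable]: "A i \<in> sets borel" for i using E by auto
    have "(LINT x|M. indicator (\<Union>i. A i) (X x) * (indicator {a<..<b} (X x) * \<alpha> x))
        = (\<Sum>i. LINT x|M. indicator (A i) (X x) * (indicator {a<..<b} (X x) * \<alpha> x))"
      by (rule integral_indicator_UN) (use union(1) iM in auto)
    moreover have "(LINT x|N. indicator (\<Union>i. A i) (Y x) * (indicator {a<..<b} (Y x) * \<beta> x))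
        = (\<Sum>i. LINT x|N. indicator (A i) (Y x) * (indicator {a<..<b} (Y x) * \<beta> x))"
      by (rule integral_indicator_UN) (use union(1) iN in auto)
    ultimately show ?case using union.IH by simp
  qed
qed

text \<open>Near 0 and at infinity the weights themselves need not be integrable. So
  \<open>k\<close> is first approximated on intervals (a, b) with 0 < a, and the integrability of
  the products with \<open>k\<close> then allows the exhaustion of the half-line. It is applied with
  \<open>inv_vol\<close> against the identity and with a slope against
  \<open>inv_vol\<close>.\<close>

lemma signed_pushforward:
  fixes \<alpha> :: "'a \<Rightarrow> real" and X :: "'a \<Rightarrow> real" and \<beta> :: "'b \<Rightarrow> real" and Y :: "'b \<Rightarrow> real"
  assumes meas [measurable]: "X \<in> borel_measurable M" "\<alpha> \<in> borel_measurable M"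
      "Y \<in> borel_measurable N" "\<beta> \<in> borel_measurable N" "k \<in> borel_measurable borel"
    and iM: "\<And>a b. 0 < a \<Longrightarrow> a < b \<Longrightarrow> integrable M (\<lambda>x. indicator {a<..<b} (X x) * \<alpha> x)"
    and iN: "\<And>a b. 0 < a \<Longrightarrow> a < b \<Longrightarrow> integrable N (\<lambda>y. indicator {a<..<b} (Y y) * \<beta> y)"
    and eq: "\<And>a b. 0 < a \<Longrightarrow> a < b \<Longrightarrow>
      (LINT x|M. indicator {a<..<b} (X x) * \<alpha> x) = (LINT y|N. indicator {a<..<b} (Y y) * \<beta> y)"
    and k: "\<And>z. 0 \<le> k z" "\<And>z. z \<le> 0 \<Longrightarrow> k z = 0"
    and kM: "integrable M (\<lambda>x. k (X x) * \<alpha> x)" and kN: "integrable N (\<lambda>y. k (Y y) * \<beta> y)"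
  shows "(LINT x|M. k (X x) * \<alpha> x) = (LINT y|N. k (Y y) * \<beta> y)"
proof -
  have loc: "(LINT x|M. k (X x) * (indicator {a<..<b} (X x) * \<alpha> x))
      = (LINT y|N. k (Y y) * (indicator {a<..<b} (Y y) * \<beta> y))" if ab: "0 < a" "a < b" for a b
  proof -
    \<comment> \<open>Integrability is a premise inside the induction. For nonnegative
      \<open>u\<close> and \<open>v\<close> it passes from the sum to each summand, although the
      weight is signed.\<close>
    have "integrable M (\<lambda>x. k (X x) * (indicator {a<..<b} (X x) * \<alpha> x)) \<longrightarrow>
      integrable N (\<lambda>y. k (Y y) * (indicator {a<..<b} (Y y) * \<beta> y)) \<longrightarrow>
      (LINT x|M. k (X x) * (indicator {a<..<b} (X x) * \<alpha> x))
      = (LINT y|N. k (Y y) * (indicator {a<..<b} (Y y) * \<beta> y))"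
      using meas(5) k(1)
    proof (induction rule: borel_measurable_induct_real)
      case (set A)
      then show ?case
        using signed_pushforward_Int[of X M \<alpha> Y N \<beta> a b A] meas iM iN eq ab by simp
    next
      case (mult u c)
      then show ?case by (cases "c = 0") (simp_all add: mult.assoc)
    next
      case (add u v)
      note [measurable] = add.hyps(1,3)
      show ?case
      proof (intro impI)
        assume i: "integrable M (\<lambda>x. (v (X x) + u (X x)) * (indicator {a<..<b} (X x) * \<alpha> x))"
          "integrable N (\<lambda>x. (v (Y x) + u (Y x)) * (indicator {a<..<b} (Y x) * \<beta> x))"
        have "integrable M (\<lambda>x. v (X x) * (indicator {a<..<b} (X x) * \<alpha> x))"
          "integrable M (\<lambda>x. u (X x) * (indicator {a<..<b} (X x) * \<alpha> x))"
          by (rule Bochner_Integration.integrable_bound[OF i(1)];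
              use add.hyps(2,4) in \<open>auto simp: abs_mult intro!: mult_right_mono\<close>)+
        moreover have "integrable N (\<lambda>x. v (Y x) * (indicator {a<..<b} (Y x) * \<beta> x))"
          "integrable N (\<lambda>x. u (Y x) * (indicator {a<..<b} (Y x) * \<beta> x))"
          by (rule Bochner_Integration.integrable_bound[OF i(2)];
              use add.hyps(2,4) in \<open>auto simp: abs_mult intro!: mult_right_mono\<close>)+
        ultimately show "(LINT x|M. (v (X x) + u (X x)) * (indicator {a<..<b} (X x) * \<alpha> x))
          = (LINT x|N. (v (Y x) + u (Y x)) * (indicator {a<..<b} (Y x) * \<beta> x))"
          using add.IH by (simp add: distrib_right)
      qed
    next
      case (seq U)
      note [measurable] = seq.hyps(1)
      have Uk: "U i z \<le> k z" for i z
        using seq.hyps by (intro incseq_le) (auto simp: incseq_def le_fun_def)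
      have Uk': "U i z \<le> \<bar>k z\<bar>" for i z
        using Uk abs_ge_self order_trans by blast
      show ?case
      proof (intro impI)
        let ?f = "\<lambda>x. indicator {a<..<b} (X x) * \<alpha> x" and ?g = "\<lambda>x. indicator {a<..<b} (Y x) * \<beta> x"
        assume i: "integrable M (\<lambda>x. k (X x) * ?f x)" "integrable N (\<lambda>x. k (Y x) * ?g x)"
        have "integrable M (\<lambda>x. U i (X x) * ?f x)" for i
          by (rule Bochner_Integration.integrable_bound[OF i(1)])
            (use seq.hyps(2) Uk' in \<open>auto simp: abs_mult intro!: mult_right_mono\<close>)
        moreover have "integrable N (\<lambda>x. U i (Y x) * ?g x)" for i
          by (rule Bochner_Integration.integrable_bound[OF i(2)])
            (use seq.hyps(2) Uk' in \<open>auto simp: abs_mult intro!: mult_right_mono\<close>)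
        ultimately have e: "(LINT x|M. U i (X x) * ?f x) = (LINT x|N. U i (Y x) * ?g x)" for i
          using seq.IH by simp
        have "(\<lambda>i. LINT x|M. U i (X x) * ?f x) \<longlonglongrightarrow> (LINT x|M. k (X x) * ?f x)"
          by (rule integral_dominated_convergence[where w="\<lambda>x. \<bar>k (X x) * ?f x\<bar>"])
            (use i integrable_abs[OF i(1)] integrable_abs[OF i(2)] seq.hyps(2,4) Uk' in \<open>auto simp: abs_mult intro!: mult_right_mono tendsto_mult\<close>)
        moreover have "(\<lambda>i. LINT x|N. U i (Y x) * ?g x) \<longlonglongrightarrow> (LINT x|N. k (Y x) * ?g x)"
          by (rule integral_dominated_convergence[where w="\<lambda>x. \<bar>k (Y x) * ?g x\<bar>"])
            (use i integrable_abs[OF i(1)] integrable_abs[OF i(2)] seq.hyps(2,4) Uk' in \<open>auto simp: abs_mult intro!: mult_right_mono tendsto_mult\<close>)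
        ultimately show "(LINT x|M. k (X x) * ?f x) = (LINT x|N. k (Y x) * ?g x)"
          unfolding e by (rule LIMSEQ_unique)
      qed
    qed
    moreover have "integrable M (\<lambda>x. k (X x) * (indicator {a<..<b} (X x) * \<alpha> x))"
      by (rule Bochner_Integration.integrable_bound[OF kM]) (auto simp: indicator_def)
    moreover have "integrable N (\<lambda>x. k (Y x) * (indicator {a<..<b} (Y x) * \<beta> x))"
      by (rule Bochner_Integration.integrable_bound[OF kN]) (auto simp: indicator_def)
    ultimately show ?thesis by simp
  qed
  \<comment> \<open>The shift by 2 puts 1 strictly inside every interval, so each one is nonempty
    and has a positive left end.\<close>
  let ?J = "\<lambda>j::nat. {1 / (real j + 2)<..<real j + 2}"
  have J: "(\<lambda>j. indicator (?J j) z :: real) \<longlonglongrightarrow> indicator {0<..} z" for z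
  proof (cases "z > 0")
    case True
    have "\<forall>\<^sub>F j in sequentially. real j > max z (1 / z)"
      by (rule filterlim_at_top_dense[THEN iffD1, OF filterlim_real_sequentially, THEN spec])
    then have "\<forall>\<^sub>F j in sequentially. (indicator (?J j) z :: real) = 1"
    proof eventually_elim
      case (elim j)
      then have "1 / z < real j + 2" "z < real j + 2" by auto
      then have "1 / (real j + 2) < z" using True by (simp add: divide_less_eq mult.commute)
      then show ?case using \<open>z < real j + 2\<close> by simp
    qed
    then show ?thesis using True by (simp add: tendsto_eventually)
  next
    case False
    have "0 \<le> 1 / (real j + 2)" for j by simp
    then have "(indicator (?J j) z :: real) = 0" for j
      using False by (smt (verit) greaterThanLessThan_iff indicator_simps(2))
    then show ?thesis using False by simp
  qed
  have lim: "(\<lambda>j. k z * (indicator (?J j) z * w)) \<longlonglongrightarrow> k z * w" for z w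
    using tendsto_mult[OF tendsto_const tendsto_mult[OF J tendsto_const], of "k z" z w] k(2)[of z]
    by (cases "z > 0") auto
  have "(\<lambda>j. LINT x|M. k (X x) * (indicator (?J j) (X x) * \<alpha> x)) \<longlonglongrightarrow> (LINT x|M. k (X x) * \<alpha> x)"
    by (rule integral_dominated_convergence[where w="\<lambda>x. \<bar>k (X x) * \<alpha> x\<bar>"])
      (use kM integrable_abs[OF kM] lim in \<open>auto simp: indicator_def\<close>)
  moreover have "(\<lambda>j. LINT x|N. k (Y x) * (indicator (?J j) (Y x) * \<beta> x)) \<longlonglongrightarrow> (LINT x|N. k (Y x) * \<beta> x)"
    by (rule integral_dominated_convergence[where w="\<lambda>x. \<bar>k (Y x) * \<beta> x\<bar>"])
      (use kN integrable_abs[OF kN] lim in \<open>auto simp: indicator_def\<close>)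
  moreover have "1 / (real j + 2) < real j + 2" "0 < 1 / (real j + 2)" for j
    by (rule less_le_trans[of _ 1], auto simp: field_simps)
  ultimately show ?thesis
    using LIMSEQ_unique by (simp add: loc)
qed

text \<open>Up to a null set, the superlevel set \<open>{y < inv_vol}\<close> is the centred ball of volume \<open>1 / y\<close>. At the
  origin \<open>inv_vol\<close> has the junk value \<open>0\<close> instead of \<open>\<infinity>\<close>.\<close>

definition inv_vol :: "real ^ 'n \<Rightarrow> real" where
  "inv_vol x = 1 / (measure lebesgue (ball (0 :: real ^ 'n) 1) * norm x ^ CARD('n))"

abbreviation uvol :: "'n::finite itself \<Rightarrow> real" where
  "uvol _ \<equiv> measure lebesgue (ball (0 :: real ^ 'n) 1)"

lemma uvol_pos: "uvol TYPE('n::finite) > 0"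
  using content_ball_pos[of 1 "0 :: real ^ 'n"] by simp

lemma inv_vol_measurable [measurable]: "inv_vol \<in> borel_measurable borel"
  unfolding inv_vol_def by measurable

lemma inv_vol_0 [simp]: "inv_vol 0 = 0"
  by (simp add: inv_vol_def zero_power)

lemma inv_vol_pos: "inv_vol (x :: real ^ 'n) > 0 \<longleftrightarrow> x \<noteq> 0"
proof (cases "x = 0")
  case False
  then show ?thesis using uvol_pos[where 'n='n] by (simp add: inv_vol_def)
qed simp

lemma inv_vol_gt_iff:
  fixes x :: "real ^ 'n"
  assumes "y > 0"
  shows "y < inv_vol x \<longleftrightarrow> x \<noteq> 0 \<and> norm x < (uvol TYPE('n) * y) powr (- 1 / real CARD('n))"
proof (cases "x = 0")
  case True
  then show ?thesis using assms by simp
next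
  case False
  define n where "n = real CARD('n)"
  have n: "n > 0" by (simp add: n_def)
  note c = uvol_pos[where 'n='n]
  have "norm x < (uvol TYPE('n) * y) powr (- 1 / n) \<longleftrightarrow>
      norm x powr n < ((uvol TYPE('n) * y) powr (- 1 / n)) powr n"
    using n False c assms powr_less_cancel2[of n "norm x" "(uvol TYPE('n) * y) powr (- 1 / n)"]
      powr_less_mono2[of n "norm x" "(uvol TYPE('n) * y) powr (- 1 / n)"] by auto
  also have "((uvol TYPE('n) * y) powr (- 1 / n)) powr n = (uvol TYPE('n) * y) powr (- 1)"
    using n by (simp add: powr_powr)
  also have "norm x powr n < \<dots> \<longleftrightarrow> norm x ^ CARD('n) < 1 / (uvol TYPE('n) * y)"
    using c assms False by (simp add: powr_minus_divide n_def powr_realpow)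
  also have "\<dots> \<longleftrightarrow> y < inv_vol x"
    using c assms False by (simp add: inv_vol_def field_simps)
  finally show ?thesis using False by (simp add: n_def)
qed

lemma emeasure_inv_vol_gt:
  assumes "y > 0"
  shows "emeasure lborel {x :: real ^ 'n. y < inv_vol x} = ennreal (1 / y)"
proof -
  define r where "r = (uvol TYPE('n) * y) powr (- 1 / real CARD('n))"
  note c = uvol_pos[where 'n='n]
  have r: "r > 0" using c assms by (simp add: r_def)
  have rn: "r ^ CARD('n) = 1 / (uvol TYPE('n) * y)"
  proof -
    have "r ^ CARD('n) = r powr real CARD('n)" using r by (simp add: powr_realpow)
    also have "\<dots> = (uvol TYPE('n) * y) powr (- 1)" by (simp add: r_def powr_powr)
    finally show ?thesis using c assms by (simp add: powr_minus_divide)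
  qed
  have "{x :: real ^ 'n. y < inv_vol x} = ball 0 r - {0}"
    unfolding set_eq_iff mem_Collect_eq inv_vol_gt_iff[OF assms] r_def[symmetric] by auto
  then have "emeasure lborel {x :: real ^ 'n. y < inv_vol x} = emeasure lborel (ball (0 :: real ^ 'n) r)"
    by (simp only: emeasure_Diff_null_set[OF finite_imp_null_set_lborel[of "{0 :: real ^ 'n}"]] finite.intros borel_open open_ball sets_lborel)
  also have "\<dots> = ennreal (measure lebesgue (ball (0 :: real ^ 'n) r))"
    using emeasure_lborel_ball_finite[of "0 :: real ^ 'n" r] by (simp add: emeasure_eq_ennreal_measure)
  also have "measure lebesgue (ball (0 :: real ^ 'n) r) = 1 / y"
    using content_ball_conv_unit_ball[of r "0 :: real ^ 'n"] r rn c by (simp add: field_simps)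
  finally show ?thesis .
qed

lemma nn_integral_inverse_square_greaterThan:
  fixes m :: real assumes "m > 0"
  shows "(\<integral>\<^sup>+ y. ennreal (1 / y\<^sup>2) * indicator {m<..} y \<partial>lborel) = ennreal (1 / m)"
proof -
  have "(\<integral>\<^sup>+ y. ennreal (1 / y\<^sup>2) * indicator {m<..} y \<partial>lborel)
      = (\<integral>\<^sup>+ y. ennreal (1 / y\<^sup>2) * indicator {m..} y \<partial>lborel)"
    by (rule nn_integral_cong_AE, rule AE_mp[OF AE_lborel_singleton[of m]], rule AE_I2) (auto simp: indicator_def)
  also have "\<dots> = ennreal (0 - (- 1 / m))"
  proof (rule nn_integral_FTC_atLeast)
    show "((\<lambda>y::real. - 1 / y) \<longlongrightarrow> 0) at_top"
      using tendsto_minus[OF tendsto_inverse_0_at_top[OF filterlim_ident[of at_top]]]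
      by (simp add: divide_inverse)
    fix y assume "m \<le> y"
    then have "((\<lambda>y. - 1 / y) has_real_derivative 1 / y\<^sup>2) (at y)"
      using assms by (auto intro!: derivative_eq_intros simp: field_simps power2_eq_square)
    then show "((\<lambda>y. - 1 / y) has_real_derivative 1 / y\<^sup>2) (at y)" .
  qed auto
  finally show ?thesis by simp
qed

text \<open>The measure dy/y^2 is infinite near 0. The parts above a level \<open>e\<close> are
  compared first: there both measures give the half-line beyond \<open>y\<close> the finite mass 1 /
  max e y. Then \<open>e\<close> decreases to 0 by monotone convergence.\<close>

lemma nn_integral_inv_vol:
  assumes [measurable]: "k \<in> borel_measurable borel"
  shows "(\<integral>\<^sup>+ x. k (inv_vol (x :: real ^ 'n)) * indicator {0<..} (inv_vol x) \<partial>lborel)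
    = (\<integral>\<^sup>+ y. k y * (ennreal (1 / y\<^sup>2) * indicator {0<..} y) \<partial>lborel)"
proof -
  let ?e = "\<lambda>j::nat. 1 / (real j + 1)"
  have eq: "(\<integral>\<^sup>+ x. k (inv_vol (x :: real ^ 'n)) * indicator {e<..} (inv_vol x) \<partial>lborel)
    = (\<integral>\<^sup>+ y. k y * (ennreal (1 / y\<^sup>2) * indicator {e<..} y) \<partial>lborel)" if e: "e > 0" for e
  proof -
    let ?M = "distr (density lborel (\<lambda>x :: real ^ 'n. indicator {e<..} (inv_vol x))) borel inv_vol"
    let ?N = "density lborel (\<lambda>y. ennreal (1 / y\<^sup>2) * indicator {e<..} y)"
    have M: "emeasure ?M {y<..} = ennreal (1 / max e y)" for y
    proof -
      have "emeasure ?M {y<..} = (\<integral>\<^sup>+ x. indicator {x :: real ^ 'n. max e y < inv_vol x} x \<partial>lborel)"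
      proof -
        have [measurable]: "(inv_vol :: real ^ 'n \<Rightarrow> real) -` {y<..} \<in> sets borel"
          using measurable_sets[OF inv_vol_measurable, of "{y<..}"] by simp
        have "emeasure ?M {y<..} = (\<integral>\<^sup>+ x. indicator {e<..} (inv_vol x) * indicator (inv_vol -` {y<..}) (x :: real ^ 'n) \<partial>lborel)"
          by (simp add: emeasure_distr emeasure_density)
        also have "\<dots> = (\<integral>\<^sup>+ x. indicator {x :: real ^ 'n. max e y < inv_vol x} x \<partial>lborel)"
          by (intro nn_integral_cong) (auto simp: indicator_def)
        finally show ?thesis .
      qed
      also have "\<dots> = emeasure lborel {x :: real ^ 'n. max e y < inv_vol x}"
        by (rule nn_integral_indicator) simp
      finally show ?thesis using emeasure_inv_vol_gt[of "max e y", where 'n='n] e by simp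
    qed
    have N: "emeasure ?N {y<..} = ennreal (1 / max e y)" for y
    proof -
      have "emeasure ?N {y<..} = (\<integral>\<^sup>+ z. ennreal (1 / z\<^sup>2) * indicator {max e y<..} z \<partial>lborel)"
        by (subst emeasure_density, simp, simp)
          (auto intro!: nn_integral_cong simp: indicator_def)
      then show ?thesis using nn_integral_inverse_square_greaterThan[of "max e y"] e by simp
    qed
    have "?M = ?N"
      by (rule measure_eqI_lessThan) (auto simp: M N)
    then have "(\<integral>\<^sup>+ y. k y \<partial>?M) = (\<integral>\<^sup>+ y. k y \<partial>?N)" by simp
    then show ?thesis
      by (simp add: nn_integral_distr nn_integral_density mult_ac)
  qed
  have S: "(SUP j. indicator {?e j<..} y) = (indicator {0<..} y :: ennreal)" for y
  proof (rule antisym)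
    show "(SUP j. indicator {?e j<..} y) \<le> (indicator {0<..} y :: ennreal)"
    proof (rule SUP_least)
      fix j
      have "0 < ?e j" by simp
      then show "indicator {?e j<..} y \<le> (indicator {0<..} y :: ennreal)"
        using less_trans[of 0 "?e j" y] by (simp only: indicator_def) auto
    qed
    show "(indicator {0<..} y :: ennreal) \<le> (SUP j. indicator {?e j<..} y)"
    proof (cases "y > 0")
      case True
      then obtain j where "?e j < y" using nat_approx_posE[of y] by (auto simp: add.commute)
      then show ?thesis using True by (intro SUP_upper2[of j]) (simp_all add: indicator_def)
    qed simp
  qed
  have mono: "incseq (\<lambda>j. indicator {?e j<..} y :: ennreal)" for y
    by (auto simp: incseq_def indicator_def frac_le intro: le_less_trans[rotated])
  have "(\<integral>\<^sup>+ x. k (inv_vol (x :: real ^ 'n)) * indicator {0<..} (inv_vol x) \<partial>lborel)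
    = (\<integral>\<^sup>+ x. (SUP j. k (inv_vol (x :: real ^ 'n)) * indicator {?e j<..} (inv_vol x)) \<partial>lborel)"
    by (simp add: S[symmetric] SUP_mult_left_ennreal)
  also have "\<dots> = (SUP j. \<integral>\<^sup>+ x. k (inv_vol (x :: real ^ 'n)) * indicator {?e j<..} (inv_vol x) \<partial>lborel)"
    using mono by (intro nn_integral_monotone_convergence_SUP)
      (auto simp: incseq_def le_fun_def intro!: mult_left_mono)
  also have "\<dots> = (SUP j. \<integral>\<^sup>+ y. k y * (ennreal (1 / y\<^sup>2) * indicator {?e j<..} y) \<partial>lborel)"
    by (intro SUP_cong refl eq) simp
  also have "\<dots> = (\<integral>\<^sup>+ y. (SUP j. k y * (ennreal (1 / y\<^sup>2) * indicator {?e j<..} y)) \<partial>lborel)"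
    using mono by (intro nn_integral_monotone_convergence_SUP[symmetric])
      (auto simp: incseq_def le_fun_def intro!: mult_left_mono)
  also have "\<dots> = (\<integral>\<^sup>+ y. k y * (ennreal (1 / y\<^sup>2) * indicator {0<..} y) \<partial>lborel)"
    by (simp add: S[symmetric] SUP_mult_left_ennreal)
  finally show ?thesis .
qed

lemma AE_inv_vol_notin_null_set:
  assumes "A \<in> null_sets lborel"
  shows "AE x :: real ^ 'n in lborel. \<not> (0 < inv_vol x \<and> inv_vol x \<in> A)"
proof -
  have [measurable]: "A \<in> sets borel" using assms by (auto simp: null_sets_def)
  have "(\<integral>\<^sup>+ x. indicator A (inv_vol (x :: real ^ 'n)) * indicator {0<..} (inv_vol x) \<partial>lborel)
      = (\<integral>\<^sup>+ z. indicator A z * (ennreal (1 / z\<^sup>2) * indicator {0<..} z) \<partial>lborel)"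
    by (rule nn_integral_inv_vol) simp
  also have "\<dots> = (\<integral>\<^sup>+ z. 0 \<partial>(lborel :: real measure))"
    using AE_not_in[OF assms] by (intro nn_integral_cong_AE) (auto elim!: eventually_mono)
  finally have "(\<integral>\<^sup>+ x. indicator A (inv_vol (x :: real ^ 'n)) * indicator {0<..} (inv_vol x) \<partial>lborel) = 0" by simp
  then have "AE x :: real ^ 'n in lborel. indicator A (inv_vol x) * indicator {0<..} (inv_vol x) = (0 :: ennreal)"
    by (subst (asm) nn_integral_0_iff_AE) auto
  then show ?thesis by eventually_elim (auto simp: indicator_def split: if_splits)
qed

section \<open>Displacement convexity on the line\<close>

text \<open>Write X^a Y^(1-p) as Y (X^(a/p) / Y)^p. The inner power is convex because a >= p, and
  the outer expression is the perspective of z^p: Jensen's inequality is applied with the weights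
  \<open>q0\<close> and \<open>q1\<close>, which are the shares of \<open>Y0\<close> and
  \<open>Y1\<close> in the mean \<open>Y\<close>.\<close>

lemma weighted_powr_convex:
  fixes p a :: real
  assumes p: "1 < p" "p \<le> a" and X: "X0 > 0" "X1 > 0" and Y: "Y0 > 0" "Y1 > 0"
    and s: "s0 \<ge> 0" "s1 \<ge> 0" "s0 + s1 = 1"
  shows "(s0 * X0 + s1 * X1) powr a * (s0 * Y0 + s1 * Y1) powr (1 - p)
    \<le> s0 * (X0 powr a * Y0 powr (1 - p)) + s1 * (X1 powr a * Y1 powr (1 - p))"
proof -
  have conv: "(q0 * z0 + q1 * z1) powr r \<le> q0 * z0 powr r + q1 * z1 powr r"
    if "r \<ge> 1" "q0 \<ge> 0" "q1 \<ge> 0" "q0 + q1 = 1" "z0 > 0" "z1 > 0" for q0 q1 z0 z1 r :: real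
    using convex_onD[OF powr_convex[OF that(1)], of q1 z0 z1] that
    by (simp add: eq_diff_eq[of q0 1 q1, symmetric])
  define Z0 where "Z0 = X0 powr (a / p)"
  define Z1 where "Z1 = X1 powr (a / p)"
  have Z: "Z0 > 0" "Z1 > 0" "Z0 powr p = X0 powr a" "Z1 powr p = X1 powr a"
    using X p by (auto simp: Z0_def Z1_def powr_powr)
  have pos: "s0 * A + s1 * B > 0" if "A > 0" "B > 0" for A B :: real
    using s that by (cases "s0 = 0") (auto intro!: add_pos_nonneg)
  define Y where "Y = s0 * Y0 + s1 * Y1"
  have Ypos: "Y > 0" using pos Y by (simp add: Y_def)
  define q0 where "q0 = s0 * Y0 / Y"
  define q1 where "q1 = s1 * Y1 / Y"
  have q: "q0 \<ge> 0" "q1 \<ge> 0" "q0 + q1 = 1"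
    using Ypos Y s by (auto simp: q0_def q1_def Y_def add_divide_distrib[symmetric])
  have "(s0 * X0 + s1 * X1) powr a = ((s0 * X0 + s1 * X1) powr (a / p)) powr p"
    using p by (simp add: powr_powr)
  also have "\<dots> \<le> (s0 * Z0 + s1 * Z1) powr p"
    unfolding Z0_def Z1_def using p X s by (intro powr_mono2 conv) auto
  also have "s0 * Z0 + s1 * Z1 = Y * (q0 * (Z0 / Y0) + q1 * (Z1 / Y1))"
    using Ypos Y by (simp add: q0_def q1_def field_simps)
  also have "(Y * (q0 * (Z0 / Y0) + q1 * (Z1 / Y1))) powr p
      = Y powr p * (q0 * (Z0 / Y0) + q1 * (Z1 / Y1)) powr p"
    using Ypos q Z Y by (intro powr_mult)
  also have "\<dots> \<le> Y powr p * (q0 * (Z0 / Y0) powr p + q1 * (Z1 / Y1) powr p)"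
    using p q Z Y by (intro mult_left_mono conv) auto
  finally have "(s0 * X0 + s1 * X1) powr a * Y powr (1 - p)
      \<le> Y powr p * (q0 * (Z0 / Y0) powr p + q1 * (Z1 / Y1) powr p) * Y powr (1 - p)"
    by (intro mult_right_mono) auto
  also have "\<dots> = (Y powr p * Y powr (1 - p)) * (q0 * (Z0 / Y0) powr p + q1 * (Z1 / Y1) powr p)"
    by simp
  also have "Y powr p * Y powr (1 - p) = Y" using Ypos by (simp add: powr_add[symmetric])
  also have "Y * (q0 * (Z0 / Y0) powr p + q1 * (Z1 / Y1) powr p)
      = s0 * (Y0 * (Z0 / Y0) powr p) + s1 * (Y1 * (Z1 / Y1) powr p)"
    using Ypos by (simp add: q0_def q1_def field_simps)
  also have "Y0 * (Z0 / Y0) powr p = X0 powr a * Y0 powr (1 - p)"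
    using Z Y by (simp add: powr_divide powr_diff)
  also have "Y1 * (Z1 / Y1) powr p = X1 powr a * Y1 powr (1 - p)"
    using Z Y by (simp add: powr_divide powr_diff)
  finally show ?thesis by (simp add: Y_def)
qed

section \<open>Laws of functions on the unit interval\<close>

abbreviation unit_lborel :: "real measure" where
  "unit_lborel \<equiv> restrict_space lborel {0<..<1}"

lemma space_unit_lborel: "space unit_lborel = {0<..<1}"
  by (simp add: space_restrict_space)

lemma prob_space_unit_lborel: "prob_space unit_lborel"
  by (rule prob_spaceI) (simp add: space_unit_lborel emeasure_restrict_space)

lemma mono_on_unit_measurable:
  "mono_on {0<..<1} u \<Longrightarrow> u \<in> borel_measurable unit_lborel" for u :: "real \<Rightarrow> real"
  using borel_measurable_mono_on_fnc
  by (subst measurable_cong_sets[where M'="restrict_space borel {0<..<1}"]) (auto simp: sets_restrict_space)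

text \<open>A relation rather than a chosen density: \<open>\<rho>\<close> is determined only up to
  null sets, and each construction supplies its own version.\<close>

definition has_law :: "(real \<Rightarrow> real) \<Rightarrow> (real \<Rightarrow> real) \<Rightarrow> bool" where
  "has_law u \<rho> \<longleftrightarrow> u \<in> borel_measurable unit_lborel \<and> \<rho> \<in> borel_measurable borel \<and> (\<forall>y. 0 \<le> \<rho> y) \<and>
     distr unit_lborel borel u = density lborel (\<lambda>y. ennreal (\<rho> y))"

lemma has_law_nn_integral:
  assumes "has_law u \<rho>" and [measurable]: "k \<in> borel_measurable borel"
  shows "(\<integral>\<^sup>+ m. k (u m) \<partial>unit_lborel) = (\<integral>\<^sup>+ y. ennreal (\<rho> y) * k y \<partial>lborel)"
proof -
  have [measurable]: "u \<in> borel_measurable unit_lborel" "\<rho> \<in> borel_measurable borel"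
    using assms by (auto simp: has_law_def)
  have "(\<integral>\<^sup>+ m. k (u m) \<partial>unit_lborel) = (\<integral>\<^sup>+ y. k y \<partial>distr unit_lborel borel u)"
    by (simp add: nn_integral_distr)
  also have "\<dots> = (\<integral>\<^sup>+ y. k y \<partial>density lborel (\<lambda>y. ennreal (\<rho> y)))"
    using assms by (simp add: has_law_def)
  finally show ?thesis by (simp add: nn_integral_density)
qed

lemma has_law_AE_neq:
  assumes "has_law u \<rho>"
  shows "AE m in unit_lborel. u m \<noteq> z"
proof -
  have [measurable]: "u \<in> borel_measurable unit_lborel" "\<rho> \<in> borel_measurable borel"
    using assms by (auto simp: has_law_def)
  have "(\<integral>\<^sup>+ m. indicator {z} (u m) \<partial>unit_lborel) = (\<integral>\<^sup>+ y. ennreal (\<rho> y) * indicator {z} y \<partial>lborel)"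
    by (rule has_law_nn_integral[OF assms]) simp
  also have "\<dots> = (\<integral>\<^sup>+ y. 0 \<partial>(lborel :: real measure))"
    by (rule nn_integral_cong_AE, rule AE_mp[OF AE_lborel_singleton[of z]], rule AE_I2) (auto simp: indicator_def)
  finally have "(\<integral>\<^sup>+ m. indicator {z} (u m) \<partial>unit_lborel) = 0" by simp
  then have "AE m in unit_lborel. (indicator {z} (u m) :: ennreal) = 0"
    by (subst (asm) nn_integral_0_iff_AE) auto
  then show ?thesis by eventually_elim (auto simp: indicator_def split: if_splits)
qed

section \<open>Stieltjes measures in place of derivatives of monotone functions\<close>

lemma sets_borel_Ioc: "sets borel = sigma_sets UNIV (range (\<lambda>(a, b). {a<..b::real}))"
  by (subst borel_sigma_sets_Ioc) (rule sets_measure_of, auto)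

lemma UN_Ioc_eq_UNIV: "(\<Union>i::nat. {- real i<..real i}) = UNIV"
proof -
  have "\<exists>i::nat. - real i < x \<and> x \<le> real i" for x
    using reals_Archimedean2[of "\<bar>x\<bar>"] by (metis abs_less_iff less_imp_le minus_less_iff)
  then show ?thesis by auto
qed

text \<open>The increments of the identity over half-open intervals are their lengths, and such
  intervals determine the measure. This plays the role of the differentiated relation s0 L0' + s1
  L1' = 1.\<close>

lemma interval_measure_sum_eq_lborel:
  fixes L0 L1 :: "real \<Rightarrow> real"
  assumes mono: "mono L0" "mono L1" and cont: "continuous_on UNIV L0" "continuous_on UNIV L1"
    and s: "s0 > 0" "s1 > 0" and id: "\<And>y. s0 * L0 y + s1 * L1 y = y"
    and A: "A \<in> sets borel"
  shows "ennreal s0 * emeasure (interval_measure L0) A + ennreal s1 * emeasure (interval_measure L1) A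
    = emeasure lborel A"
proof -
  let ?\<mu> = "\<lambda>A. ennreal s0 * emeasure (interval_measure L0) A + ennreal s1 * emeasure (interval_measure L1) A"
  let ?M = "measure_of UNIV (sets borel) ?\<mu>"
  have em: "emeasure ?M A = ?\<mu> A" if "A \<in> sets borel" for A
  proof (rule emeasure_measure_of_sigma)
    show "sigma_algebra UNIV (sets borel)"
      using sets.sigma_algebra_axioms[of borel] by simp
    show "positive (sets borel) ?\<mu>" by (simp add: positive_def)
    show "countably_additive (sets borel) ?\<mu>"
    proof (rule countably_additiveI)
      fix B :: "nat \<Rightarrow> real set" assume B: "range B \<subseteq> sets borel" "disjoint_family B"
      have "(\<Sum>i. emeasure (interval_measure L) (B i)) = emeasure (interval_measure L) (\<Union>i. B i)" for L
        using B by (intro suminf_emeasure) auto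
      then show "(\<Sum>i. ?\<mu> (B i)) = ?\<mu> (\<Union>i. B i)"
        by (simp add: suminf_add[symmetric] ennreal_suminf_cmult)
    qed
  qed fact
  have Ioc: "emeasure (interval_measure L) {a<..b} = ennreal (L b - L a)"
    if "a \<le> b" "mono L" "continuous_on UNIV L" for a b and L :: "real \<Rightarrow> real"
    using that by (intro emeasure_interval_measure_Ioc)
      (auto simp: mono_def continuous_on_eq_continuous_within intro: continuous_within_subset)
  have eq: "?\<mu> {a<..b} = emeasure lborel {a<..b}" for a b
  proof (cases "a \<le> b")
    case True
    have "?\<mu> {a<..b} = ennreal (s0 * (L0 b - L0 a) + s1 * (L1 b - L1 a))"
      using True mono cont s
      by (simp add: Ioc ennreal_mult' ennreal_plus mono_def)
    also have "s0 * (L0 b - L0 a) + s1 * (L1 b - L1 a) = b - a"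
      using id[of a] id[of b] by (simp add: algebra_simps)
    finally show ?thesis using True by simp
  qed simp
  have "?M = lborel"
  proof (rule measure_eqI_generator_eq[where \<Omega>=UNIV])
    show "Int_stable (range (\<lambda>(a, b). {a<..b::real}))" by (auto simp: Int_stable_def)
    show "sets ?M = sigma_sets UNIV (range (\<lambda>(a, b). {a<..b::real}))"
      using sets.sigma_sets_eq[of "borel :: real measure"] by (simp add: sets_borel_Ioc[symmetric])
    show "sets lborel = sigma_sets UNIV (range (\<lambda>(a, b). {a<..b::real}))"
      by (simp add: sets_borel_Ioc[symmetric])
    show "(\<Union>i. {- real (i::nat)<..real i}) = UNIV" by (rule UN_Ioc_eq_UNIV)
    show "emeasure ?M {- real (i::nat)<..real i} \<noteq> \<infinity>" for i
      using em eq by simp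
  qed (use em eq in auto)
  then show ?thesis using em[OF A] by simp
qed

text \<open>As \<open>s0\<close> and \<open>s1\<close> are positive, a Lebesgue null set is null for
  both Stieltjes measures, which therefore have densities. The functions \<open>l0\<close> and
  \<open>l1\<close> stand for the derivatives of \<open>L0\<close> and \<open>L1\<close>.\<close>

lemma interval_measure_densities:
  fixes L0 L1 :: "real \<Rightarrow> real"
  assumes mono: "mono L0" "mono L1" and cont: "continuous_on UNIV L0" "continuous_on UNIV L1"
    and s: "s0 > 0" "s1 > 0" and id: "\<And>y. s0 * L0 y + s1 * L1 y = y"
  obtains l0 l1 where "l0 \<in> borel_measurable borel" "l1 \<in> borel_measurable borel"
    "interval_measure L0 = density lborel l0" "interval_measure L1 = density lborel l1"
    "AE y in lborel. ennreal s0 * l0 y + ennreal s1 * l1 y = 1"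
proof -
  note sum = interval_measure_sum_eq_lborel[OF assms]
  have ac: "absolutely_continuous lborel (interval_measure L0)" "absolutely_continuous lborel (interval_measure L1)"
  proof -
    have "emeasure (interval_measure L0) A = 0 \<and> emeasure (interval_measure L1) A = 0"
      if "A \<in> null_sets lborel" for A
      using sum[of A] that s by (auto simp: null_sets_def)
    then show "absolutely_continuous lborel (interval_measure L0)" "absolutely_continuous lborel (interval_measure L1)"
      by (auto simp: absolutely_continuous_def null_sets_def)
  qed
  define l0 where "l0 = RN_deriv lborel (interval_measure L0)"
  define l1 where "l1 = RN_deriv lborel (interval_measure L1)"
  have [measurable]: "l0 \<in> borel_measurable borel" "l1 \<in> borel_measurable borel"
    using borel_measurable_RN_deriv[of lborel] by (auto simp: l0_def l1_def)
  have d: "interval_measure L0 = density lborel l0" "interval_measure L1 = density lborel l1"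
    unfolding l0_def l1_def using ac by (auto intro!: sigma_finite_measure.density_RN_deriv[OF sigma_finite_lborel, symmetric])
  have "density lborel (\<lambda>y. ennreal s0 * l0 y + ennreal s1 * l1 y) = density lborel (\<lambda>y. 1)"
  proof (rule measure_eqI)
    fix A assume "A \<in> sets (density lborel (\<lambda>y. ennreal s0 * l0 y + ennreal s1 * l1 y))"
    then have [measurable]: "A \<in> sets borel" by simp
    have "emeasure (density lborel (\<lambda>y. ennreal s0 * l0 y + ennreal s1 * l1 y)) A
      = ennreal s0 * (\<integral>\<^sup>+ y. l0 y * indicator A y \<partial>lborel) + ennreal s1 * (\<integral>\<^sup>+ y. l1 y * indicator A y \<partial>lborel)"
      by (simp add: emeasure_density distrib_right nn_integral_add nn_integral_cmult mult.assoc)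
    also have "\<dots> = emeasure lborel A"
      using sum[of A] by (simp add: d emeasure_density)
    finally show "emeasure (density lborel (\<lambda>y. ennreal s0 * l0 y + ennreal s1 * l1 y)) A
      = emeasure (density lborel (\<lambda>y. 1)) A" by (simp add: emeasure_density)
  qed simp
  then have "AE y in lborel. ennreal s0 * l0 y + ennreal s1 * l1 y = 1"
    by (subst (asm) sigma_finite_measure.density_unique_iff[OF sigma_finite_lborel]) auto
  then show ?thesis using that[of l0 l1] d by simp
qed

text \<open>Flat stretches of \<open>L\<close> carry no Stieltjes mass, so the substitution z = L y
  holds even where \<open>L\<close> is not injective. The two measures are compared on half-lines,
  whose preimages in (a, b] are again half-open intervals.\<close>

lemma interval_measure_pushforward_self:
  fixes L :: "real \<Rightarrow> real"
  assumes mono: "mono L" and cont: "continuous_on UNIV L" and ab: "a \<le> b"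
    and [measurable]: "k \<in> borel_measurable borel"
  shows "(\<integral>\<^sup>+ y. k (L y) * indicator {a<..b} y \<partial>interval_measure L) = (\<integral>\<^sup>+ z. k z * indicator {L a<..L b} z \<partial>lborel)"
proof -
  have [measurable]: "L \<in> borel_measurable borel"
    using mono borel_measurable_mono by blast
  have Ioc: "emeasure (interval_measure L) {a<..b} = ennreal (L b - L a)" if "a \<le> b" for a b
    using that mono cont by (intro emeasure_interval_measure_Ioc)
      (auto simp: mono_def continuous_on_eq_continuous_within intro: continuous_within_subset)
  let ?M = "distr (density (interval_measure L) (indicator {a<..b})) borel L"
  let ?N = "density lborel (indicator {L a<..L b})"
  have Lab: "L a \<le> L b" using mono ab by (simp add: mono_def)
  have N: "emeasure ?N {z<..} = ennreal (L b - max (L a) z)" for z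
  proof -
    have "{L a<..L b} \<inter> {z<..} = {max (L a) z<..L b}" by auto
    then have "emeasure ?N {z<..} = emeasure lborel {max (L a) z<..L b}"
      by (simp add: emeasure_density indicator_inter_arith[symmetric])
    then show ?thesis
      by (cases "max (L a) z \<le> L b") (auto simp: ennreal_neg)
  qed
  have M: "emeasure ?M {z<..} = ennreal (L b - max (L a) z)" for z
  proof -
    have e: "emeasure ?M {z<..} = emeasure (interval_measure L) ({a<..b} \<inter> L -` {z<..})"
    proof -
      have [measurable]: "L -` {z<..} \<in> sets borel"
        using measurable_sets[of L borel borel "{z<..}"] by simp
      show ?thesis
        by (simp add: emeasure_distr emeasure_density indicator_inter_arith[symmetric])
    qed
    consider "z < L a" | "L b \<le> z" | "L a \<le> z" "z < L b" by linarith
    then show ?thesis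
    proof cases
      case 1
      have "z < L y" if "a < y" for y using that 1 monoD[OF mono, of a y] by simp
      then have "{a<..b} \<inter> L -` {z<..} = {a<..b}" by auto
      then show ?thesis using e 1 Ioc ab by simp
    next
      case 2
      have "L y \<le> z" if "y \<le> b" for y using that 2 monoD[OF mono, of y b] by simp
      then have "{a<..b} \<inter> L -` {z<..} = {}" by fastforce
      then show ?thesis using e 2 Lab by (simp add: ennreal_neg)
    next
      case 3
      \<comment> \<open>The maximum \<open>s\<close> of this set is the last point at which
        \<open>L\<close> takes the value \<open>z\<close>. If \<open>L\<close> is flat at that
        height, the set where \<open>L\<close> exceeds \<open>z\<close> starts only at the right end
        of the stretch.\<close>
      let ?S = "{y \<in> {a..b}. L y = z}"
      have ca: "continuous_on {a..b} L" using cont continuous_on_subset by blast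
      have ne: "?S \<noteq> {}" using IVT'[of L a z b] 3 ab ca by auto
      have "compact ?S"
        using ca by (intro compact_eq_bounded_closed[THEN iffD2] conjI continuous_closed_preimage_constant)
          (auto intro: bounded_subset[OF bounded_closed_interval[of a b]])
      from compact_attains_sup[OF this ne]
      obtain s where s: "s \<in> ?S" "\<And>y. y \<in> ?S \<Longrightarrow> y \<le> s" by blast
      have "{a<..b} \<inter> L -` {z<..} = {s<..b}"
      proof (intro set_eqI iffI)
        fix y assume y: "y \<in> {a<..b} \<inter> L -` {z<..}"
        then have "\<not> y \<le> s" using monoD[OF mono, of y s] s(1) by auto
        then show "y \<in> {s<..b}" using y by auto
      next
        fix y assume y: "y \<in> {s<..b}"
        then have "z \<le> L y" using monoD[OF mono, of s y] s(1) by auto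
        moreover have "L y \<noteq> z" using s(1) s(2)[of y] y by auto
        ultimately show "y \<in> {a<..b} \<inter> L -` {z<..}" using y s(1) by auto
      qed
      then show ?thesis using e 3 s(1) Ioc[of s b] by simp
    qed
  qed
  have "?M = ?N"
    by (rule measure_eqI_lessThan) (auto simp: M N)
  then have "(\<integral>\<^sup>+ y. k y \<partial>?M) = (\<integral>\<^sup>+ y. k y \<partial>?N)" by simp
  then show ?thesis by (simp add: nn_integral_distr nn_integral_density mult_ac)
qed

text \<open>Formally the density of \<open>w\<close> is rho(L) L', with \<open>l\<close> in the
  place of L'. The events w in (a, b] and u in (L a, L b] differ only where \<open>u\<close> takes
  the value L a or L b, which has probability zero because the law of \<open>u\<close> has no
  atoms.\<close>

lemma has_law_compose:
  fixes L :: "real \<Rightarrow> real"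
  assumes law: "has_law u \<rho>" and [measurable]: "w \<in> borel_measurable unit_lborel"
    and mono: "mono L" and cont: "continuous_on UNIV L"
    and Lw: "\<And>m. m \<in> {0<..<1} \<Longrightarrow> L (w m) = u m"
    and [measurable]: "l \<in> borel_measurable borel" and l: "interval_measure L = density lborel l"
  shows "distr unit_lborel borel w = density lborel (\<lambda>y. ennreal (\<rho> (L y)) * l y)"
proof -
  interpret prob_space unit_lborel by (rule prob_space_unit_lborel)
  have [measurable]: "u \<in> borel_measurable unit_lborel" "\<rho> \<in> borel_measurable borel"
    using law by (auto simp: has_law_def)
  have [measurable]: "L \<in> borel_measurable borel"
    using mono borel_measurable_mono by blast
  let ?M = "distr unit_lborel borel w" and ?N = "density lborel (\<lambda>y. ennreal (\<rho> (L y)) * l y)"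
  have eq: "emeasure ?M {a<..b} = emeasure ?N {a<..b}" for a b
  proof (cases "a \<le> b")
    case True
    have "emeasure ?M {a<..b} = (\<integral>\<^sup>+ m. indicator {a<..b} (w m) \<partial>unit_lborel)"
      using nn_integral_distr[of w unit_lborel borel "indicator {a<..b}"] by simp
    also have "\<dots> = (\<integral>\<^sup>+ m. indicator {L a<..L b} (u m) \<partial>unit_lborel)"
    proof (rule nn_integral_cong_AE)
      show "AE m in unit_lborel. (indicator {a<..b} (w m) :: ennreal) = indicator {L a<..L b} (u m)"
        using has_law_AE_neq[OF law, of "L a"] has_law_AE_neq[OF law, of "L b"] AE_space
      proof eventually_elim
        case (elim m)
        then have "L (w m) = u m" using Lw by (simp add: space_unit_lborel)
        then have "w m \<in> {a<..b} \<longleftrightarrow> u m \<in> {L a<..L b}"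
          using elim(1,2) mono[THEN monoD, of a "w m"] mono[THEN monoD, of "w m" b]
            mono[THEN monoD, of "w m" a] mono[THEN monoD, of b "w m"]
          unfolding greaterThanAtMost_iff by linarith
        then show ?case by (simp only: indicator_def)
      qed
    qed
    also have "\<dots> = (\<integral>\<^sup>+ z. ennreal (\<rho> z) * indicator {L a<..L b} z \<partial>lborel)"
      by (rule has_law_nn_integral[OF law]) simp
    also have "\<dots> = (\<integral>\<^sup>+ y. ennreal (\<rho> (L y)) * indicator {a<..b} y \<partial>interval_measure L)"
      by (rule interval_measure_pushforward_self[OF mono cont True, symmetric]) simp
    also have "\<dots> = emeasure ?N {a<..b}"
      by (simp add: l nn_integral_density emeasure_density mult_ac)
    finally show ?thesis .
  qed simp
  show ?thesis
  proof (rule measure_eqI_generator_eq[where \<Omega>=UNIV])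
    show "Int_stable (range (\<lambda>(a, b). {a<..b::real}))" by (auto simp: Int_stable_def)
    show "sets ?M = sigma_sets UNIV (range (\<lambda>(a, b). {a<..b::real}))"
      "sets ?N = sigma_sets UNIV (range (\<lambda>(a, b). {a<..b::real}))"
      by (simp_all add: sets_borel_Ioc[symmetric])
    show "(\<Union>i. {- real (i::nat)<..real i}) = UNIV" by (rule UN_Ioc_eq_UNIV)
    show "emeasure ?M {- real (i::nat)<..real i} \<noteq> \<infinity>" for i
      by (simp add: emeasure_distr)
  qed (use eq in auto)
qed

text \<open>The map \<open>w m \<mapsto> u0 m\<close> is monotone and Lipschitz with constant \<open>1 / s0\<close>; \<open>L0\<close> is its McShane
  extension, which keeps \<open>L1\<close> monotone as well.\<close>

lemma displacement_factor:
  fixes u0 u1 w :: "real \<Rightarrow> real"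
  assumes mono: "mono_on {0<..<1} u0" "mono_on {0<..<1} u1"
    and pos: "\<And>m. m \<in> {0<..<1} \<Longrightarrow> 0 < u0 m"
    and s: "s0 > 0" "s1 > 0" and w: "\<And>m. w m = s0 * u0 m + s1 * u1 m"
  obtains L0 L1 where "mono L0" "mono L1" "continuous_on UNIV L0" "continuous_on UNIV L1"
    "\<And>y. s0 * L0 y + s1 * L1 y = y"
    "\<And>m. m \<in> {0<..<1} \<Longrightarrow> L0 (w m) = u0 m" "\<And>m. m \<in> {0<..<1} \<Longrightarrow> L1 (w m) = u1 m"
proof -
  define g where "g = (\<lambda>y m. u0 m + max 0 ((y - w m) / s0))"
  define L0 where "L0 = (\<lambda>y. INF m\<in>{0<..<1}. g y m)"
  define L1 where "L1 = (\<lambda>y. (y - s0 * L0 y) / s1)"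
  have ne: "{0<..<1::real} \<noteq> {}" by simp
  \<comment> \<open>Positivity of \<open>u0\<close> supplies the lower bound that makes the infimum
    finite.\<close>
  have bdd: "bdd_below (g y ` {0<..<1})" for y
    using pos by (intro bdd_belowI2[of _ 0]) (force simp: g_def intro: add_nonneg_nonneg less_imp_le)
  have L0_le: "L0 y \<le> g y m" if "m \<in> {0<..<1}" for y m
    unfolding L0_def by (rule cINF_lower[OF bdd that])
  have L0_ge: "c \<le> L0 y" if "\<And>m. m \<in> {0<..<1} \<Longrightarrow> c \<le> g y m" for c y
    unfolding L0_def using ne that by (rule cINF_greatest)
  have mL0: "L0 y \<le> L0 z" if "y \<le> z" for y z
  proof (rule L0_ge)
    fix m :: real assume m: "m \<in> {0<..<1}"
    have "(y - w m) / s0 \<le> (z - w m) / s0" using that s by (intro divide_right_mono) auto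
    then show "L0 y \<le> g z m" using L0_le[OF m, of y] by (simp add: g_def)
  qed
  \<comment> \<open>The constant 1/s0 is exactly what makes y - s0 L0(y), and with it
    \<open>L1\<close>, monotone.\<close>
  have lip: "L0 z \<le> L0 y + (z - y) / s0" if "y \<le> z" for y z
  proof -
    have "L0 z - (z - y) / s0 \<le> L0 y"
    proof (rule L0_ge)
      fix m :: real assume m: "m \<in> {0<..<1}"
      have "(z - w m) / s0 = (y - w m) / s0 + (z - y) / s0" by (simp add: add_divide_distrib[symmetric])
      moreover have "0 \<le> (z - y) / s0" using that s by simp
      ultimately show "L0 z - (z - y) / s0 \<le> g y m" using L0_le[OF m, of z] by (simp add: g_def)
    qed
    then show ?thesis by simp
  qed
  have "mono L0" using mL0 by (rule monoI)
  moreover have "mono L1"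
  proof (rule monoI)
    fix y z :: real assume yz: "y \<le> z"
    have "s0 * L0 z \<le> s0 * (L0 y + (z - y) / s0)" using s lip[OF yz] by (intro mult_left_mono) auto
    then have "s0 * L0 z - s0 * L0 y \<le> z - y" using s by (simp add: distrib_left)
    then show "L1 y \<le> L1 z" unfolding L1_def using s by (intro divide_right_mono) auto
  qed
  moreover have c0: "continuous_on UNIV L0"
  proof (rule Lipschitz.lipschitz_on_continuous_on)
    show "(1 / s0)-lipschitz_on UNIV L0"
    proof (rule lipschitz_on_leI)
      fix x y :: real assume "x \<le> y"
      then show "dist (L0 x) (L0 y) \<le> 1 / s0 * dist x y"
        using mL0[of x y] lip[of x y] by (simp add: dist_real_def)
    qed (use s in auto)
  qed
  moreover have "continuous_on UNIV L1"
    unfolding L1_def using s by (intro continuous_intros c0) auto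
  moreover have id: "s0 * L0 y + s1 * L1 y = y" for y
    using s by (simp add: L1_def)
  moreover have L0w: "L0 (w m) = u0 m" if m: "m \<in> {0<..<1}" for m
  proof (rule antisym)
    show "L0 (w m) \<le> u0 m" using L0_le[OF m, of "w m"] by (simp add: g_def)
    show "u0 m \<le> L0 (w m)"
    proof (rule L0_ge)
      fix m' :: real assume m': "m' \<in> {0<..<1}"
      show "u0 m \<le> g (w m) m'"
      proof (cases "m \<le> m'")
        case True
        then show ?thesis using mono_onD[OF mono(1) m m'] by (simp add: g_def)
      next
        case False
        \<comment> \<open>For m' < m the increase of \<open>u1\<close> makes \<open>w\<close> grow
          at least as fast as s0 u0, so the Lipschitz penalty in \<open>g\<close> compensates for
          the smaller value u0 m'.\<close>
        then have "s1 * u1 m' \<le> s1 * u1 m" using mono_onD[OF mono(2) m' m] s by simp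
        then have "s0 * (u0 m - u0 m') \<le> w m - w m'" by (simp add: w algebra_simps)
        then have "u0 m - u0 m' \<le> (w m - w m') / s0" using s by (simp add: le_divide_eq mult.commute)
        then show ?thesis by (simp add: g_def)
      qed
    qed
  qed
  moreover have "L1 (w m) = u1 m" if m: "m \<in> {0<..<1}" for m
    unfolding L1_def L0w[OF m] using s by (simp add: w)
  ultimately show ?thesis using that by blast
qed

section \<open>The energy of a law and its convexity along interpolation\<close>

definition density_energy :: "real \<Rightarrow> real \<Rightarrow> (real \<Rightarrow> real) \<Rightarrow> ennreal" where
  "density_energy a p \<rho> = (\<integral>\<^sup>+ y. indicator {0<..} y * ennreal (y powr a * \<rho> y powr p) \<partial>lborel)"

text \<open>One factor of \<open>\<rho>\<close> is spent in passing to \<open>m\<close>, which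
  lowers the exponent to p - 1. Over \<open>m\<close> the energies at different times live on one
  space and can be compared pointwise.\<close>

lemma density_energy_eq:
  assumes law: "has_law u \<rho>" and pos: "\<And>m. m \<in> {0<..<1} \<Longrightarrow> 0 < u m"
  shows "density_energy a p \<rho> = (\<integral>\<^sup>+ m. ennreal (u m powr a * \<rho> (u m) powr (p - 1)) \<partial>unit_lborel)"
proof -
  have [measurable]: "\<rho> \<in> borel_measurable borel" and \<rho>: "\<And>y. \<rho> y \<ge> 0"
    using law by (auto simp: has_law_def)
  have "(\<integral>\<^sup>+ m. ennreal (u m powr a * \<rho> (u m) powr (p - 1)) \<partial>unit_lborel)
      = (\<integral>\<^sup>+ m. indicator {0<..} (u m) * ennreal (u m powr a * \<rho> (u m) powr (p - 1)) \<partial>unit_lborel)"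
    using pos by (intro nn_integral_cong) (simp add: space_unit_lborel)
  also have "\<dots> = (\<integral>\<^sup>+ y. ennreal (\<rho> y) * (indicator {0<..} y * ennreal (y powr a * \<rho> y powr (p - 1))) \<partial>lborel)"
    by (rule has_law_nn_integral[OF law]) simp
  also have "\<dots> = density_energy a p \<rho>"
    unfolding density_energy_def
  proof (intro nn_integral_cong)
    fix y :: real
    have "\<rho> y * (y powr a * \<rho> y powr (p - 1)) = y powr a * \<rho> y powr p"
      using \<rho>[of y] by (cases "\<rho> y = 0") (simp_all add: powr_diff)
    then show "ennreal (\<rho> y) * (indicator {0<..} y * ennreal (y powr a * \<rho> y powr (p - 1)))
        = indicator {0<..} y * ennreal (y powr a * \<rho> y powr p)"
      using \<rho>[of y] by (cases "y > 0") (simp_all add: ennreal_mult'[symmetric] del: mult_cancel_left)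
  qed
  finally show ?thesis by simp
qed

theorem displacement_convexity:
  fixes u0 u1 :: "real \<Rightarrow> real"
  assumes p: "1 < p" "p \<le> a"
    and mono: "mono_on {0<..<1} u0" "mono_on {0<..<1} u1"
    and pos: "\<And>m. m \<in> {0<..<1} \<Longrightarrow> 0 < u0 m" "\<And>m. m \<in> {0<..<1} \<Longrightarrow> 0 < u1 m"
    and law: "has_law u0 \<rho>0" "has_law u1 \<rho>1"
    and s: "s0 > 0" "s1 > 0" "s0 + s1 = 1"
  obtains \<rho> where "has_law (\<lambda>m. s0 * u0 m + s1 * u1 m) \<rho>"
    "density_energy a p \<rho> \<le> ennreal s0 * density_energy a p \<rho>0 + ennreal s1 * density_energy a p \<rho>1"
proof -
  define w where "w = (\<lambda>m. s0 * u0 m + s1 * u1 m)"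
  have [measurable]: "u0 \<in> borel_measurable unit_lborel" "u1 \<in> borel_measurable unit_lborel"
    "\<rho>0 \<in> borel_measurable borel" "\<rho>1 \<in> borel_measurable borel"
    and \<rho>: "\<And>y. \<rho>0 y \<ge> 0" "\<And>y. \<rho>1 y \<ge> 0"
    using law by (auto simp: has_law_def)
  have [measurable]: "w \<in> borel_measurable unit_lborel" unfolding w_def by measurable
  obtain L0 L1 where L: "mono L0" "mono L1" "continuous_on UNIV L0" "continuous_on UNIV L1"
    "\<And>y. s0 * L0 y + s1 * L1 y = y"
    "\<And>m. m \<in> {0<..<1} \<Longrightarrow> L0 (w m) = u0 m" "\<And>m. m \<in> {0<..<1} \<Longrightarrow> L1 (w m) = u1 m"
    using displacement_factor[OF mono pos(1) s(1,2), of w] by (auto simp: w_def)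
  obtain l0 l1 where [measurable]: "l0 \<in> borel_measurable borel" "l1 \<in> borel_measurable borel"
    and l: "interval_measure L0 = density lborel l0" "interval_measure L1 = density lborel l1"
    "AE y in lborel. ennreal s0 * l0 y + ennreal s1 * l1 y = 1"
    using interval_measure_densities[OF L(1-4) s(1,2) L(5)] by metis
  have [measurable]: "L0 \<in> borel_measurable borel" "L1 \<in> borel_measurable borel"
    using L(1,2) borel_measurable_mono by blast+
  have d0: "distr unit_lborel borel w = density lborel (\<lambda>y. ennreal (\<rho>0 (L0 y)) * l0 y)"
    by (rule has_law_compose[OF law(1) _ L(1,3,6) _ l(1)]) auto
  have d1: "distr unit_lborel borel w = density lborel (\<lambda>y. ennreal (\<rho>1 (L1 y)) * l1 y)"
    by (rule has_law_compose[OF law(2) _ L(2,4,7) _ l(2)]) auto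
  define \<rho> where "\<rho> = (\<lambda>y. enn2real (ennreal (\<rho>0 (L0 y)) * l0 y))"
  have [measurable]: "\<rho> \<in> borel_measurable borel" unfolding \<rho>_def by measurable
  \<comment> \<open>\<open>l0\<close> and \<open>l1\<close> are extended real densities; since their
    combination with positive weights equals 1, the value infinity occurs only on a null
    set.\<close>
  have fin: "AE y in lborel. l0 y < \<infinity> \<and> l1 y < \<infinity>"
    using l(3)
  proof eventually_elim
    case (elim y)
    have "l0 y \<noteq> \<infinity>" using elim s by (intro notI) (simp add: ennreal_mult_top)
    moreover have "l1 y \<noteq> \<infinity>" using elim s by (intro notI) (simp add: ennreal_mult_top)
    ultimately show ?case by (simp add: less_top[symmetric])
  qed
  have \<rho>0: "AE y in lborel. ennreal (\<rho> y) = ennreal (\<rho>0 (L0 y)) * l0 y"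
    using fin
  proof eventually_elim
    case (elim y)
    then show ?case by (simp add: \<rho>_def ennreal_mult_less_top)
  qed
  have "density lborel (\<lambda>y. ennreal (\<rho> y)) = distr unit_lborel borel w"
    unfolding d0 using \<rho>0 by (intro density_cong) auto
  then have law_w: "has_law w \<rho>" by (auto simp: has_law_def \<rho>_def)
  \<comment> \<open>The factorization through \<open>L1\<close> gives a second density of the same
    law, hence the same one up to a null set. This links \<open>\<rho>\<close> to both end points at
    once.\<close>
  have \<rho>1: "AE y in lborel. ennreal (\<rho> y) = ennreal (\<rho>1 (L1 y)) * l1 y"
    using law_w d1
    by (subst sigma_finite_measure.density_unique_iff[OF sigma_finite_lborel, symmetric]) (auto simp: has_law_def)
  have dw: "distr unit_lborel borel w = density lborel (\<lambda>y. ennreal (\<rho> y))"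
    using law_w by (simp add: has_law_def)
  \<comment> \<open>A null set of values pulls back to a null set of \<open>m\<close>, because the
    law of \<open>w\<close> has a density. So relations between densities may be evaluated at
    \<open>w m\<close>.\<close>
  have AEw: "AE m in unit_lborel. P (w m)" if "AE y in lborel. P y" "Measurable.pred borel P" for P
  proof -
    have "AE y in distr unit_lborel borel w. P y"
      unfolding dw using that by (subst AE_density) auto
    then show ?thesis by (subst (asm) AE_distr_iff) (use that in auto)
  qed
  have posw: "AE m in unit_lborel. \<rho> (w m) > 0"
  proof -
    have "AE y in distr unit_lborel borel w. \<rho> y > 0"
      unfolding dw by (subst AE_density) auto
    then show ?thesis by (subst (asm) AE_distr_iff) auto
  qed
  have A: "AE m in unit_lborel. ennreal (\<rho> (w m)) = ennreal (\<rho>0 (L0 (w m))) * l0 (w m)"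
    "AE m in unit_lborel. ennreal (\<rho> (w m)) = ennreal (\<rho>1 (L1 (w m))) * l1 (w m)"
    "AE m in unit_lborel. ennreal s0 * l0 (w m) + ennreal s1 * l1 (w m) = 1"
    "AE m in unit_lborel. l0 (w m) < \<infinity> \<and> l1 (w m) < \<infinity>"
    by (rule AEw, fact \<rho>0 \<rho>1 l(3) fin, measurable)+
  have E: "AE m in unit_lborel. w m powr a * \<rho> (w m) powr (p - 1)
     \<le> s0 * (u0 m powr a * \<rho>0 (u0 m) powr (p - 1)) + s1 * (u1 m powr a * \<rho>1 (u1 m) powr (p - 1))"
    using A posw AE_space
  proof eventually_elim
    case (elim m)
    then have m: "m \<in> {0<..<1}" by (simp add: space_unit_lborel)
    have *: "ennreal (\<rho> (w m)) = ennreal (\<rho>0 (u0 m)) * l0 (w m)"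
      "ennreal (\<rho> (w m)) = ennreal (\<rho>1 (u1 m)) * l1 (w m)"
      using elim(1,2) L(6,7)[OF m] by auto
    obtain a0 a1 where a: "l0 (w m) = ennreal a0" "l1 (w m) = ennreal a1" "a0 \<ge> 0" "a1 \<ge> 0"
      using elim(4) by (cases "l0 (w m)"; cases "l1 (w m)") auto
    have r: "\<rho> (w m) = \<rho>0 (u0 m) * a0" "\<rho> (w m) = \<rho>1 (u1 m) * a1"
      using * a \<rho> elim(5) by (simp_all add: ennreal_mult'[symmetric])
    have sa: "s0 * a0 + s1 * a1 = 1"
    proof -
      have "ennreal (s0 * a0 + s1 * a1) = ennreal 1"
        using elim(3) a s by (simp add: ennreal_mult' ennreal_plus)
      then show ?thesis using a s by (subst (asm) ennreal_inj) auto
    qed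
    have pr: "\<rho>0 (u0 m) > 0" "\<rho>1 (u1 m) > 0"
      using r elim(5) \<rho>(1)[of "u0 m"] \<rho>(2)[of "u1 m"] by (auto simp: order.order_iff_strict)
    \<comment> \<open>Dividing \<open>s0 * a0 + s1 * a1 = 1\<close> by the density at
      \<open>w m\<close> shows that reciprocal densities interpolate linearly, each taken at its own
      slope.\<close>
    have "1 / \<rho> (w m) = (s0 * a0 + s1 * a1) / \<rho> (w m)" by (simp add: sa)
    also have "\<dots> = s0 * (a0 / \<rho> (w m)) + s1 * (a1 / \<rho> (w m))" by (simp add: add_divide_distrib)
    also have "a0 / \<rho> (w m) = 1 / \<rho>0 (u0 m)" using r(1) elim(5) pr by (auto simp: field_simps)
    also have "a1 / \<rho> (w m) = 1 / \<rho>1 (u1 m)" using r(2) elim(5) pr by (auto simp: field_simps)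
    finally have Y: "s0 * (1 / \<rho>0 (u0 m)) + s1 * (1 / \<rho>1 (u1 m)) = 1 / \<rho> (w m)" by simp
    have inv: "(1 / x) powr (1 - p) = x powr (p - 1)" if "x > 0" for x
      using that by (simp add: powr_divide powr_diff)
    show ?case
      using weighted_powr_convex[OF p pos(1)[OF m] pos(2)[OF m], of "1 / \<rho>0 (u0 m)" "1 / \<rho>1 (u1 m)" s0 s1]
        pr s elim(5) unfolding Y by (simp add: inv w_def)
  qed
  have posw': "0 < w m" if "m \<in> {0<..<1}" for m
    using pos[OF that] s by (simp add: w_def add_pos_pos)
  have "density_energy a p \<rho> = (\<integral>\<^sup>+ m. ennreal (w m powr a * \<rho> (w m) powr (p - 1)) \<partial>unit_lborel)"
    by (rule density_energy_eq[OF law_w posw'])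
  also have "\<dots> \<le> (\<integral>\<^sup>+ m. ennreal s0 * ennreal (u0 m powr a * \<rho>0 (u0 m) powr (p - 1))
      + ennreal s1 * ennreal (u1 m powr a * \<rho>1 (u1 m) powr (p - 1)) \<partial>unit_lborel)"
    using E s by (intro nn_integral_mono_AE) (auto simp: ennreal_mult'[symmetric] ennreal_plus[symmetric]
        elim!: eventually_mono intro!: ennreal_leI simp del: ennreal_plus)
  also have "\<dots> = ennreal s0 * density_energy a p \<rho>0 + ennreal s1 * density_energy a p \<rho>1"
    unfolding density_energy_eq[OF law(1) pos(1), of a p, simplified] density_energy_eq[OF law(2) pos(2), of a p, simplified]
    by (simp add: nn_integral_add nn_integral_cmult)
  finally show ?thesis using that law_w by (simp add: w_def)
qed

section \<open>Uniqueness of weak gradients\<close>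

text \<open>Products of one-dimensional bumps converge to the indicator of the open box. The closed
  box is compact, so |f| restricted to it is an integrable majorant.\<close>

lemma box_integral_eq_0:
  fixes f :: "real ^ 'n \<Rightarrow> real"
  assumes loc: "\<And>K. compact K \<Longrightarrow> set_integrable lebesgue K f"
    and zero: "\<And>\<phi>. test_function \<phi> \<Longrightarrow> (LINT x|lebesgue. f x * \<phi> x) = 0"
  shows "(LINT x|lebesgue. indicator (box a b) x * f x) = 0"
proof -
  let ?\<phi> = "\<lambda>k x. \<Prod>i\<in>UNIV. bump k (a $ i) (b $ i) (x $ i)"
  let ?h = "\<lambda>x. indicator (cbox a b) x * f x"
  have h: "integrable lebesgue ?h"
    using loc[of "cbox a b"] by (simp add: set_integrable_def)
  have bounds: "0 \<le> ?\<phi> k x" "?\<phi> k x \<le> 1" for k x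
    by (auto intro!: prod_nonneg prod_le_1 simp: bump_bounds)
  have supp: "?\<phi> k x = 0" if nx: "x \<notin> box a b" for k x
  proof -
    obtain i where "x $ i \<notin> {a $ i<..<b $ i}" using nx unfolding mem_box_cart greaterThanLessThan_iff by blast
    then have "bump k (a $ i) (b $ i) (x $ i) = 0" by (rule bump_eq_0)
    then show ?thesis by (intro prod_zero) auto
  qed
  have eq: "f x * ?\<phi> k x = ?h x * ?\<phi> k x" for k x
    using supp[of x k] box_subset_cbox[of a b] by (cases "x \<in> box a b") auto
  have [measurable]: "(\<lambda>x. ?\<phi> k x) \<in> borel_measurable lebesgue" for k
    by (rule test_function_lebesgue[OF test_function_box])
  have lim: "(\<lambda>k. ?\<phi> k x) \<longlonglongrightarrow> indicator (box a b) x" for x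
  proof -
    have "(\<lambda>k. ?\<phi> k x) \<longlonglongrightarrow> (\<Prod>i\<in>UNIV. indicator {a $ i<..<b $ i} (x $ i))"
      by (intro tendsto_prod bump_tendsto)
    moreover have "(\<Prod>i\<in>UNIV. indicator {a $ i<..<b $ i} (x $ i)) = (indicator (box a b) x :: real)"
    proof (cases "x \<in> box a b")
      case True
      then show ?thesis by (auto simp: mem_box_cart intro!: prod.neutral)
    next
      case False
      then obtain i where "x $ i \<notin> {a $ i<..<b $ i}"
        unfolding mem_box_cart greaterThanLessThan_iff by blast
      then have "(\<Prod>i\<in>UNIV. indicator {a $ i<..<b $ i} (x $ i)) = (0::real)"
        by (intro prod_zero bexI[of _ i]) auto
      then show ?thesis using False by simp
    qed
    ultimately show ?thesis by simp
  qed
  have "(\<lambda>k. LINT x|lebesgue. ?h x * ?\<phi> k x) \<longlonglongrightarrow> (LINT x|lebesgue. indicator (box a b) x * f x)"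
  proof (rule integral_dominated_convergence[where w="\<lambda>x. \<bar>?h x\<bar>"])
    show "(\<lambda>x. indicator (box a b) x * f x) \<in> borel_measurable lebesgue"
    proof -
      have "(\<lambda>x. indicator (box a b) x * f x) = (\<lambda>x. indicator (box a b) x * ?h x)"
        using box_subset_cbox[of a b] by (auto simp: indicator_def fun_eq_iff)
      moreover have [measurable]: "box a b \<in> sets lebesgue" by (rule fmeasurableD[OF lmeasurable_box])
      note [measurable] = borel_measurable_integrable[OF h]
      have "(\<lambda>x. indicator (box a b) x * ?h x) \<in> borel_measurable lebesgue" by measurable
      ultimately show ?thesis by simp
    qed
    show "(\<lambda>x. ?h x * ?\<phi> k x) \<in> borel_measurable lebesgue" for k
      using borel_measurable_integrable[OF h] by measurable
    show "integrable lebesgue (\<lambda>x. \<bar>?h x\<bar>)" using h by (rule integrable_abs)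
    show "AE x in lebesgue. (\<lambda>k. ?h x * ?\<phi> k x) \<longlonglongrightarrow> indicator (box a b) x * f x"
    proof (rule AE_I2)
      fix x
      have eq': "?h x * indicator (box a b) x = indicator (box a b) x * f x"
        using box_subset_cbox[of a b] by (auto simp: indicator_def)
      show "(\<lambda>k. ?h x * ?\<phi> k x) \<longlonglongrightarrow> indicator (box a b) x * f x"
        by (subst eq'[symmetric]) (intro tendsto_mult tendsto_const lim)
    qed
    show "AE x in lebesgue. norm (?h x * ?\<phi> k x) \<le> \<bar>?h x\<bar>" for k
    proof (rule AE_I2)
      fix x
      have "\<bar>?h x\<bar> * ?\<phi> k x \<le> \<bar>?h x\<bar> * 1"
        by (intro mult_left_mono bounds) auto
      then show "norm (?h x * ?\<phi> k x) \<le> \<bar>?h x\<bar>"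
        using bounds(1)[of k x] by (simp add: abs_mult)
    qed
  qed
  moreover have "(LINT x|lebesgue. ?h x * ?\<phi> k x) = 0" for k
    using zero[OF test_function_box[of k a b]] by (simp add: eq)
  ultimately show ?thesis using LIMSEQ_unique[OF _ tendsto_const] by fastforce
qed

text \<open>\<open>ennreal\<close> sends negative reals to 0, so the two densities in the proof are
  the positive and the negative part of \<open>h\<close>. They have equal finite mass on boxes,
  hence define the same measure.\<close>

lemma AE_eq_0_if_box_integrals_eq_0:
  fixes h :: "'a :: euclidean_space \<Rightarrow> real"
  assumes h: "integrable lborel h" and zero: "\<And>a b. (LINT x|lborel. indicator (box a b) x * h x) = 0"
  shows "AE x in lborel. h x = 0"
proof -
  have [measurable]: "h \<in> borel_measurable borel" using h by simp
  let ?M = "density lborel (\<lambda>x. ennreal (h x))" and ?N = "density lborel (\<lambda>x. ennreal (- h x))"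
  have fin: "emeasure ?M A < \<infinity>" if "A \<in> sets borel" for A
  proof -
    have "emeasure ?M A \<le> (\<integral>\<^sup>+ x. ennreal (norm (h x)) \<partial>lborel)"
      using that by (subst emeasure_density) (auto intro!: nn_integral_mono ennreal_leI simp: indicator_def)
    then show ?thesis using h by (auto simp: integrable_iff_bounded)
  qed
  have eq: "emeasure ?M (box a b) = emeasure ?N (box a b)" for a b
  proof -
    have i: "integrable lborel (\<lambda>x. indicator (box a b) x * h x)"
      using integrable_mult_indicator[of "box a b" lborel h] h by simp
    have m: "emeasure ?M (box a b) = (\<integral>\<^sup>+ x. ennreal (indicator (box a b) x * h x) \<partial>lborel)"
      by (subst emeasure_density) (auto intro!: nn_integral_cong simp: indicator_def)
    have n: "emeasure ?N (box a b) = (\<integral>\<^sup>+ x. ennreal (- (indicator (box a b) x * h x)) \<partial>lborel)"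
      by (subst emeasure_density) (auto intro!: nn_integral_cong simp: indicator_def)
    have "enn2real (emeasure ?M (box a b)) = enn2real (emeasure ?N (box a b))"
      using real_lebesgue_integral_def[OF i] zero[of a b] unfolding m n by simp
    moreover have "emeasure ?M (box a b) < \<infinity>" "emeasure ?N (box a b) < \<infinity>"
      using i unfolding m n real_integrable_def by (auto simp: less_top)
    ultimately show ?thesis by (metis ennreal_enn2real infinity_ennreal_def)
  qed
  have E: "sets borel = sigma_sets UNIV (range (\<lambda>(a, b). box a b :: 'a set))"
    by (subst borel_eq_box) (rule sets_measure_of, auto)
  have "?M = ?N"
  proof (rule measure_eqI_generator_eq[where \<Omega>=UNIV])
    show "Int_stable (range (\<lambda>(a, b). box a b :: 'a set))"
      by (auto simp: Int_stable_def box_Int_box)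
    show "(\<Union>i. box (- (real (i::nat) *\<^sub>R One)) (real i *\<^sub>R One)) = (UNIV :: 'a set)"
      by (rule UN_box_eq_UNIV)
    show "emeasure ?M (box (- (real (i::nat) *\<^sub>R One)) (real i *\<^sub>R One)) \<noteq> \<infinity>" for i
      using fin by (simp add: less_top)
  qed (use eq E in auto)
  then have "AE x in lborel. ennreal (h x) = ennreal (- h x)"
    by (subst (asm) sigma_finite_measure.density_unique_iff[OF sigma_finite_lborel]) auto
  then show ?thesis
    by eventually_elim (metis ennreal_eq_0_iff ennreal_less_zero_iff less_le_not_le linorder_linear neg_le_0_iff_le order_antisym_conv)
qed

text \<open>Fundamental lemma of the calculus of variations. It is localized to boxes, where
  \<open>f\<close> is integrable and has a Borel version; the intersection of two boxes is a box, so
  the localized function still has vanishing box integrals.\<close>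

lemma AE_eq_0_if_test_integrals_eq_0:
  fixes f :: "real ^ 'n \<Rightarrow> real"
  assumes loc: "\<And>K. compact K \<Longrightarrow> set_integrable lebesgue K f"
    and zero: "\<And>\<phi>. test_function \<phi> \<Longrightarrow> (LINT x|lebesgue. f x * \<phi> x) = 0"
  shows "AE x in lebesgue. f x = 0"
proof -
  have "AE x in lebesgue. x \<in> box (- (real i *\<^sub>R One)) (real i *\<^sub>R One) \<longrightarrow> f x = 0" for i :: nat
  proof -
    let ?B = "box (- (real i *\<^sub>R One)) (real i *\<^sub>R One) :: (real ^ 'n) set"
    let ?h = "\<lambda>x. indicator ?B x * f x"
    have "set_integrable lebesgue (cbox (- (real i *\<^sub>R One)) (real i *\<^sub>R One)) f" by (rule loc) simp
    then have "set_integrable lebesgue ?B f" by (rule set_integrable_subset) (auto simp: box_subset_cbox)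
    then have h: "integrable lebesgue ?h" by (simp add: set_integrable_def)
    then obtain h' where [measurable]: "h' \<in> borel_measurable lborel" and h': "AE x in lborel. ?h x = h' x"
      using completion_ex_borel_measurable_real[of ?h lborel] borel_measurable_integrable[OF h] by auto
    have AE: "AE x in lebesgue. ?h x = h' x" using h' by (rule AE_completion)
    have [measurable]: "h' \<in> borel_measurable lebesgue" by (rule measurable_completion) simp
    have "integrable lebesgue h'"
      using h AE borel_measurable_integrable[OF h] by (subst integrable_cong_AE[of _ _ ?h]) auto
    then have ih': "integrable lborel h'" by (simp add: integrable_completion)
    have "AE x in lborel. h' x = 0"
    proof (rule AE_eq_0_if_box_integrals_eq_0[OF ih'])
      fix a b :: "real ^ 'n"
      obtain c d where cd: "box a b \<inter> ?B = box c d" by (simp add: box_Int_box)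
      have "(LINT x|lborel. indicator (box a b) x * h' x) = (LINT x|lebesgue. indicator (box a b) x * h' x)"
        by (rule integral_completion[symmetric]) simp
      also have "\<dots> = (LINT x|lebesgue. indicator (box a b) x * ?h x)"
      proof (rule integral_cong_AE)
        have [measurable]: "box a b \<in> sets lebesgue" by (rule fmeasurableD[OF lmeasurable_box])
        note [measurable] = borel_measurable_integrable[OF h]
        show "(\<lambda>x. indicator (box a b) x * h' x) \<in> borel_measurable lebesgue"
          "(\<lambda>x. indicator (box a b) x * ?h x) \<in> borel_measurable lebesgue" by measurable
        show "AE x in lebesgue. indicator (box a b) x * h' x = indicator (box a b) x * ?h x"
          using AE by eventually_elim simp
      qed
      also have "(\<lambda>x. indicator (box a b) x * ?h x) = (\<lambda>x. indicator (box c d) x * f x)"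
        unfolding cd[symmetric] by (auto simp: indicator_def fun_eq_iff)
      also have "(LINT x|lebesgue. indicator (box c d) x * f x) = 0"
        using assms by (rule box_integral_eq_0)
      finally show "(LINT x|lborel. indicator (box a b) x * h' x) = 0" .
    qed
    then have "AE x in lebesgue. h' x = 0" by (rule AE_completion)
    with AE show ?thesis by eventually_elim (auto simp: indicator_def)
  qed
  then have "AE x in lebesgue. \<forall>i::nat. x \<in> box (- (real i *\<^sub>R One)) (real i *\<^sub>R One) \<longrightarrow> f x = 0"
    unfolding AE_all_countable by blast
  then show ?thesis
  proof eventually_elim
    case (elim x)
    have "x \<in> (\<Union>i::nat. box (- (real i *\<^sub>R One)) (real i *\<^sub>R One))"
      by (subst UN_box_eq_UNIV) simp
    then show ?case using elim by blast
  qed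
qed

lemma weak_gradient_unique:
  fixes f :: "real ^ 'n \<Rightarrow> real"
  assumes g: "has_weak_gradient f g" and g': "has_weak_gradient f g'"
  shows "AE x in lebesgue. g x = g' x"
proof -
  have "AE x in lebesgue. g x $ i - g' x $ i = 0" for i
  proof (rule AE_eq_0_if_test_integrals_eq_0)
    have c: "set_integrable lebesgue K (\<lambda>x. g x $ i)" if "compact K" "locally_integrable g"
      for K and g :: "real ^ 'n \<Rightarrow> real ^ 'n"
      using integrable_bounded_linear[OF bounded_linear_vec_nth[of i], of lebesgue "\<lambda>x. indicator K x *\<^sub>R g x"] that
      by (simp add: locally_integrable_def set_integrable_def)
    show "set_integrable lebesgue K (\<lambda>x. g x $ i - g' x $ i)" if "compact K" for K
      using c[OF that] g g' by (intro set_integral_diff) (auto simp: has_weak_gradient_def)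
    fix \<phi> :: "real ^ 'n \<Rightarrow> real" assume \<phi>: "test_function \<phi>"
    let ?K = "closure {x. \<phi> x \<noteq> 0}"
    have K: "compact ?K" and cont: "continuous_on UNIV \<phi>"
      using \<phi> test_function_continuous unfolding test_function_def by blast+
    have "bounded (\<phi> ` ?K)"
      by (intro compact_imp_bounded compact_continuous_image continuous_on_subset[OF cont] K) auto
    then obtain B where "\<forall>y\<in>\<phi> ` ?K. norm y \<le> B" unfolding bounded_iff by blast
    then have B: "\<bar>\<phi> x\<bar> \<le> B" if "x \<in> ?K" for x using that by simp
    note [measurable] = test_function_lebesgue[OF \<phi>]
    have i: "integrable lebesgue (\<lambda>x. g x $ i * \<phi> x)" if "locally_integrable g"
      for g :: "real ^ 'n \<Rightarrow> real ^ 'n"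
    proof -
      have gi: "integrable lebesgue (\<lambda>x. indicator ?K x * g x $ i)"
        using c[OF K that] by (simp add: set_integrable_def)
      have eq: "g x $ i * \<phi> x = (indicator ?K x * g x $ i) * \<phi> x" for x
        using closure_subset[of "{x. \<phi> x \<noteq> 0}"] by (cases "\<phi> x = 0") auto
      show ?thesis
        unfolding eq
      proof (rule Bochner_Integration.integrable_bound[of _ "\<lambda>x. B * (indicator ?K x * g x $ i)"])
        show "integrable lebesgue (\<lambda>x. B * (indicator ?K x * g x $ i))"
          using gi by simp
        show "(\<lambda>x. (indicator ?K x * g x $ i) * \<phi> x) \<in> borel_measurable lebesgue"
          using borel_measurable_integrable[OF gi] by measurable
        show "AE x in lebesgue. norm (indicator ?K x * g x $ i * \<phi> x) \<le> norm (B * (indicator ?K x * g x $ i))"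
        proof (rule AE_I2)
          fix x
          show "norm (indicator ?K x * g x $ i * \<phi> x) \<le> norm (B * (indicator ?K x * g x $ i))"
          proof (cases "x \<in> ?K")
            case True
            then show ?thesis using B[OF True] mult_right_mono[of "\<bar>\<phi> x\<bar>" "\<bar>B\<bar>" "\<bar>g x $ i\<bar>"]
              by (simp add: abs_mult mult.commute)
          qed simp
        qed
      qed
    qed
    have "(LINT x|lebesgue. g x $ i * \<phi> x) = (LINT x|lebesgue. g' x $ i * \<phi> x)"
    proof -
      have "- (LINT x|lebesgue. g x $ i * \<phi> x) = (LINT x|lebesgue. f x * frechet_derivative \<phi> (at x) (axis i 1))"
        using g \<phi> unfolding has_weak_gradient_def by simp
      also have "\<dots> = - (LINT x|lebesgue. g' x $ i * \<phi> x)"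
        using g' \<phi> unfolding has_weak_gradient_def by blast
      finally show ?thesis by simp
    qed
    then show "(LINT x|lebesgue. (g x $ i - g' x $ i) * \<phi> x) = 0"
      using i g g' by (simp add: left_diff_distrib has_weak_gradient_def)
  qed
  then have "AE x in lebesgue. \<forall>i. g x $ i - g' x $ i = 0" by (simp add: AE_all_countable AE_finite_allI)
  then show ?thesis by eventually_elim (simp add: vec_eq_iff)
qed

section \<open>Weak gradients of superpositions of balls\<close>

text \<open>By translation invariance all difference quotients of \<open>F\<close> have integral zero.\<close>

lemma integral_directional_derivative_eq_0:
  fixes F D :: "'a :: euclidean_space \<Rightarrow> real"
  assumes [measurable]: "F \<in> borel_measurable borel" "D \<in> borel_measurable borel" and e: "norm e = 1"
    and lip: "\<And>x h. \<bar>F (x + h *\<^sub>R e) - F x\<bar> \<le> K * \<bar>h\<bar>"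
    and supp: "\<And>x. norm x > R \<Longrightarrow> F x = 0"
    and D: "AE x in lborel. ((\<lambda>s. F (x + s *\<^sub>R e)) has_real_derivative D x) (at 0)"
  shows "(LINT x|lborel. D x) = 0"
proof -
  define h where "h = (\<lambda>k::nat. 1 / real (Suc k))"
  have h: "0 < h k" "h k \<le> 1" for k by (auto simp: h_def)
  have hlim: "filterlim h (at 0) sequentially"
    using LIMSEQ_inverse_real_of_nat h unfolding filterlim_at h_def
    by (auto simp: inverse_eq_divide)
  \<comment> \<open>A step of length \<open>2 * \<bar>R\<bar> + 1\<close> along \<open>e\<close>
    leaves the ball that carries \<open>F\<close>, so the Lipschitz estimate also bounds the values
    of \<open>F\<close>.\<close>
  have Fb: "\<bar>F x\<bar> \<le> K * (2 * \<bar>R\<bar> + 1)" if "norm x \<le> R" for x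
  proof -
    have "norm ((2 * \<bar>R\<bar> + 1) *\<^sub>R e) \<le> norm (x + (2 * \<bar>R\<bar> + 1) *\<^sub>R e) + norm x"
      using norm_triangle_ineq4[of "x + (2 * \<bar>R\<bar> + 1) *\<^sub>R e" x] by simp
    then have "norm (x + (2 * \<bar>R\<bar> + 1) *\<^sub>R e) > R" using e that by simp
    then have "F (x + (2 * \<bar>R\<bar> + 1) *\<^sub>R e) = 0" by (rule supp)
    then show ?thesis using lip[of x "2 * \<bar>R\<bar> + 1"] by simp
  qed
  have ball: "integrable lborel (\<lambda>x :: 'a. indicator (cball 0 r) x * c)" for r c :: real
    by (rule integrable_mult_left) (auto intro!: integrable_real_indicator emeasure_lborel_cball_finite)
  have iF: "integrable lborel F"
  proof (rule Bochner_Integration.integrable_bound[OF ball[of R "K * (2 * \<bar>R\<bar> + 1)"]])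
    show "AE x in lborel. norm (F x) \<le> norm (indicator (cball 0 R) x * (K * (2 * \<bar>R\<bar> + 1)))"
    proof (rule AE_I2)
      fix x show "norm (F x) \<le> norm (indicator (cball 0 R) x * (K * (2 * \<bar>R\<bar> + 1)))"
        using Fb[of x] supp[of x] by (cases "norm x \<le> R") (auto simp: indicator_def)
    qed
  qed simp
  have shift: "integrable lborel (\<lambda>x. F (x + c))" "(LINT x|lborel. F (x + c)) = (LINT x|lborel. F x)" for c
  proof -
    have "integrable (distr lborel borel ((+) c)) F" using iF by (simp add: lborel_distr_plus)
    then show "integrable lborel (\<lambda>x. F (x + c))" by (subst (asm) integrable_distr_eq) (auto simp: add.commute)
    have "(LINT x|lborel. F x) = (LINT x|distr lborel borel ((+) c). F x)" by (simp add: lborel_distr_plus)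
    also have "\<dots> = (LINT x|lborel. F (x + c))" by (subst integral_distr) (auto simp: add.commute)
    finally show "(LINT x|lborel. F (x + c)) = (LINT x|lborel. F x)" by simp
  qed
  have "(\<lambda>k. LINT x|lborel. (F (x + h k *\<^sub>R e) - F x) / h k) \<longlonglongrightarrow> (LINT x|lborel. D x)"
  proof (rule integral_dominated_convergence[where w="\<lambda>x. indicator (cball 0 (R + 1)) x * K"])
    show "integrable lborel (\<lambda>x :: 'a. indicator (cball 0 (R + 1)) x * K)" by (rule ball)
    show "AE x in lborel. (\<lambda>k. (F (x + h k *\<^sub>R e) - F x) / h k) \<longlonglongrightarrow> D x"
      using D
    proof eventually_elim
      case (elim x)
      then have "((\<lambda>s. (F (x + s *\<^sub>R e) - F x) / s) \<longlongrightarrow> D x) (at 0)"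
        by (simp add: DERIV_def)
      then show ?case by (rule filterlim_compose[OF _ hlim])
    qed
    show "AE x in lborel. norm ((F (x + h k *\<^sub>R e) - F x) / h k) \<le> indicator (cball 0 (R + 1)) x * K" for k
    proof (rule AE_I2)
      fix x
      show "norm ((F (x + h k *\<^sub>R e) - F x) / h k) \<le> indicator (cball 0 (R + 1)) x * K"
      proof (cases "norm x \<le> R + 1")
        case True
        then show ?thesis using lip[of x "h k"] h[of k] by (simp add: divide_le_eq)
      next
        case False
        have "norm x \<le> norm (x + h k *\<^sub>R e) + norm (h k *\<^sub>R e)"
          using norm_triangle_ineq4[of "x + h k *\<^sub>R e" "h k *\<^sub>R e"] by simp
        then have "norm (x + h k *\<^sub>R e) > R" using False e h[of k] by simp
        then show ?thesis using supp[of x] supp[of "x + h k *\<^sub>R e"] False by simp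
      qed
    qed
  qed measurable
  moreover have "(LINT x|lborel. (F (x + h k *\<^sub>R e) - F x) / h k) = 0" for k
    using shift[of "h k *\<^sub>R e"] iF by simp
  ultimately have "(\<lambda>k::nat. 0) \<longlonglongrightarrow> (LINT x|lborel. D x)" by (simp only:)
  then show ?thesis by (simp add: LIMSEQ_const_iff)
qed

lemma test_function_bounds:
  fixes \<phi> :: "real ^ 'n \<Rightarrow> real"
  assumes \<phi>: "test_function \<phi>"
  obtains R B where "R > 0" "B > 0" "\<And>x. norm x > R \<Longrightarrow> \<phi> x = 0"
    "\<And>x. norm x > R \<Longrightarrow> frechet_derivative \<phi> (at x) (axis i 1) = 0"
    "\<And>x. \<bar>\<phi> x\<bar> \<le> B" "\<And>x. \<bar>frechet_derivative \<phi> (at x) (axis i 1)\<bar> \<le> B"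
    "(\<lambda>x. frechet_derivative \<phi> (at x) (axis i 1)) \<in> borel_measurable borel"
    "\<And>x s. ((\<lambda>s. \<phi> (x + s *\<^sub>R axis i 1)) has_real_derivative
        frechet_derivative \<phi> (at (x + s *\<^sub>R axis i 1)) (axis i 1)) (at s)"
proof -
  let ?e = "axis i 1 :: real ^ 'n"
  let ?d = "\<lambda>x. frechet_derivative \<phi> (at x) ?e"
  have cont: "continuous_on UNIV \<phi>" by (rule test_function_continuous[OF \<phi>])
  have "Ck (Suc 0) \<phi>" using \<phi> by (simp only: test_function_def)
  then have diff: "\<phi> differentiable (at x)" and cd: "continuous_on UNIV ?d" for x
    by (auto simp: differentiable_on_def)
  have deriv: "(\<phi> has_derivative frechet_derivative \<phi> (at x)) (at x)" for x
    using diff frechet_derivative_works by blast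
  have "bounded (closure {x. \<phi> x \<noteq> 0})"
    using \<phi> unfolding test_function_def by (auto intro: compact_imp_bounded)
  then obtain R0 where R0: "\<And>x. x \<in> closure {x. \<phi> x \<noteq> 0} \<Longrightarrow> norm x \<le> R0"
    unfolding bounded_iff by blast
  define R where "R = \<bar>R0\<bar> + 1"
  have z: "\<phi> x = 0" if "norm x > R" for x
    using R0[of x] that closure_subset[of "{x. \<phi> x \<noteq> 0}"] unfolding R_def by force
  have dz: "?d x = 0" if "norm x > R" for x
  proof -
    have "((\<lambda>x. 0) has_derivative (\<lambda>h. 0)) (at x)" by simp
    then have "(\<phi> has_derivative (\<lambda>h. 0)) (at x)"
    proof (rule has_derivative_transform_within_open)
      show "open {x :: real ^ 'n. norm x > R}" by (intro open_Collect_less continuous_intros)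
    qed (use that z in auto)
    then have "(\<lambda>h. 0) = frechet_derivative \<phi> (at x)" by (rule frechet_derivative_at)
    then show ?thesis by metis
  qed
  have bd: "\<exists>B. \<forall>x. \<bar>g x\<bar> \<le> B" if "continuous_on UNIV g" "\<And>x. norm x > R \<Longrightarrow> g x = 0"
    for g :: "real ^ 'n \<Rightarrow> real"
  proof -
    have "bounded (g ` cball 0 R)"
      by (intro compact_imp_bounded compact_continuous_image continuous_on_subset[OF that(1)]) auto
    then obtain B where "\<forall>y\<in>g ` cball 0 R. norm y \<le> B" unfolding bounded_iff by blast
    then have "\<bar>g x\<bar> \<le> B" if "norm x \<le> R" for x using that by simp
    then have "\<bar>g x\<bar> \<le> \<bar>B\<bar>" for x
      using that(2)[of x] by (cases "norm x \<le> R") (auto intro: order_trans abs_ge_self)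
    then show ?thesis by blast
  qed
  obtain B1 B2 where B: "\<And>x. \<bar>\<phi> x\<bar> \<le> B1" "\<And>x. \<bar>?d x\<bar> \<le> B2"
    using bd[OF cont z] bd[OF cd dz] by blast
  have line: "((\<lambda>s. \<phi> (x + s *\<^sub>R ?e)) has_real_derivative ?d (x + s *\<^sub>R ?e)) (at s)" for x s
  proof -
    have "((\<lambda>s. x + s *\<^sub>R ?e) has_derivative (\<lambda>h. h *\<^sub>R ?e)) (at s)"
      by (auto intro!: derivative_eq_intros)
    then have "((\<lambda>s. \<phi> (x + s *\<^sub>R ?e)) has_derivative
        (\<lambda>h. frechet_derivative \<phi> (at (x + s *\<^sub>R ?e)) (h *\<^sub>R ?e))) (at s)"
      by (rule has_derivative_compose[OF _ deriv])
    moreover have "frechet_derivative \<phi> (at y) (h *\<^sub>R ?e) = ?d y * h" for y h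
      using linear_scale[OF has_derivative_linear[OF deriv]] by simp
    ultimately show ?thesis by (simp add: has_field_derivative_def)
  qed
  show ?thesis
  proof (rule that[of R "\<bar>B1\<bar> + \<bar>B2\<bar> + 1"])
    show "\<bar>\<phi> x\<bar> \<le> \<bar>B1\<bar> + \<bar>B2\<bar> + 1" "\<bar>?d x\<bar> \<le> \<bar>B1\<bar> + \<bar>B2\<bar> + 1" for x
      using B(1)[of x] B(2)[of x] by linarith+
    show "?d \<in> borel_measurable borel" by (rule borel_measurable_continuous_onI[OF cd])
  qed (use z dz line R_def in auto)
qed

section \<open>Calculus of the inverse volume\<close>

lemma AE_inv_vol_neq:
  assumes "y > 0"
  shows "AE x :: real ^ 'n in lborel. inv_vol x \<noteq> y"
proof -
  have "{y} \<in> null_sets lborel" by (rule finite_imp_null_set_lborel) simp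
  from AE_inv_vol_notin_null_set[OF this] show ?thesis
    by eventually_elim (use assms in auto)
qed

lemma DERIV_divide_power:
  fixes c z :: real
  assumes "c \<noteq> 0" "z \<noteq> 0"
  shows "((\<lambda>r. 1 / (c * r ^ n)) has_real_derivative - (real n / (c * z ^ Suc n))) (at z)"
proof (cases n)
  case 0
  then show ?thesis by simp
next
  case (Suc k)
  have "((\<lambda>r. c * r ^ Suc k) has_real_derivative c * (real (Suc k) * z ^ k)) (at z)"
    using DERIV_cmult[OF DERIV_pow[of "Suc k" z UNIV], of c] by simp
  from DERIV_inverse_fun[OF this] have "((\<lambda>r. inverse (c * r ^ Suc k)) has_real_derivative
      - (c * (real (Suc k) * z ^ k) * inverse ((c * z ^ Suc k) ^ Suc (Suc 0)))) (at z)"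
    using assms by simp
  moreover have "c * (real (Suc k) * z ^ k) * inverse ((c * z ^ Suc k) ^ Suc (Suc 0)) = real n / (c * z ^ Suc n)"
    using assms by (simp add: Suc field_simps)
  ultimately show ?thesis by (simp only: Suc inverse_eq_divide)
qed

lemma inv_vol_line_derivative:
  fixes x :: "real ^ 'n"
  assumes "x \<noteq> 0"
  shows "((\<lambda>s. inv_vol (x + s *\<^sub>R axis i 1)) has_real_derivative
    - (real CARD('n) * inv_vol x * x $ i / (norm x)\<^sup>2)) (at 0)"
proof -
  let ?e = "axis i 1 :: real ^ 'n"
  note c = uvol_pos[where 'n='n]
  have "((\<lambda>s. x + s *\<^sub>R ?e) has_derivative (\<lambda>h. h *\<^sub>R ?e)) (at 0)"
    by (auto intro!: derivative_eq_intros)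
  then have "((\<lambda>s. norm (x + s *\<^sub>R ?e)) has_derivative (\<lambda>h. inner (h *\<^sub>R ?e) (sgn x))) (at 0)"
    by (rule has_derivative_compose) (use has_derivative_norm[OF assms] in simp)
  moreover have "(\<lambda>h. inner (h *\<^sub>R ?e) (sgn x)) = (*) (x $ i / norm x)"
    by (auto simp: fun_eq_iff sgn_div_norm inner_axis' divide_inverse)
  ultimately have n: "((\<lambda>s. norm (x + s *\<^sub>R ?e)) has_real_derivative (x $ i / norm x)) (at 0)"
    by (simp add: has_field_derivative_def)
  have "((\<lambda>r. 1 / (uvol TYPE('n) * r ^ CARD('n))) has_real_derivative
      - (real CARD('n) / (uvol TYPE('n) * norm x ^ Suc CARD('n)))) (at (norm (x + 0 *\<^sub>R ?e)))"
    using DERIV_divide_power[of "uvol TYPE('n)" "norm x"] c assms by simp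
  from DERIV_chain2[OF this n] show ?thesis
    by (simp add: inv_vol_def power2_eq_square mult_ac)
qed

text \<open>Clamping \<open>inv_vol\<close> to [y1, y2] amounts to clamping the radius between two
  positive values, where 1/(c r^n) has a bounded derivative; \<open>K\<close> is its size at the
  smaller radius. The clamped radius also gives the continuous value y2 - y1 at the origin, where
  \<open>inv_vol\<close> itself has its default value.\<close>

lemma inv_vol_clamp:
  assumes y: "0 < y1" "y1 < y2"
  obtains \<zeta> :: "real ^ 'n \<Rightarrow> real" and K where "continuous_on UNIV \<zeta>" "K > 0" "\<And>x x'. \<bar>\<zeta> x - \<zeta> x'\<bar> \<le> K * norm (x - x')"
    "\<And>x. x \<noteq> 0 \<Longrightarrow> \<zeta> x = min y2 (max y1 (inv_vol x)) - y1"
    "\<And>x. \<bar>\<zeta> x\<bar> \<le> y2 - y1"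
proof -
  let ?n = "CARD('n)"
  let ?c = "uvol TYPE('n)"
  note c = uvol_pos[where 'n='n]
  define q where "q = (\<lambda>r. 1 / (?c * r ^ ?n))"
  define rad where "rad = (\<lambda>y. (?c * y) powr (- 1 / real ?n))"
  have rad: "rad y > 0" "q (rad y) = y" if "y > 0" for y
  proof -
    show pos: "rad y > 0" using c that by (simp add: rad_def)
    have "rad y ^ ?n = rad y powr real ?n" using pos by (simp add: powr_realpow)
    also have "\<dots> = (?c * y) powr (- 1)" by (simp add: rad_def powr_powr)
    finally show "q (rad y) = y" using c that by (simp add: q_def powr_minus_divide)
  qed
  have qanti: "q s \<le> q r" if "0 < r" "r \<le> s" for r s
    unfolding q_def using that c by (intro divide_left_mono mult_left_mono power_mono mult_pos_pos) auto
  have rr: "rad y2 \<le> rad y1"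
    unfolding rad_def using y c by (intro powr_mono2') auto
  define h where "h = (\<lambda>r. max (rad y2) (min (rad y1) r))"
  have h_lip: "\<bar>h r - h s\<bar> \<le> \<bar>r - s\<bar>" for r s by (auto simp: h_def max_def min_def)
  have h_ge: "h r \<ge> rad y2" "h r \<le> rad y1" for r using rr by (auto simp: h_def)
  define K where "K = real ?n / (?c * rad y2 ^ Suc ?n)"
  have K: "K > 0" using c rad(1)[of y2] y by (simp add: K_def)
  have q_lip: "\<bar>q r - q s\<bar> \<le> K * \<bar>r - s\<bar>" if "r \<ge> rad y2" "s \<ge> rad y2" for r s
  proof -
    have "norm (q r - q s) \<le> K * norm (r - s)"
    proof (rule field_differentiable_bound[where S="{rad y2..}"])
      fix z assume z: "z \<in> {rad y2..}"
      then have z0: "z > 0" using rad(1)[of y2] y by auto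
      show "(q has_field_derivative - (real ?n / (?c * z ^ Suc ?n))) (at z within {rad y2..})"
        unfolding q_def by (rule has_field_derivative_at_within[OF DERIV_divide_power]) (use c z0 in auto)
      have "real ?n / (?c * z ^ Suc ?n) \<le> K"
        unfolding K_def using z c rad(1)[of y2] y z0
        by (intro divide_left_mono mult_left_mono power_mono mult_pos_pos zero_less_power) auto
      then show "norm (- (real ?n / (?c * z ^ Suc ?n))) \<le> K" using c z0 by simp
    qed (use that in auto)
    then show ?thesis by simp
  qed
  define \<zeta> where "\<zeta> = (\<lambda>x :: real ^ 'n. q (h (norm x)) - y1)"
  have lip: "\<bar>\<zeta> x - \<zeta> x'\<bar> \<le> K * norm (x - x')" for x x'
  proof -
    have "\<bar>\<zeta> x - \<zeta> x'\<bar> \<le> K * \<bar>h (norm x) - h (norm x')\<bar>"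
      unfolding \<zeta>_def using q_lip[OF h_ge(1) h_ge(1)] by simp
    also have "\<dots> \<le> K * norm (x - x')"
      using K h_lip norm_triangle_ineq3[of x x'] by (intro mult_left_mono) (auto intro: order_trans)
    finally show ?thesis .
  qed
  have "continuous_on UNIV \<zeta>"
    by (rule lipschitz_on_continuous_on[of K], rule lipschitz_onI)
      (use lip K in \<open>auto simp: dist_norm\<close>)
  moreover have "\<zeta> x = min y2 (max y1 (inv_vol x)) - y1" if "x \<noteq> 0" for x
  proof -
    have T: "inv_vol x = q (norm x)" by (simp add: inv_vol_def q_def)
    have nx: "norm x > 0" using that by simp
    consider "norm x \<le> rad y2" | "rad y1 \<le> norm x" | "rad y2 \<le> norm x" "norm x \<le> rad y1" by linarith
    then show ?thesis
    proof cases
      case 1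
      then have "h (norm x) = rad y2" "y2 \<le> inv_vol x"
        using rr qanti[OF nx 1] rad(2)[of y2] y by (auto simp: h_def T)
      then show ?thesis using rad(2)[of y2] y by (simp add: \<zeta>_def)
    next
      case 2
      then have "h (norm x) = rad y1" "inv_vol x \<le> y1"
        using rr qanti[OF rad(1) 2] rad(2)[of y1] y by (auto simp: h_def T)
      then show ?thesis using rad(2)[of y1] y by (simp add: \<zeta>_def)
    next
      case 3
      then have "h (norm x) = norm x" "y1 \<le> inv_vol x" "inv_vol x \<le> y2"
        using qanti[OF rad(1) 3(1)] qanti[OF nx 3(2)] rad(2)[of y1] rad(2)[of y2] y by (auto simp: h_def T)
      then show ?thesis by (simp add: \<zeta>_def T)
    qed
  qed
  moreover have "\<bar>\<zeta> x\<bar> \<le> y2 - y1" for x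
    using qanti[OF rad(1) h_ge(1)[of "norm x"]] qanti[of "h (norm x)" "rad y1"] h_ge[of "norm x"]
      rad[of y1] rad[of y2] y by (auto simp: \<zeta>_def)
  ultimately show ?thesis using that K lip by blast
qed

lemma inverse_norm_eq:
  fixes x :: "real ^ 'n"
  assumes "x \<noteq> 0"
  shows "1 / norm x = (uvol TYPE('n) * inv_vol x) powr (1 / real CARD('n))"
proof -
  have "uvol TYPE('n) * inv_vol x = (1 / norm x) powr real CARD('n)"
    using uvol_pos[where 'n='n] assms by (simp add: inv_vol_def powr_realpow power_divide)
  then show ?thesis using assms by (simp add: powr_powr)
qed

text \<open>This is minus the i-th partial derivative of \<open>inv_vol\<close>, times the test
  function: the density on space whose slices over the levels y are the values of
  \<open>flux\<close>.\<close>

definition flux_density :: "(real ^ 'n \<Rightarrow> real) \<Rightarrow> 'n \<Rightarrow> real ^ 'n \<Rightarrow> real" where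
  "flux_density \<phi> i x = real CARD('n) * inv_vol x * x $ i / (norm x)\<^sup>2 * \<phi> x"

text \<open>The region is a centred ball up to a point, so by the divergence theorem this is the
  integral of \<open>\<phi>\<close> times the i-th component of the outer normal over its boundary
  sphere. The volume form keeps surface measures out of the argument.\<close>

definition flux :: "(real ^ 'n \<Rightarrow> real) \<Rightarrow> 'n \<Rightarrow> real \<Rightarrow> real" where
  "flux \<phi> i y = (LINT x|lborel. (if y < inv_vol x then frechet_derivative \<phi> (at x) (axis i 1) else 0))"

lemma flux_density_bound:
  fixes x :: "real ^ 'n"
  assumes "\<And>x. norm x > R \<Longrightarrow> \<phi> x = 0" "\<And>x. \<bar>\<phi> x\<bar> \<le> B"
  shows "\<bar>flux_density \<phi> i x\<bar> \<le> indicator (cball 0 R) x *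
    (real CARD('n) * inv_vol x * (uvol TYPE('n) * inv_vol x) powr (1 / real CARD('n)) * B)"
proof (cases "x = 0 \<or> norm x > R")
  case True
  then show ?thesis using assms(1)[of x] by (auto simp: flux_density_def)
next
  case False
  then have T: "inv_vol x > 0" and nz: "x \<noteq> 0" by (auto simp: inv_vol_pos)
  have "\<bar>flux_density \<phi> i x\<bar> = real CARD('n) * inv_vol x * (\<bar>x $ i\<bar> / (norm x)\<^sup>2) * \<bar>\<phi> x\<bar>"
    using T by (simp add: flux_density_def abs_mult)
  also have "\<dots> \<le> real CARD('n) * inv_vol x * (1 / norm x) * B"
  proof (intro mult_mono mult_left_mono)
    have "\<bar>x $ i\<bar> / (norm x)\<^sup>2 \<le> norm x / (norm x)\<^sup>2"
      by (intro divide_right_mono component_le_norm_cart) simp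
    then show "\<bar>x $ i\<bar> / (norm x)\<^sup>2 \<le> 1 / norm x" using False by (simp add: power2_eq_square)
  qed (use T assms(2)[of x] in auto)
  finally show ?thesis using False unfolding inverse_norm_eq[OF nz] by simp
qed

lemma integrable_bounded_cball:
  fixes f :: "'a :: euclidean_space \<Rightarrow> real"
  assumes [measurable]: "f \<in> borel_measurable borel" and b: "\<And>x. \<bar>f x\<bar> \<le> indicator (cball 0 R) x * C"
  shows "integrable lborel f"
proof (rule Bochner_Integration.integrable_bound)
  show "integrable lborel (\<lambda>x :: 'a. indicator (cball 0 R) x * C)"
    by (rule integrable_mult_left) (auto intro!: integrable_real_indicator emeasure_lborel_cball_finite)
  show "AE x in lborel. norm (f x) \<le> norm (indicator (cball 0 R) x * C)"
    using b by (auto intro!: AE_I2 intro: order_trans abs_ge_self)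
qed simp

lemma flux_density_measurable:
  "test_function \<phi> \<Longrightarrow> flux_density \<phi> i \<in> borel_measurable borel"
  using test_function_borel[of \<phi>] unfolding flux_density_def by measurable

lemma integrable_flux_density:
  assumes \<phi>: "test_function \<phi>" and ab: "0 < a" "a < b"
  shows "integrable lborel (\<lambda>x. indicator {a<..<b} (inv_vol x) * flux_density \<phi> i x)"
proof -
  obtain R B where R: "R > 0" "B > 0" "\<And>x. norm x > R \<Longrightarrow> \<phi> x = 0" "\<And>x. \<bar>\<phi> x\<bar> \<le> B"
    using test_function_bounds[OF \<phi>] by metis
  note [measurable] = flux_density_measurable[OF \<phi>]
  let ?C = "real CARD('a) * b * (uvol TYPE('a) * b) powr (1 / real CARD('a)) * B"
  show ?thesis
  proof (rule integrable_bounded_cball[where R=R and C="?C"])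
    fix x
    show "\<bar>indicator {a<..<b} (inv_vol x) * flux_density \<phi> i x\<bar> \<le> indicator (cball 0 R) x * ?C"
    proof (cases "inv_vol x \<in> {a<..<b}")
      case True
      have "\<bar>flux_density \<phi> i x\<bar> \<le> indicator (cball 0 R) x *
          (real CARD('a) * inv_vol x * (uvol TYPE('a) * inv_vol x) powr (1 / real CARD('a)) * B)"
        using R(3,4) by (rule flux_density_bound)
      also have "\<dots> \<le> indicator (cball 0 R) x * ?C"
        using True ab uvol_pos[where 'n='a] R
        by (intro mult_left_mono mult_right_mono mult_mono powr_mono2) auto
      finally show ?thesis using True by simp
    next
      case False
      then show ?thesis using ab R uvol_pos[where 'n='a] by simp
    qed
  qed measurable
qed

text \<open>The clamp is Lipschitz, so its product with \<open>\<phi>\<close> is Lipschitz with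
  bounded support and its directional derivative integrates to zero. The kinks lie on the two
  spheres where \<open>inv_vol\<close> is \<open>y1\<close> or \<open>y2\<close>, which are null;
  outside the shell between them the clamp is locally constant.\<close>

lemma clamp_integration_by_parts:
  fixes \<phi> :: "real ^ 'n \<Rightarrow> real"
  assumes \<phi>: "test_function \<phi>" and y: "0 < y1" "y1 < y2"
  shows "(LINT x|lborel. (min y2 (max y1 (inv_vol x)) - y1) * frechet_derivative \<phi> (at x) (axis i 1))
    = (LINT x|lborel. indicator {y1<..<y2} (inv_vol x) * flux_density \<phi> i x)"
proof -
  let ?e = "axis i 1 :: real ^ 'n"
  let ?d = "\<lambda>x. frechet_derivative \<phi> (at x) ?e"
  obtain R B where R: "R > 0" "B > 0" "\<And>x. norm x > R \<Longrightarrow> \<phi> x = 0" "\<And>x. norm x > R \<Longrightarrow> ?d x = 0"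
    "\<And>x. \<bar>\<phi> x\<bar> \<le> B" "\<And>x. \<bar>?d x\<bar> \<le> B" and [measurable]: "?d \<in> borel_measurable borel"
    and line: "\<And>x s. ((\<lambda>s. \<phi> (x + s *\<^sub>R ?e)) has_real_derivative ?d (x + s *\<^sub>R ?e)) (at s)"
    using test_function_bounds[OF \<phi>, of i] by metis
  obtain \<zeta> :: "real ^ 'n \<Rightarrow> real" and K where \<zeta>: "continuous_on UNIV \<zeta>" "K > 0"
    "\<And>x x'. \<bar>\<zeta> x - \<zeta> x'\<bar> \<le> K * norm (x - x')"
    "\<And>x. x \<noteq> 0 \<Longrightarrow> \<zeta> x = min y2 (max y1 (inv_vol x)) - y1" "\<And>x. \<bar>\<zeta> x\<bar> \<le> y2 - y1"
    using inv_vol_clamp[OF y] by metis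
  note [measurable] = test_function_borel[OF \<phi>] flux_density_measurable[OF \<phi>]
  have [measurable]: "\<zeta> \<in> borel_measurable borel" by (rule borel_measurable_continuous_onI[OF \<zeta>(1)])
  define D where "D = (\<lambda>x. \<zeta> x * ?d x - indicator {y1<..<y2} (inv_vol x) * flux_density \<phi> i x)"
  have "(LINT x|lborel. D x) = 0"
  proof (rule integral_directional_derivative_eq_0[where F="\<lambda>x. \<zeta> x * \<phi> x" and e="?e"
        and K="(y2 - y1) * B + B * K" and R=R])
    show "D \<in> borel_measurable borel" unfolding D_def by measurable
    show "norm ?e = 1" by simp
    show "\<zeta> x * \<phi> x = 0" if "norm x > R" for x using R(3)[OF that] by simp
    show "\<bar>\<zeta> (x + h *\<^sub>R ?e) * \<phi> (x + h *\<^sub>R ?e) - \<zeta> x * \<phi> x\<bar> \<le> ((y2 - y1) * B + B * K) * \<bar>h\<bar>" for x h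
    proof -
      have "norm (\<phi> (x + h *\<^sub>R ?e) - \<phi> (x + 0 *\<^sub>R ?e)) \<le> B * norm (h - 0)"
        by (rule field_differentiable_bound[where S=UNIV and f'="\<lambda>s. ?d (x + s *\<^sub>R ?e)"])
          (use line R(6) in auto)
      then have 1: "\<bar>\<phi> (x + h *\<^sub>R ?e) - \<phi> x\<bar> \<le> B * \<bar>h\<bar>" by simp
      have 2: "\<bar>\<zeta> (x + h *\<^sub>R ?e) - \<zeta> x\<bar> \<le> K * \<bar>h\<bar>"
        using \<zeta>(3)[of "x + h *\<^sub>R ?e" x] by simp
      have "\<zeta> (x + h *\<^sub>R ?e) * \<phi> (x + h *\<^sub>R ?e) - \<zeta> x * \<phi> x
        = \<zeta> (x + h *\<^sub>R ?e) * (\<phi> (x + h *\<^sub>R ?e) - \<phi> x) + \<phi> x * (\<zeta> (x + h *\<^sub>R ?e) - \<zeta> x)"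
        by (simp add: algebra_simps)
      also have "\<bar>\<dots>\<bar> \<le> \<bar>\<zeta> (x + h *\<^sub>R ?e)\<bar> * \<bar>\<phi> (x + h *\<^sub>R ?e) - \<phi> x\<bar> + \<bar>\<phi> x\<bar> * \<bar>\<zeta> (x + h *\<^sub>R ?e) - \<zeta> x\<bar>"
        by (simp add: abs_mult[symmetric] abs_triangle_ineq)
      also have "\<dots> \<le> (y2 - y1) * (B * \<bar>h\<bar>) + B * (K * \<bar>h\<bar>)"
        using 1 2 \<zeta>(5)[of "x + h *\<^sub>R ?e"] R(2) R(5)[of x] y by (intro add_mono mult_mono) auto
      finally show ?thesis by (simp add: algebra_simps)
    qed
    show "AE x in lborel. ((\<lambda>s. \<zeta> (x + s *\<^sub>R ?e) * \<phi> (x + s *\<^sub>R ?e)) has_real_derivative D x) (at 0)"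
      using AE_inv_vol_neq[OF y(1), where 'n='n] AE_inv_vol_neq[of y2, where 'n='n, OF order.strict_trans[OF y]]
        AE_lborel_singleton[of "0 :: real ^ 'n"]
    proof eventually_elim
      case (elim x)
      let ?T = "\<lambda>s. inv_vol (x + s *\<^sub>R ?e)"
      note dT = inv_vol_line_derivative[OF elim(3), of i]
      have cT: "isCont ?T 0" by (rule DERIV_isCont[OF dT])
      have T0: "inv_vol x > 0" using elim(3) by (simp add: inv_vol_pos)
      have "(?T \<longlongrightarrow> ?T 0) (nhds 0)"
        using tendsto_at_iff_tendsto_nhds[of ?T 0] cT unfolding isCont_def by blast
      then have tl: "(?T \<longlongrightarrow> inv_vol x) (nhds 0)" by simp
      have ne: "\<forall>\<^sub>F s in nhds 0. x + s *\<^sub>R ?e \<noteq> 0"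
        using order_tendstoD(1)[OF tl T0] by eventually_elim (simp add: inv_vol_pos)
      have "((\<lambda>s. \<zeta> (x + s *\<^sub>R ?e)) has_real_derivative
          - (indicator {y1<..<y2} (inv_vol x) * (real CARD('n) * inv_vol x * x $ i / (norm x)\<^sup>2))) (at 0)"
      proof -
        consider "inv_vol x < y1" | "inv_vol x > y2" | "y1 < inv_vol x" "inv_vol x < y2"
          using elim(1,2) by linarith
        then show ?thesis
        proof cases
          case 1
          have "\<forall>\<^sub>F s in nhds 0. \<zeta> (x + s *\<^sub>R ?e) = 0"
            using order_tendstoD(2)[OF tl 1] ne by eventually_elim (use y in \<open>simp add: \<zeta>(4)\<close>)
          then show ?thesis using 1 by (subst DERIV_cong_ev[OF refl _ refl, of _ "\<lambda>_. 0"]) auto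
        next
          case 2
          have "\<forall>\<^sub>F s in nhds 0. \<zeta> (x + s *\<^sub>R ?e) = y2 - y1"
            using order_tendstoD(1)[OF tl 2] ne by eventually_elim (use y in \<open>simp add: \<zeta>(4)\<close>)
          then show ?thesis using 2 by (subst DERIV_cong_ev[OF refl _ refl, of _ "\<lambda>_. y2 - y1"]) auto
        next
          case 3
          have "\<forall>\<^sub>F s in nhds 0. \<zeta> (x + s *\<^sub>R ?e) = ?T s - y1"
            using order_tendstoD(1)[OF tl 3(1)] order_tendstoD(2)[OF tl 3(2)] ne
            by eventually_elim (use y in \<open>simp add: \<zeta>(4)\<close>)
          moreover have "((\<lambda>s. ?T s - y1) has_real_derivative
            - (real CARD('n) * inv_vol x * x $ i / (norm x)\<^sup>2)) (at 0)"
            using DERIV_diff[OF dT DERIV_const[of y1]] by simp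
          ultimately show ?thesis using 3 by (subst DERIV_cong_ev[OF refl _ refl, of _ "\<lambda>s. ?T s - y1"]) auto
        qed
      qed
      from DERIV_mult[OF this line[of x 0]] show ?case
        by (simp add: D_def flux_density_def algebra_simps)
    qed
  qed measurable
  moreover have "integrable lborel (\<lambda>x. \<zeta> x * ?d x)"
  proof (rule integrable_bounded_cball[where R=R and C="(y2 - y1) * B"])
    fix x
    have "\<bar>\<zeta> x * ?d x\<bar> \<le> (y2 - y1) * B"
      unfolding abs_mult using \<zeta>(5)[of x] R(6)[of x] y by (intro mult_mono) auto
    then show "\<bar>\<zeta> x * ?d x\<bar> \<le> indicator (cball 0 R) x * ((y2 - y1) * B)"
      using R(4)[of x] by (cases "norm x \<le> R") auto
  qed measurable
  moreover note integrable_flux_density[OF \<phi> y, of i]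
  ultimately have "(LINT x|lborel. \<zeta> x * ?d x) = (LINT x|lborel. indicator {y1<..<y2} (inv_vol x) * flux_density \<phi> i x)"
    by (simp add: D_def)
  moreover have "(LINT x|lborel. \<zeta> x * ?d x) = (LINT x|lborel. (min y2 (max y1 (inv_vol x)) - y1) * ?d x)"
  proof (rule integral_cong_AE)
    show "AE x in lborel. \<zeta> x * ?d x = (min y2 (max y1 (inv_vol x)) - y1) * ?d x"
      using AE_lborel_singleton[of "0 :: real ^ 'n"] by eventually_elim (simp add: \<zeta>(4))
  qed measurable
  ultimately show ?thesis by simp
qed

text \<open>The region of integration has volume 1/y. The resulting bound on y times the flux makes
  that product integrable against a probability density.\<close>

lemma flux_bound:
  fixes \<phi> :: "real ^ 'n \<Rightarrow> real"
  assumes "y > 0" "B > 0" "\<And>x. \<bar>frechet_derivative \<phi> (at x) (axis i 1)\<bar> \<le> B"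
    and [measurable]: "(\<lambda>x. frechet_derivative \<phi> (at x) (axis i 1)) \<in> borel_measurable borel"
  shows "\<bar>flux \<phi> i y\<bar> \<le> B / y"
proof -
  let ?S = "{x :: real ^ 'n. y < inv_vol x}"
  have S: "emeasure lborel ?S = ennreal (1 / y)" by (rule emeasure_inv_vol_gt[OF assms(1)])
  have i: "integrable lborel (\<lambda>x. B * indicator ?S x)"
    using S by (intro integrable_mult_right integrable_real_indicator) (simp_all add: S)
  have "\<bar>flux \<phi> i y\<bar> \<le> (LINT x|lborel. \<bar>if y < inv_vol x then frechet_derivative \<phi> (at x) (axis i 1) else 0\<bar>)"
    unfolding flux_def by (rule integral_abs_bound)
  also have "\<dots> \<le> (LINT x|lborel. B * indicator ?S x)"
    by (rule integral_mono'[OF i]) (use assms in \<open>auto simp: indicator_def\<close>)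
  also have "\<dots> = B / y" using S assms(1) by (simp add: measure_def)
  finally show ?thesis .
qed

lemma flux_measurable:
  assumes [measurable]: "(\<lambda>x. frechet_derivative \<phi> (at x) (axis i 1)) \<in> borel_measurable borel"
  shows "flux \<phi> i \<in> borel_measurable borel"
proof -
  have "(\<lambda>y. LINT x|lborel. (if y < inv_vol x then frechet_derivative \<phi> (at x) (axis i 1) else 0)) \<in> borel_measurable lborel"
    by measurable
  then show ?thesis unfolding flux_def by simp
qed

text \<open>A coarea formula written without surface integrals: integrating the indicator of y <
  inv_vol x over a < y < b gives the clamped inverse volume minus a, to which
  \<open>clamp_integration_by_parts\<close> applies.\<close>

lemma integral_flux:
  fixes \<phi> :: "real ^ 'n \<Rightarrow> real"
  assumes \<phi>: "test_function \<phi>" and ab: "0 < a" "a < b"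
  shows "(LINT y|lborel. indicator {a<..<b} y * flux \<phi> i y)
    = (LINT x|lborel. indicator {a<..<b} (inv_vol x) * flux_density \<phi> i x)"
proof -
  let ?d = "\<lambda>x. frechet_derivative \<phi> (at x) (axis i 1)"
  obtain R B where R: "R > 0" "B > 0" "\<And>x. norm x > R \<Longrightarrow> ?d x = 0" "\<And>x. \<bar>?d x\<bar> \<le> B"
    and [measurable]: "?d \<in> borel_measurable borel"
    using test_function_bounds[OF \<phi>, of i] by metis
  let ?f = "\<lambda>(x, y). indicator {a<..<b} y * (if y < inv_vol x then ?d x else 0)"
  have int: "integrable (lborel \<Otimes>\<^sub>M lborel) ?f"
  proof (rule Bochner_Integration.integrable_bound)
    have "emeasure (lborel \<Otimes>\<^sub>M lborel) (cball (0 :: real ^ 'n) R \<times> {a<..<b}) < \<infinity>"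
      using emeasure_lborel_cball_finite[of "0 :: real ^ 'n" R] ab
      by (subst lborel.emeasure_pair_measure_Times) (auto simp: ennreal_mult_less_top)
    then show "integrable (lborel \<Otimes>\<^sub>M lborel) (\<lambda>z. B * indicator (cball (0 :: real ^ 'n) R \<times> {a<..<b}) z)"
      by (intro integrable_mult_right integrable_real_indicator) auto
    show "AE z in lborel \<Otimes>\<^sub>M lborel. norm (?f z) \<le> norm (B * indicator (cball (0 :: real ^ 'n) R \<times> {a<..<b}) z)"
    proof (rule AE_I2)
      fix z :: "(real ^ 'n) \<times> real"
      show "norm (?f z) \<le> norm (B * indicator (cball (0 :: real ^ 'n) R \<times> {a<..<b}) z)"
        using R(2) R(3)[of "fst z"] R(4)[of "fst z"]
        by (cases z, cases "norm (fst z) \<le> R") (auto simp: indicator_def)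
    qed
  qed measurable
  have inner: "(LINT y|lborel. ?f (x, y)) = (min b (max a (inv_vol x)) - a) * ?d x" for x
  proof -
    have "(LINT y|lborel. ?f (x, y)) = (LINT y|lborel. ?d x * indicator {a<..<min b (max a (inv_vol x))} y)"
      by (intro Bochner_Integration.integral_cong) (auto simp: indicator_def)
    then show ?thesis using ab by simp
  qed
  have "(LINT y|lborel. indicator {a<..<b} y * flux \<phi> i y) = (LINT y|lborel. LINT x|lborel. ?f (x, y))"
    by (simp add: flux_def)
  also have "\<dots> = (LINT x|lborel. LINT y|lborel. ?f (x, y))"
    using lborel_pair.Fubini_integral[of "\<lambda>x y. ?f (x, y)"] int by simp
  also have "\<dots> = (LINT x|lborel. (min b (max a (inv_vol x)) - a) * ?d x)" by (simp only: inner)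
  finally show ?thesis using clamp_integration_by_parts[OF \<phi> ab, of i] by simp
qed

section \<open>Superpositions of balls and their radial gradients\<close>

definition layer_fun :: "(real \<Rightarrow> real) \<Rightarrow> real ^ 'n \<Rightarrow> real" where
  "layer_fun u x = (LINT m|unit_lborel. (if u m < inv_vol x then u m else 0))"

definition radial_gradient :: "(real \<Rightarrow> real) \<Rightarrow> real ^ 'n \<Rightarrow> real ^ 'n" where
  "radial_gradient \<rho> x = - (real CARD('n) * (inv_vol x)\<^sup>2 * \<rho> (inv_vol x) / (norm x)\<^sup>2) *\<^sub>R x"

lemma layer_fun_measurable:
  assumes [measurable]: "u \<in> borel_measurable unit_lborel"
  shows "layer_fun u \<in> borel_measurable borel"
proof -
  interpret sigma_finite_measure unit_lborel
    by (rule prob_space_imp_sigma_finite[OF prob_space_unit_lborel])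
  have "(\<lambda>x :: real ^ 'a. LINT m|unit_lborel. (if u m < inv_vol x then u m else 0)) \<in> borel_measurable lborel"
    by measurable
  then show ?thesis unfolding layer_fun_def by simp
qed

text \<open>The layer of \<open>m\<close> has height \<open>u m\<close> on a set of volume 1 / u m,
  hence unit mass for every \<open>m\<close>. The bounded weight \<open>d\<close> is 1 for the
  integrability of \<open>layer_fun\<close>, and a partial derivative of a test function for
  Fubini's theorem.\<close>

lemma integrable_layer:
  assumes [measurable]: "u \<in> borel_measurable unit_lborel" and pos: "\<And>m. m \<in> {0<..<1} \<Longrightarrow> 0 < u m"
    and [measurable]: "d \<in> borel_measurable borel" and B: "\<And>x. \<bar>d x\<bar> \<le> B"
  shows "integrable (lborel \<Otimes>\<^sub>M unit_lborel) (\<lambda>(x :: real ^ 'n, m). (if u m < inv_vol x then u m else 0) * d x)"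
proof -
  interpret P: prob_space unit_lborel by (rule prob_space_unit_lborel)
  interpret pair_sigma_finite "lborel :: (real ^ 'n) measure" unit_lborel ..
  show ?thesis
  proof (rule integrableI_bounded)
    have "(\<integral>\<^sup>+ z. ennreal (norm (case z of (x :: real ^ 'n, m) \<Rightarrow> (if u m < inv_vol x then u m else 0) * d x))
        \<partial>(lborel \<Otimes>\<^sub>M unit_lborel))
      \<le> (\<integral>\<^sup>+ z. (case z of (x :: real ^ 'n, m) \<Rightarrow> ennreal (B * u m) * indicator {x. u m < inv_vol x} x)
        \<partial>(lborel \<Otimes>\<^sub>M unit_lborel))"
    proof (rule nn_integral_mono, clarify)
      fix x :: "real ^ 'n" and m assume "(x, m) \<in> space (lborel \<Otimes>\<^sub>M unit_lborel)"
      then have m: "0 < u m" using pos by (simp add: space_pair_measure space_unit_lborel)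
      have "\<bar>u m * d x\<bar> \<le> B * u m"
        using m B[of x] by (simp add: abs_mult mult.commute mult_left_mono)
      then show "ennreal (norm ((if u m < inv_vol x then u m else 0) * d x))
          \<le> ennreal (B * u m) * indicator {x. u m < inv_vol x} x"
        by (simp add: ennreal_leI)
    qed
    also have "\<dots> = (\<integral>\<^sup>+ m. \<integral>\<^sup>+ x. ennreal (B * u m) * indicator {x :: real ^ 'n. u m < inv_vol x} x \<partial>lborel \<partial>unit_lborel)"
      by (subst nn_integral_snd[symmetric]) (auto simp: indicator_def)
    also have "\<dots> = (\<integral>\<^sup>+ m. ennreal B \<partial>unit_lborel)"
    proof (rule nn_integral_cong)
      fix m assume "m \<in> space unit_lborel"
      then have m: "0 < u m" using pos by (simp add: space_unit_lborel)
      have "0 \<le> B" using B[of 0] by linarith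
      have "(\<integral>\<^sup>+ x. ennreal (B * u m) * indicator {x :: real ^ 'n. u m < inv_vol x} x \<partial>lborel)
          = ennreal (B * u m) * ennreal (1 / u m)"
        using emeasure_inv_vol_gt[OF m, where 'n='n] by (simp add: nn_integral_cmult_indicator)
      then show "(\<integral>\<^sup>+ x. ennreal (B * u m) * indicator {x :: real ^ 'n. u m < inv_vol x} x \<partial>lborel) = ennreal B"
        using m \<open>0 \<le> B\<close> by (simp add: ennreal_mult[symmetric])
    qed
    also have "\<dots> < \<infinity>" by (simp add: P.emeasure_space_1[unfolded space_unit_lborel] space_unit_lborel)
    finally show "(\<integral>\<^sup>+ z. ennreal (norm (case z of (x :: real ^ 'n, m) \<Rightarrow> (if u m < inv_vol x then u m else 0) * d x))
        \<partial>(lborel \<Otimes>\<^sub>M unit_lborel)) < \<infinity>" .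
  qed measurable
qed

text \<open>Fubini's theorem turns the left side into the integral over \<open>m\<close> of
  \<open>u m\<close> times the flux at level \<open>u m\<close>, and the law of \<open>u\<close>
  converts this into an integral over levels.\<close>

lemma integral_layer_fun_derivative:
  fixes \<phi> :: "real ^ 'n \<Rightarrow> real"
  assumes law: "has_law u \<rho>" and pos: "\<And>m. m \<in> {0<..<1} \<Longrightarrow> 0 < u m" and \<phi>: "test_function \<phi>"
  shows "integrable lborel (\<lambda>y. (if 0 < y then y * \<rho> y else 0) * flux \<phi> i y)"
    and "(LINT x|lborel. layer_fun u x * frechet_derivative \<phi> (at x) (axis i 1))
      = (LINT y|lborel. (if 0 < y then y * \<rho> y else 0) * flux \<phi> i y)"
proof -
  interpret P: prob_space unit_lborel by (rule prob_space_unit_lborel)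
  interpret pair_sigma_finite "lborel :: (real ^ 'n) measure" unit_lborel ..
  have [measurable]: "u \<in> borel_measurable unit_lborel" "\<rho> \<in> borel_measurable borel"
    and \<rho>: "\<And>y. 0 \<le> \<rho> y" and d: "distr unit_lborel borel u = density lborel (\<lambda>y. ennreal (\<rho> y))"
    using law by (auto simp: has_law_def)
  let ?d = "\<lambda>x. frechet_derivative \<phi> (at x) (axis i 1)"
  obtain B where B: "B > 0" "\<And>x. \<bar>?d x\<bar> \<le> B" and [measurable]: "?d \<in> borel_measurable borel"
    using test_function_bounds[OF \<phi>, of i] by metis
  have [measurable]: "flux \<phi> i \<in> borel_measurable borel" by (rule flux_measurable) simp
  let ?g = "\<lambda>y. (if 0 < y then y else 0) * flux \<phi> i y"
  have gB: "\<bar>?g y\<bar> \<le> B" for y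
    using flux_bound[of y B \<phi> i] B by (auto simp: abs_mult field_simps)
  have "integrable unit_lborel (\<lambda>m. ?g (u m))"
    by (rule P.integrable_const_bound[of _ B]) (use gB in auto)
  then have "integrable (distr unit_lborel borel u) ?g" by (subst integrable_distr_eq) auto
  then have "integrable lborel (\<lambda>y. \<rho> y * ?g y)"
    unfolding d using \<rho> by (subst (asm) integrable_density) auto
  moreover have eq: "\<rho> y * ?g y = (if 0 < y then y * \<rho> y else 0) * flux \<phi> i y" for y by simp
  ultimately show "integrable lborel (\<lambda>y. (if 0 < y then y * \<rho> y else 0) * flux \<phi> i y)" by (simp only:)
  have "(LINT x|lborel. layer_fun u x * ?d x)
      = (LINT x|lborel. LINT m|unit_lborel. (if u m < inv_vol x then u m else 0) * ?d x)"
    by (simp add: layer_fun_def)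
  also have "\<dots> = (LINT m|unit_lborel. LINT x|lborel. (if u m < inv_vol x then u m else 0) * ?d x)"
    using Fubini_integral[OF integrable_layer[OF _ pos _ B(2)]] by simp
  also have "\<dots> = (LINT m|unit_lborel. ?g (u m))"
  proof (rule Bochner_Integration.integral_cong[OF refl])
    fix m assume "m \<in> space unit_lborel"
    then have m: "0 < u m" using pos by (simp add: space_unit_lborel)
    have "(LINT x|lborel. (if u m < inv_vol x then u m else 0) * ?d x)
        = (LINT x|lborel. u m * (if u m < inv_vol x then ?d x else 0))"
      by (intro Bochner_Integration.integral_cong) auto
    then show "(LINT x|lborel. (if u m < inv_vol x then u m else 0) * ?d x) = ?g (u m)"
      using m by (simp add: flux_def)
  qed
  also have "\<dots> = (LINT y|distr unit_lborel borel u. ?g y)" by (subst integral_distr) auto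
  also have "\<dots> = (LINT y|lborel. \<rho> y * ?g y)"
    unfolding d using \<rho> by (subst integral_density) auto
  finally show "(LINT x|lborel. layer_fun u x * ?d x) = (LINT y|lborel. (if 0 < y then y * \<rho> y else 0) * flux \<phi> i y)"
    by (simp only: eq)
qed

text \<open>With T = inv_vol x and c the volume of the unit ball, the norm of the gradient is n T^2
  rho(T) / |x|, and 1/|x| is (c T)^(1/n). The p-th power contributes T^(2p + p/n), the push-forward
  divides by T^2, and n^p c^(p/n) is the constant left over.\<close>

lemma nn_integral_radial_gradient:
  assumes [measurable]: "\<rho> \<in> borel_measurable borel" and \<rho>: "\<And>y. 0 \<le> \<rho> y" and p: "1 < p"
  shows "(\<integral>\<^sup>+ x. ennreal (norm (radial_gradient \<rho> (x :: real ^ 'n)) powr p) \<partial>lborel)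
    = ennreal (real CARD('n) powr p * uvol TYPE('n) powr (p / real CARD('n)))
      * density_energy (2 * p - 2 + p / real CARD('n)) p \<rho>"
proof -
  let ?n = "real CARD('n)" and ?c = "uvol TYPE('n)"
  note c = uvol_pos[where 'n='n]
  let ?k = "\<lambda>y. ennreal (?n powr p * ?c powr (p / ?n)) * ennreal (y powr (2 * p + p / ?n) * \<rho> y powr p)"
  have norm: "norm (radial_gradient \<rho> x) powr p = ?n powr p * ?c powr (p / ?n) * (inv_vol x powr (2 * p + p / ?n) * \<rho> (inv_vol x) powr p)"
    if "x \<noteq> 0" for x :: "real ^ 'n"
  proof -
    have T: "inv_vol x > 0" using that by (simp add: inv_vol_pos)
    have "norm (radial_gradient \<rho> x) = ?n * (inv_vol x)\<^sup>2 * \<rho> (inv_vol x) * (1 / norm x)"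
      using \<rho>[of "inv_vol x"] that by (simp add: radial_gradient_def power2_eq_square)
    also have "\<dots> = ?n * inv_vol x powr 2 * \<rho> (inv_vol x) * (?c * inv_vol x) powr (1 / ?n)"
      using T by (simp add: inverse_norm_eq[OF that])
    moreover have "(inv_vol x powr 2) powr p = inv_vol x powr (p * 2)"
      by (simp only: powr_powr mult.commute)
    then have "(inv_vol x)\<^sup>2 powr p = inv_vol x powr (p * 2)" using T by simp
    ultimately show ?thesis
      using T c \<rho>[of "inv_vol x"] by (simp add: powr_mult powr_powr powr_add mult_ac)
  qed
  have "(\<integral>\<^sup>+ x. ennreal (norm (radial_gradient \<rho> (x :: real ^ 'n)) powr p) \<partial>lborel)
      = (\<integral>\<^sup>+ x. ?k (inv_vol (x :: real ^ 'n)) * indicator {0<..} (inv_vol x) \<partial>lborel)"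
  proof (rule nn_integral_cong)
    fix x :: "real ^ 'n"
    show "ennreal (norm (radial_gradient \<rho> x) powr p) = ?k (inv_vol x) * indicator {0<..} (inv_vol x)"
    proof (cases "x = 0")
      case True
      then show ?thesis by (simp add: radial_gradient_def)
    next
      case False
      then show ?thesis by (simp add: norm ennreal_mult' inv_vol_pos)
    qed
  qed
  also have "\<dots> = (\<integral>\<^sup>+ y. ?k y * (ennreal (1 / y\<^sup>2) * indicator {0<..} y) \<partial>lborel)"
    by (rule nn_integral_inv_vol) measurable
  also have "\<dots> = (\<integral>\<^sup>+ y. ennreal (?n powr p * ?c powr (p / ?n))
      * (indicator {0<..} y * ennreal (y powr (2 * p - 2 + p / ?n) * \<rho> y powr p)) \<partial>lborel)"
  proof (rule nn_integral_cong)
    fix y :: real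
    show "?k y * (ennreal (1 / y\<^sup>2) * indicator {0<..} y) = ennreal (?n powr p * ?c powr (p / ?n))
      * (indicator {0<..} y * ennreal (y powr (2 * p - 2 + p / ?n) * \<rho> y powr p))"
    proof (cases "y > 0")
      case True
      have "y powr (2 * p - 2 + p / ?n) = y powr (2 * p + p / ?n) * (1 / y\<^sup>2)"
        using True by (simp add: powr_diff[symmetric] powr_numeral[symmetric] algebra_simps del: powr_numeral)
      then have "ennreal (y powr (2 * p - 2 + p / ?n) * \<rho> y powr p)
          = ennreal (y powr (2 * p + p / ?n) * \<rho> y powr p) * ennreal (1 / y\<^sup>2)"
        by (simp add: ennreal_mult'[symmetric] mult_ac)
      then show ?thesis using True by (simp add: mult.assoc)
    qed simp
  qed
  also have "\<dots> = ennreal (?n powr p * ?c powr (p / ?n)) * density_energy (2 * p - 2 + p / ?n) p \<rho>"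
    unfolding density_energy_def by (rule nn_integral_cmult) measurable
  finally show ?thesis .
qed

text \<open>\<open>signed_pushforward\<close> trades the flux over levels for
  \<open>flux_density\<close> over space, and T rho(T) times that density is minus the gradient
  component times the test function. Finite energy makes the gradient locally integrable, through z
  <= z^p + 1, which gives integrability on the spatial side.\<close>

theorem layer_fun_weak_gradient:
  fixes f :: "real ^ 'n \<Rightarrow> real"
  assumes law: "has_law u \<rho>" and pos: "\<And>m. m \<in> {0<..<1} \<Longrightarrow> 0 < u m" and p: "1 < p"
    and fin: "density_energy (2 * p - 2 + p / real CARD('n)) p \<rho> < \<infinity>"
    and [measurable]: "f \<in> borel_measurable lebesgue" and f: "AE x in lebesgue. f x = layer_fun u x"
  shows "has_weak_gradient f (radial_gradient \<rho>)"
proof -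
  interpret P: prob_space unit_lborel by (rule prob_space_unit_lborel)
  interpret pair_sigma_finite "lborel :: (real ^ 'n) measure" unit_lborel ..
  have um[measurable]: "u \<in> borel_measurable unit_lborel" and [measurable]: "\<rho> \<in> borel_measurable borel"
    and \<rho>: "\<And>y. 0 \<le> \<rho> y"
    using law by (auto simp: has_law_def)
  let ?g = "radial_gradient \<rho> :: real ^ 'n \<Rightarrow> real ^ 'n"
  have [measurable]: "?g \<in> borel_measurable borel" unfolding radial_gradient_def by measurable
  have gp: "integrable lborel (\<lambda>x. norm (?g x) powr p)"
    using fin nn_integral_radial_gradient[OF _ \<rho> p, where 'n='n]
    by (intro integrableI_bounded) (auto simp: ennreal_mult_less_top)
  have ig: "integrable lborel (\<lambda>x. indicator (cball 0 R) x * norm (?g x))" for R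
  proof (rule Bochner_Integration.integrable_bound)
    show "integrable lborel (\<lambda>x. norm (?g x) powr p + indicator (cball (0 :: real ^ 'n) R) x)"
      using gp by (intro Bochner_Integration.integrable_add integrable_real_indicator emeasure_lborel_cball_finite) auto
    have "z \<le> z powr p + 1" if "0 \<le> z" for z :: real
    proof (cases "z \<le> 1")
      case False
      then have "z powr 1 \<le> z powr p" using p by (intro powr_mono) auto
      then show ?thesis using that False by simp
    qed (simp add: add_increasing)
    then show "AE x in lborel. norm (indicator (cball 0 R) x * norm (?g x)) \<le> norm (norm (?g x) powr p + indicator (cball 0 R) x)"
      by (auto simp: indicator_def)
    have "cball (0 :: real ^ 'n) R \<in> sets borel" by simp
    then show "(\<lambda>x. indicator (cball 0 R) x * norm (?g x)) \<in> borel_measurable lborel"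
      by (intro borel_measurable_times borel_measurable_indicator borel_measurable_norm) simp_all
  qed
  have li: "integrable lborel (layer_fun u :: real ^ 'n \<Rightarrow> real)"
    using integrable_fst[of "\<lambda>x m. (if u m < inv_vol x then u m else 0) * 1"]
      integrable_layer[where 'n='n and d="\<lambda>_. 1" and B=1, OF um pos]
    by (simp add: layer_fun_def[abs_def])
  then have fi: "integrable lebesgue f"
    using f layer_fun_measurable[OF um, where 'a='n]
    by (subst integrable_cong_AE[of _ _ "layer_fun u"])
      (auto simp: integrable_completion intro!: measurable_completion)
  have K: "\<exists>R. K \<subseteq> cball 0 R" if "compact K" for K :: "(real ^ 'n) set"
    using compact_imp_bounded[OF that] by (auto simp: bounded_iff subset_iff)
  have "locally_integrable f"
    unfolding locally_integrable_def set_integrable_def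
    by (intro allI impI integrable_mult_indicator[OF fmeasurableD[OF lmeasurable_compact] fi])
  moreover have "locally_integrable ?g"
    unfolding locally_integrable_def
  proof (intro allI impI)
    fix K :: "(real ^ 'n) set" assume "compact K"
    then obtain R where R: "K \<subseteq> cball 0 R" using K by blast
    have [measurable]: "K \<in> sets borel" using \<open>compact K\<close> by (rule borel_compact)
    have "integrable lborel (\<lambda>x. indicator K x *\<^sub>R ?g x)"
      by (rule Bochner_Integration.integrable_bound[OF ig[of R]]) (use R in \<open>auto simp: indicator_def subset_iff intro!: AE_I2\<close>)
    then show "set_integrable lebesgue K ?g"
      unfolding set_integrable_def by (subst integrable_completion) auto
  qed
  moreover have "(LINT x|lebesgue. f x * frechet_derivative \<phi> (at x) (axis i 1)) = - (LINT x|lebesgue. ?g x $ i * \<phi> x)"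
    if \<phi>: "test_function \<phi>" for \<phi> i
  proof -
    let ?d = "\<lambda>x. frechet_derivative \<phi> (at x) (axis i 1)"
    obtain R B where R: "R > 0" "B > 0" "\<And>x. norm x > R \<Longrightarrow> \<phi> x = 0" "\<And>x. \<bar>\<phi> x\<bar> \<le> B"
        "\<And>x. \<bar>?d x\<bar> \<le> B" and [measurable]: "?d \<in> borel_measurable borel"
      using test_function_bounds[OF \<phi>, of i] by metis
    note [measurable] = test_function_borel[OF \<phi>] flux_density_measurable[OF \<phi>, of i]
      layer_fun_measurable[OF um, where 'a='n]
    have [measurable]: "flux \<phi> i \<in> borel_measurable borel" by (rule flux_measurable) simp
    let ?k = "\<lambda>y. if 0 < y then y * \<rho> y else 0"
    have [measurable]: "(\<lambda>x. ?g x $ i) \<in> borel_measurable borel" by (simp add: cart_eq_inner_axis)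
    have [measurable]: "\<phi> \<in> borel_measurable lborel" using test_function_borel[OF \<phi>] by simp
    have kd: "?k (inv_vol x) * flux_density \<phi> i x = - (?g x $ i * \<phi> x)" for x
      by (cases "x = 0") (auto simp: inv_vol_pos flux_density_def radial_gradient_def power2_eq_square)
    have ib: "integrable lborel (\<lambda>x. ?k (inv_vol x) * flux_density \<phi> i x)"
      unfolding kd
    proof (rule Bochner_Integration.integrable_bound)
      show "integrable lborel (\<lambda>x. B * (indicator (cball 0 R) x * norm (?g x)))"
        using ig by (rule integrable_mult_right)
      have "\<bar>?g x $ i * \<phi> x\<bar> \<le> \<bar>B * (indicator (cball 0 R) x * norm (?g x))\<bar>" for x
      proof (cases "norm x \<le> R")
        case True
        have "\<bar>?g x $ i\<bar> * \<bar>\<phi> x\<bar> \<le> norm (?g x) * B"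
          using R by (intro mult_mono component_le_norm_cart) auto
        then show ?thesis using True R by (simp add: abs_mult mult.commute)
      qed (use R in auto)
      then show "AE x in lborel. norm (- (?g x $ i * \<phi> x)) \<le> norm (B * (indicator (cball 0 R) x * norm (?g x)))"
        by simp
    qed measurable
    have "(LINT x|lebesgue. f x * ?d x) = (LINT x|lebesgue. layer_fun u x * ?d x)"
    proof (rule integral_cong_AE)
      have [measurable]: "?d \<in> borel_measurable lebesgue" by (intro measurable_completion) simp
      show "(\<lambda>x. f x * ?d x) \<in> borel_measurable lebesgue" by measurable
      show "(\<lambda>x. layer_fun u x * ?d x) \<in> borel_measurable lebesgue" by (intro measurable_completion) simp
      show "AE x in lebesgue. f x * ?d x = layer_fun u x * ?d x" using f by eventually_elim simp
    qed
    also have "\<dots> = (LINT x|lborel. layer_fun u x * ?d x)" by (rule integral_completion) simp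
    also have "\<dots> = (LINT y|lborel. ?k y * flux \<phi> i y)"
      by (rule integral_layer_fun_derivative(2)[OF law pos \<phi>])
    also have "\<dots> = (LINT x|lborel. ?k (inv_vol x) * flux_density \<phi> i x)"
    proof (rule signed_pushforward[where k="?k" and X=inv_vol and \<alpha>="flux_density \<phi> i" and Y="\<lambda>y. y"
          and \<beta>="flux \<phi> i", symmetric])
      fix a b :: real assume ab: "0 < a" "a < b"
      show "integrable lborel (\<lambda>x. indicator {a<..<b} (inv_vol x) * flux_density \<phi> i x)"
        by (rule integrable_flux_density[OF \<phi> ab])
      show "(LINT x|lborel. indicator {a<..<b} (inv_vol x) * flux_density \<phi> i x) = (LINT y|lborel. indicator {a<..<b} y * flux \<phi> i y)"
        by (rule integral_flux[OF \<phi> ab, symmetric])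
      show "integrable lborel (\<lambda>y. indicator {a<..<b} y * flux \<phi> i y)"
      proof (rule integrable_bounded_cball[where R=b and C="B / a"])
        fix y
        show "\<bar>indicator {a<..<b} y * flux \<phi> i y\<bar> \<le> indicator (cball 0 b) y * (B / a)"
        proof (cases "y \<in> {a<..<b}")
          case True
          then have "\<bar>flux \<phi> i y\<bar> \<le> B / y" using ab R by (intro flux_bound) auto
          also have "\<dots> \<le> B / a" using True ab R by (intro divide_left_mono) auto
          finally show ?thesis using True ab by (simp add: dist_real_def)
        qed (use R ab in simp)
      qed measurable
    qed (use ib integral_layer_fun_derivative(1)[OF law pos \<phi>] \<rho> in auto)
    also have "\<dots> = - (LINT x|lborel. ?g x $ i * \<phi> x)" unfolding kd by simp
    also have "(LINT x|lborel. ?g x $ i * \<phi> x) = (LINT x|lebesgue. ?g x $ i * \<phi> x)"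
      by (rule integral_completion[symmetric]) simp
    finally show ?thesis .
  qed
  ultimately show ?thesis by (auto simp: has_weak_gradient_def)
qed

section \<open>Height functions\<close>

definition dist_fun :: "('a :: euclidean_space \<Rightarrow> real) \<Rightarrow> real \<Rightarrow> real" where
  "dist_fun f h = measure lborel {x. h < f x}"

definition trunc_mass :: "('a :: euclidean_space \<Rightarrow> real) \<Rightarrow> real \<Rightarrow> real" where
  "trunc_mass f h = (LINT x|lborel. min (f x) h)"

context
  fixes f :: "'a :: euclidean_space \<Rightarrow> real"
  assumes f_meas [measurable]: "f \<in> borel_measurable borel"
    and nonneg: "\<And>x. 0 \<le> f x" and f_int: "integrable lborel f" and mass: "(LINT x|lborel. f x) = 1"
begin

lemma emeasure_superlevel: "0 < h \<Longrightarrow> emeasure lborel {x. h < f x} = ennreal (dist_fun f h)"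
proof -
  assume h: "0 < h"
  have "integrable lborel (\<lambda>x. indicator {x. h < f x} x :: real)"
  proof (rule Bochner_Integration.integrable_bound)
    show "integrable lborel (\<lambda>x. f x / h)" using f_int by simp
    show "AE x in lborel. norm (indicator {x. h < f x} x :: real) \<le> norm (f x / h)"
      using h nonneg by (auto simp: indicator_def)
  qed simp
  then have "emeasure lborel {x. h < f x} < \<infinity>" by (simp add: integrable_indicator_iff)
  then show ?thesis unfolding dist_fun_def by (intro emeasure_eq_ennreal_measure) auto
qed

lemma integrable_trunc: "0 \<le> h \<Longrightarrow> integrable lborel (\<lambda>x. min (f x) h)"
  by (rule Bochner_Integration.integrable_bound[OF f_int]) (use nonneg in auto)

lemma integrable_superlevel: "0 < h \<Longrightarrow> integrable lborel (\<lambda>x. c * indicator {x. h < f x} x)" for c :: real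
  by (intro integrable_mult_right integrable_real_indicator) (auto simp: emeasure_superlevel)

lemma dist_fun_nonneg: "0 \<le> dist_fun f h" by (simp add: dist_fun_def)

text \<open>The difference of the two truncations equals h' - h where f > h', vanishes where f <= h,
  and lies in between elsewhere. The pair of bounds expresses, through chords, that
  \<open>trunc_mass f\<close> is concave with slope \<open>dist_fun f\<close>.\<close>

lemma trunc_mass_diff:
  assumes "0 < h" "h \<le> h'"
  shows "dist_fun f h' * (h' - h) \<le> trunc_mass f h' - trunc_mass f h"
    and "trunc_mass f h' - trunc_mass f h \<le> dist_fun f h * (h' - h)"
proof -
  have d: "trunc_mass f h' - trunc_mass f h = (LINT x|lborel. min (f x) h' - min (f x) h)"
    using assms integrable_trunc by (simp add: trunc_mass_def)
  have i: "integrable lborel (\<lambda>x. min (f x) h' - min (f x) h)"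
    using assms integrable_trunc by simp
  have "dist_fun f h' * (h' - h) = (LINT x|lborel. (h' - h) * indicator {x. h' < f x} x)"
    by (simp add: dist_fun_def)
  also have "\<dots> \<le> (LINT x|lborel. min (f x) h' - min (f x) h)"
    using assms by (intro integral_mono i integrable_superlevel) (auto simp: indicator_def)
  finally show "dist_fun f h' * (h' - h) \<le> trunc_mass f h' - trunc_mass f h" by (simp add: d)
  have "(LINT x|lborel. min (f x) h' - min (f x) h) \<le> (LINT x|lborel. (h' - h) * indicator {x. h < f x} x)"
    using assms by (intro integral_mono i integrable_superlevel) (auto simp: indicator_def)
  also have "\<dots> = dist_fun f h * (h' - h)" by (simp add: dist_fun_def)
  finally show "trunc_mass f h' - trunc_mass f h \<le> dist_fun f h * (h' - h)" by (simp add: d)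
qed

lemma trunc_mass_mono: "0 < h \<Longrightarrow> h \<le> h' \<Longrightarrow> trunc_mass f h \<le> trunc_mass f h'"
  using trunc_mass_diff(1)[of h h'] mult_nonneg_nonneg[OF dist_fun_nonneg[of h'], of "h' - h"] by simp

lemma dist_fun_antimono: "0 < h \<Longrightarrow> h \<le> h' \<Longrightarrow> dist_fun f h' \<le> dist_fun f h"
proof -
  assume h: "0 < h" "h \<le> h'"
  have "ennreal (dist_fun f h') \<le> ennreal (dist_fun f h)"
    using h by (subst (1 2) emeasure_superlevel[symmetric]) (auto intro!: emeasure_mono)
  then show ?thesis using dist_fun_nonneg by (simp add: ennreal_le_iff)
qed

lemma trunc_mass_bounds: "0 < h \<Longrightarrow> 0 \<le> trunc_mass f h" "0 < h \<Longrightarrow> trunc_mass f h \<le> 1"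
  unfolding trunc_mass_def mass[symmetric]
  using nonneg by (auto intro!: integral_nonneg_AE integral_mono integrable_trunc f_int)

lemma dist_fun_eq_0_iff: "0 < h \<Longrightarrow> dist_fun f h = 0 \<longleftrightarrow> trunc_mass f h = 1"
proof -
  assume h: "0 < h"
  have "dist_fun f h = 0 \<longleftrightarrow> emeasure lborel {x. h < f x} = 0"
    using emeasure_superlevel[OF h] dist_fun_nonneg[of h] by (simp add: ennreal_eq_0_iff)
  also have "\<dots> \<longleftrightarrow> (AE x in lborel. f x - min (f x) h = 0)"
    by (subst AE_iff_measurable[where N="{x. h < f x}"]) auto
  also have "\<dots> \<longleftrightarrow> (LINT x|lborel. f x - min (f x) h) = 0"
    using h f_int integrable_trunc[of h] by (subst integral_nonneg_eq_0_iff_AE) auto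
  also have "\<dots> \<longleftrightarrow> trunc_mass f h = 1"
    using h f_int integrable_trunc[of h] mass by (auto simp: trunc_mass_def)
  finally show ?thesis .
qed

lemma ex_trunc_mass:
  assumes "0 < m" "m < 1"
  shows "\<exists>h>0. trunc_mass f h = m"
proof -
  have "(\<lambda>k. LINT x|lborel. min (f x) (1 / real (Suc k))) \<longlonglongrightarrow> (LINT x|(lborel :: 'a measure). 0)"
  proof (rule integral_dominated_convergence[where w=f])
    have "(\<lambda>k. min (f x) (1 / real (Suc k))) \<longlonglongrightarrow> min (f x) 0" for x
      by (intro tendsto_min tendsto_const) (use LIMSEQ_inverse_real_of_nat in \<open>simp add: inverse_eq_divide\<close>)
    then show "AE x in lborel. (\<lambda>k. min (f x) (1 / real (Suc k))) \<longlonglongrightarrow> 0"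
      using nonneg by (simp add: min_absorb2)
  qed (use f_int nonneg in auto)
  then have "\<forall>\<^sub>F k in sequentially. trunc_mass f (1 / real (Suc k)) < m"
    using assms by (intro order_tendstoD(2)[of _ "0"]) (auto simp: trunc_mass_def)
  then obtain k where k: "trunc_mass f (1 / real (Suc k)) < m"
    by (auto simp: eventually_sequentially)
  have "(\<lambda>k. LINT x|lborel. min (f x) (real (Suc k))) \<longlonglongrightarrow> (LINT x|lborel. f x)"
  proof (rule integral_dominated_convergence[where w=f])
    have "(\<lambda>k. min (f x) (real (Suc k))) \<longlonglongrightarrow> f x" for x
    proof (rule tendsto_eventually)
      obtain N :: nat where "f x \<le> real N" using real_arch_simple by blast
      then show "\<forall>\<^sub>F k in sequentially. min (f x) (real (Suc k)) = f x"
        by (intro eventually_sequentiallyI[of N]) auto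
    qed
    then show "AE x in lborel. (\<lambda>k. min (f x) (real (Suc k))) \<longlonglongrightarrow> f x" by simp
  qed (use f_int nonneg in auto)
  then have "\<forall>\<^sub>F k in sequentially. m < trunc_mass f (real (Suc k))"
    using assms mass by (intro order_tendstoD(1)[of _ 1]) (auto simp: trunc_mass_def)
  then obtain l where l: "m < trunc_mass f (real (Suc l))"
    by (auto simp: eventually_sequentially)
  let ?a = "1 / real (Suc k)" and ?b = "real (Suc l)"
  have ab: "0 < ?a" "0 < ?b" by auto
  have le: "?a \<le> ?b"
    using trunc_mass_mono[OF ab(2), of ?a] k l by (intro leI notI) auto
  have "continuous_on {?a..?b} (trunc_mass f)"
  proof (rule lipschitz_on_continuous_on[of "dist_fun f ?a"], rule lipschitz_on_leI)
    fix x y assume xy: "x \<in> {?a..?b}" "y \<in> {?a..?b}" "x \<le> y"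
    then have "0 < x" using ab by (meson atLeastAtMost_iff less_le_trans)
    then have "trunc_mass f y - trunc_mass f x \<le> dist_fun f x * (y - x)" "trunc_mass f x \<le> trunc_mass f y"
      using trunc_mass_diff(2) trunc_mass_mono xy by auto
    moreover have "dist_fun f x * (y - x) \<le> dist_fun f ?a * (y - x)"
      using dist_fun_antimono[OF ab(1), of x] xy by (intro mult_right_mono) auto
    ultimately show "dist (trunc_mass f x) (trunc_mass f y) \<le> dist_fun f ?a * dist x y"
      using xy by (simp add: dist_real_def)
  qed (rule dist_fun_nonneg)
  then obtain h where "?a \<le> h" "trunc_mass f h = m"
    using IVT'[of "trunc_mass f" ?a m ?b] k l le by auto
  then show ?thesis using less_le_trans[OF ab(1)] by blast
qed

lemma trunc_mass_inj:
  assumes "0 < h" "0 < h'" "0 < dist_fun f h" "0 < dist_fun f h'" "trunc_mass f h = trunc_mass f h'"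
  shows "h = h'"
proof -
  have False if "0 < x" "x < y" "0 < dist_fun f y" "trunc_mass f x = trunc_mass f y" for x y
  proof -
    have "0 < dist_fun f y * (y - x)" using that by (intro mult_pos_pos) auto
    also have "\<dots> \<le> trunc_mass f y - trunc_mass f x" using that by (intro trunc_mass_diff) auto
    finally show False using that by simp
  qed
  then show ?thesis using assms by (metis linorder_cases)
qed

definition inv_trunc :: "real \<Rightarrow> real" where
  "inv_trunc m = (SOME h. 0 < h \<and> trunc_mass f h = m)"

lemma inv_trunc:
  assumes "m \<in> {0<..<1}"
  shows "0 < inv_trunc m" "trunc_mass f (inv_trunc m) = m" "0 < dist_fun f (inv_trunc m)"
proof -
  have "0 < inv_trunc m \<and> trunc_mass f (inv_trunc m) = m"
    unfolding inv_trunc_def using assms ex_trunc_mass[of m] by (intro someI_ex[of "\<lambda>h. 0 < h \<and> trunc_mass f h = m"]) auto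
  then show "0 < inv_trunc m" "trunc_mass f (inv_trunc m) = m" by auto
  then show "0 < dist_fun f (inv_trunc m)"
    using dist_fun_eq_0_iff[of "inv_trunc m"] dist_fun_nonneg[of "inv_trunc m"] assms
    by (auto simp: order.order_iff_strict)
qed

lemma inv_trunc_trunc_mass:
  assumes "0 < h" "0 < dist_fun f h"
  shows "trunc_mass f h \<in> {0<..<1}" "inv_trunc (trunc_mass f h) = h"
proof -
  have "trunc_mass f h \<noteq> 1" using dist_fun_eq_0_iff assms by force
  moreover have "0 < trunc_mass f h"
  proof -
    have "0 < dist_fun f h * (h - h / 2)" using assms by simp
    also have "\<dots> \<le> trunc_mass f h - trunc_mass f (h / 2)" using assms by (intro trunc_mass_diff) auto
    also have "\<dots> \<le> trunc_mass f h" using trunc_mass_bounds(1)[of "h / 2"] assms by simp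
    finally show ?thesis .
  qed
  ultimately show m: "trunc_mass f h \<in> {0<..<1}" using trunc_mass_bounds(2)[of h] assms by auto
  show "inv_trunc (trunc_mass f h) = h"
    by (rule trunc_mass_inj) (use inv_trunc[OF m] assms in auto)
qed

text \<open>For h > 0, lying strictly below the essential supremum means exactly that the set where
  f > h is not null. On such heights \<open>trunc_mass f\<close> is strictly increasing, so the
  definite description has a unique solution.\<close>

lemma height_eq_inv_trunc:
  assumes "m \<in> {0<..<1}"
  shows "(THE h. 0 < h \<and> ereal h < esssup lborel (\<lambda>x. ereal \<bar>f x\<bar>) \<and> (LINT x|lborel. min (f x) h) = m)
    = inv_trunc m"
proof -
  have ess: "ereal h < esssup lborel (\<lambda>x. ereal \<bar>f x\<bar>) \<longleftrightarrow> 0 < dist_fun f h" if h: "0 < h" for h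
  proof
    assume "ereal h < esssup lborel (\<lambda>x. ereal \<bar>f x\<bar>)"
    then have "0 < emeasure lborel {x \<in> space lborel. ereal h < ereal \<bar>f x\<bar>}"
      by (intro esssup_pos_measure) auto
    then show "0 < dist_fun f h" using emeasure_superlevel[OF h] nonneg by simp
  next
    assume d: "0 < dist_fun f h"
    show "ereal h < esssup lborel (\<lambda>x. ereal \<bar>f x\<bar>)"
    proof (rule ccontr)
      assume "\<not> ereal h < esssup lborel (\<lambda>x. ereal \<bar>f x\<bar>)"
      then have le: "esssup lborel (\<lambda>x. ereal \<bar>f x\<bar>) \<le> ereal h" by simp
      have "AE x in lborel. f x \<le> h"
        using esssup_AE[of "\<lambda>x. ereal \<bar>f x\<bar>" lborel]
      proof eventually_elim
        case (elim x)
        then have "ereal \<bar>f x\<bar> \<le> ereal h" using le by (rule order_trans)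
        then show ?case by simp
      qed
      then have "emeasure lborel {x. h < f x} = 0"
        by (subst (asm) AE_iff_measurable[where N="{x. h < f x}"]) (auto simp: not_le)
      then show False using d emeasure_superlevel[OF h] by (simp add: ennreal_eq_0_iff)
    qed
  qed
  show ?thesis
  proof (rule the_equality)
    show "0 < inv_trunc m \<and> ereal (inv_trunc m) < esssup lborel (\<lambda>x. ereal \<bar>f x\<bar>) \<and> (LINT x|lborel. min (f x) (inv_trunc m)) = m"
      using inv_trunc[OF assms] ess by (auto simp: trunc_mass_def)
    fix h assume h: "0 < h \<and> ereal h < esssup lborel (\<lambda>x. ereal \<bar>f x\<bar>) \<and> (LINT x|lborel. min (f x) h) = m"
    then have "0 < dist_fun f h" using ess by blast
    then show "h = inv_trunc m"
      using h inv_trunc_trunc_mass(2)[of h] by (auto simp: trunc_mass_def)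
  qed
qed

text \<open>\<open>inv_trunc\<close> is the height function and inverts \<open>trunc_mass f\<close>,
  whose slope is \<open>dist_fun f\<close>, so this is its derivative. The reciprocal is the volume
  of the superlevel set at height \<open>inv_trunc m\<close>, in agreement with the balls in
  \<open>from_height\<close>.\<close>

definition slope_fun :: "real \<Rightarrow> real" where
  "slope_fun m = 1 / dist_fun f (inv_trunc m)"

lemma inv_trunc_mono:
  assumes "m \<in> {0<..<1}" "m' \<in> {0<..<1}" "m \<le> m'"
  shows "inv_trunc m \<le> inv_trunc m'"
proof (rule ccontr)
  assume "\<not> inv_trunc m \<le> inv_trunc m'"
  then have "trunc_mass f (inv_trunc m') \<le> trunc_mass f (inv_trunc m)"
    using inv_trunc[OF assms(2)] by (intro trunc_mass_mono) auto
  then have "m = m'" using inv_trunc(2) assms by auto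
  then show False using \<open>\<not> inv_trunc m \<le> inv_trunc m'\<close> by simp
qed

lemma slope_fun_mono: "mono_on {0<..<1} slope_fun"
  unfolding slope_fun_def
  by (intro mono_onI divide_left_mono dist_fun_antimono inv_trunc_mono mult_pos_pos inv_trunc) auto

lemma slope_fun_pos: "m \<in> {0<..<1} \<Longrightarrow> 0 < slope_fun m"
  using inv_trunc(3) by (simp add: slope_fun_def)

lemma inv_trunc_diff:
  assumes m: "m \<in> {0<..<1}" "m' \<in> {0<..<1}" "m \<le> m'"
  shows "slope_fun m * (m' - m) \<le> inv_trunc m' - inv_trunc m"
    and "inv_trunc m' - inv_trunc m \<le> slope_fun m' * (m' - m)"
proof -
  note i = inv_trunc[OF m(1)] inv_trunc[OF m(2)]
  have "dist_fun f (inv_trunc m') * (inv_trunc m' - inv_trunc m) \<le> m' - m"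
    "m' - m \<le> dist_fun f (inv_trunc m) * (inv_trunc m' - inv_trunc m)"
    using trunc_mass_diff[OF i(1) inv_trunc_mono[OF m]] i by auto
  then show "slope_fun m * (m' - m) \<le> inv_trunc m' - inv_trunc m"
    "inv_trunc m' - inv_trunc m \<le> slope_fun m' * (m' - m)"
    using i by (auto simp: slope_fun_def field_simps)
qed

section \<open>Layer-cake formula and the change of variables from heights to masses\<close>

lemma dist_fun_measurable [measurable]: "dist_fun f \<in> borel_measurable borel"
proof -
  have "dist_fun f = (\<lambda>h. enn2real (\<integral>\<^sup>+ x. (if h < f x then 1 else 0) \<partial>lborel))"
  proof
    fix h
    have "(\<integral>\<^sup>+ x. (if h < f x then 1 else 0) \<partial>lborel) = (\<integral>\<^sup>+ x. indicator {x. h < f x} x \<partial>lborel)"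
      by (intro nn_integral_cong) auto
    then show "dist_fun f h = enn2real (\<integral>\<^sup>+ x. (if h < f x then 1 else 0) \<partial>lborel)"
      by (simp add: dist_fun_def measure_def)
  qed
  moreover have "(\<lambda>h. enn2real (\<integral>\<^sup>+ x. (if h < f x then 1 else 0) \<partial>lborel)) \<in> borel_measurable lborel"
    by measurable
  ultimately show ?thesis by simp
qed

lemma nn_integral_dist_fun:
  assumes c: "0 \<le> c"
  shows "(\<integral>\<^sup>+ h. ennreal (dist_fun f h) * indicator {c<..} h \<partial>lborel) = (\<integral>\<^sup>+ x. ennreal (f x - c) \<partial>lborel)"
proof -
  have "(\<integral>\<^sup>+ h. ennreal (dist_fun f h) * indicator {c<..} h \<partial>lborel)
      = (\<integral>\<^sup>+ h. (\<integral>\<^sup>+ x. (if c < h \<and> h < f x then 1 else 0) \<partial>lborel) \<partial>lborel)"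
  proof (rule nn_integral_cong)
    fix h :: real
    have "ennreal (dist_fun f h) = (\<integral>\<^sup>+ x. (if c < h \<and> h < f x then 1 else 0) \<partial>lborel)" if "c < h"
    proof -
      have "(\<integral>\<^sup>+ x. (if c < h \<and> h < f x then 1 else 0) \<partial>lborel) = (\<integral>\<^sup>+ x. indicator {x. h < f x} x \<partial>lborel)"
        using that by (intro nn_integral_cong) auto
      then show ?thesis using that c by (simp add: emeasure_superlevel)
    qed
    then show "ennreal (dist_fun f h) * indicator {c<..} h = (\<integral>\<^sup>+ x. (if c < h \<and> h < f x then 1 else 0) \<partial>lborel)"
      by (cases "c < h") simp_all
  qed
  also have "\<dots> = (\<integral>\<^sup>+ x. (\<integral>\<^sup>+ h. (if c < h \<and> h < f x then 1 else 0) \<partial>lborel) \<partial>lborel)"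
    by (rule lborel_pair.Fubini') measurable
  also have "\<dots> = (\<integral>\<^sup>+ x. ennreal (f x - c) \<partial>lborel)"
  proof (rule nn_integral_cong)
    fix x
    have "(\<integral>\<^sup>+ h. (if c < h \<and> h < f x then 1 else 0) \<partial>lborel) = (\<integral>\<^sup>+ h. indicator {c<..<f x} h \<partial>lborel)"
      by (intro nn_integral_cong) auto
    also have "\<dots> = ennreal (f x - c)"
      by (cases "c \<le> f x") (auto simp: ennreal_neg)
    finally show "(\<integral>\<^sup>+ h. (if c < h \<and> h < f x then 1 else 0) \<partial>lborel) = ennreal (f x - c)" .
  qed
  finally show ?thesis .
qed

lemma nn_integral_dist_fun_eq:
  assumes "0 < c"
  shows "(\<integral>\<^sup>+ h. ennreal (dist_fun f h) * indicator {c<..} h \<partial>lborel) = ennreal (1 - trunc_mass f c)"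
proof -
  have "(\<integral>\<^sup>+ x. ennreal (f x - c) \<partial>lborel) = (\<integral>\<^sup>+ x. ennreal (f x - min (f x) c) \<partial>lborel)"
    by (intro nn_integral_cong) (auto simp: min_def ennreal_neg)
  also have "\<dots> = ennreal (LINT x|lborel. f x - min (f x) c)"
    using f_int integrable_trunc[of c] assms by (intro nn_integral_eq_integral) auto
  also have "(LINT x|lborel. f x - min (f x) c) = 1 - trunc_mass f c"
    using f_int integrable_trunc[of c] assms mass by (simp add: trunc_mass_def)
  finally show ?thesis using nn_integral_dist_fun[of c] assms by simp
qed

text \<open>Formally the mass m = trunc_mass f h has dm = dist_fun f h dh. The proof compares tails:
  by the layer-cake formula the part above height \<open>inv_trunc a\<close> has mass 1 - a. The
  value 0 for nonpositive \<open>h\<close> makes the map monotone on the whole line.\<close>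

lemma distr_trunc_mass:
  "distr (density lborel (\<lambda>h. ennreal (dist_fun f h) * indicator {0<..} h)) borel (\<lambda>h. if 0 < h then trunc_mass f h else 0)
    = distr unit_lborel borel (\<lambda>m. m)"
proof -
  let ?F = "\<lambda>h. if 0 < h then trunc_mass f h else 0"
  let ?N = "density lborel (\<lambda>h. ennreal (dist_fun f h) * indicator {0<..} h)"
  have "mono ?F" using trunc_mass_mono trunc_mass_bounds by (auto intro!: monoI)
  then have [measurable]: "?F \<in> borel_measurable borel" by (rule borel_measurable_mono)
  have N: "emeasure (distr ?N borel ?F) {a<..} = ennreal (1 - max 0 (min 1 a))" for a
  proof -
    have [measurable]: "?F -` {a<..} \<in> sets borel" using measurable_sets[of ?F borel borel "{a<..}"] by simp
    have e: "emeasure (distr ?N borel ?F) {a<..} = (\<integral>\<^sup>+ h. ennreal (dist_fun f h) * indicator {0<..} h * indicator (?F -` {a<..}) h \<partial>lborel)"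
      by (simp add: emeasure_distr emeasure_density)
    consider "a \<le> 0" | "1 \<le> a" | "a \<in> {0<..<1}" by fastforce
    then show ?thesis
    proof cases
      case 1
      have "(\<integral>\<^sup>+ h. ennreal (dist_fun f h) * indicator {0<..} h * indicator (?F -` {a<..}) h \<partial>lborel)
          = (\<integral>\<^sup>+ h. ennreal (dist_fun f h) * indicator {0<..} h \<partial>lborel)"
      proof (rule nn_integral_cong)
        fix h :: real
        show "ennreal (dist_fun f h) * indicator {0<..} h * indicator (?F -` {a<..}) h = ennreal (dist_fun f h) * indicator {0<..} h"
          using inv_trunc_trunc_mass(1)[of h] 1 dist_fun_nonneg[of h]
          by (cases "0 < h"; cases "dist_fun f h = 0") (auto simp: indicator_def)
      qed
      also have "\<dots> = 1" using nn_integral_dist_fun[of 0] nn_integral_eq_integral[OF f_int] nonneg mass by simp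
      finally show ?thesis using e 1 by simp
    next
      case 2
      have "(\<integral>\<^sup>+ h. ennreal (dist_fun f h) * indicator {0<..} h * indicator (?F -` {a<..}) h \<partial>lborel) = (\<integral>\<^sup>+ h. 0 \<partial>(lborel :: real measure))"
      proof (rule nn_integral_cong)
        fix h :: real
        have "\<not> a < ?F h" using trunc_mass_bounds(2)[of h] 2 by auto
        then show "ennreal (dist_fun f h) * indicator {0<..} h * indicator (?F -` {a<..}) h = 0" by (simp add: indicator_def)
      qed
      then show ?thesis using e 2 by simp
    next
      case 3
      note i = inv_trunc[OF 3]
      have "(\<integral>\<^sup>+ h. ennreal (dist_fun f h) * indicator {0<..} h * indicator (?F -` {a<..}) h \<partial>lborel)
          = (\<integral>\<^sup>+ h. ennreal (dist_fun f h) * indicator {inv_trunc a<..} h \<partial>lborel)"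
      proof (rule nn_integral_cong)
        fix h :: real
        show "ennreal (dist_fun f h) * indicator {0<..} h * indicator (?F -` {a<..}) h = ennreal (dist_fun f h) * indicator {inv_trunc a<..} h"
        proof (cases "0 < h \<and> 0 < dist_fun f h")
          case True
          have "a < trunc_mass f h \<longleftrightarrow> inv_trunc a < h"
          proof
            assume "a < trunc_mass f h"
            then show "inv_trunc a < h"
              using trunc_mass_mono[of h "inv_trunc a"] True i by (intro not_le_imp_less notI) simp
          next
            assume l: "inv_trunc a < h"
            then have "a \<le> trunc_mass f h" using trunc_mass_mono[of "inv_trunc a" h] i by simp
            moreover have "a \<noteq> trunc_mass f h"
              using inv_trunc_trunc_mass(2)[of h] True l by auto
            ultimately show "a < trunc_mass f h" by simp
          qed
          then show ?thesis using True i by (simp add: indicator_def)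
        next
          case False
          then show ?thesis using i dist_fun_nonneg[of h] by (auto simp: indicator_def)
        qed
      qed
      also have "\<dots> = ennreal (1 - a)" using nn_integral_dist_fun_eq[OF i(1)] i by simp
      finally show ?thesis using e 3 by simp
    qed
  qed
  have U: "emeasure (distr unit_lborel borel (\<lambda>m. m)) {a<..} = ennreal (1 - max 0 (min 1 a))" for a
  proof -
    have "emeasure (distr unit_lborel borel (\<lambda>m. m)) {a<..} = emeasure lborel ({a<..} \<inter> {0<..<1})"
      by (subst emeasure_distr) (auto simp: space_unit_lborel emeasure_restrict_space measurable_restrict_space1)
    also have "{a<..} \<inter> {0<..<1} = {max 0 a<..<1::real}" by auto
    also have "emeasure lborel {max 0 a<..<1::real} = ennreal (1 - max 0 (min 1 a))"
      by (cases "a \<le> 1") auto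
    finally show ?thesis .
  qed
  show ?thesis by (rule measure_eqI_lessThan) (auto simp: N U)
qed

text \<open>Substitute m = trunc_mass f h: the Jacobian is \<open>dist_fun f h\<close> and the slope
  at \<open>m\<close> is its reciprocal. Heights where \<open>dist_fun f h\<close> vanishes
  contribute nothing, so the default value of the quotient there is harmless.\<close>

lemma nn_integral_inv_trunc:
  assumes [measurable]: "k \<in> borel_measurable borel"
  shows "(\<integral>\<^sup>+ m. k (slope_fun m) \<partial>unit_lborel)
    = (\<integral>\<^sup>+ h. ennreal (dist_fun f h) * indicator {0<..} h * k (1 / dist_fun f h) \<partial>lborel)"
proof -
  let ?F = "\<lambda>h. if 0 < h then trunc_mass f h else 0"
  let ?N = "density lborel (\<lambda>h. ennreal (dist_fun f h) * indicator {0<..} h)"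
  have "mono ?F" using trunc_mass_mono trunc_mass_bounds by (auto intro!: monoI)
  then have [measurable]: "?F \<in> borel_measurable borel" by (rule borel_measurable_mono)
  have [measurable]: "slope_fun \<in> borel_measurable unit_lborel"
    by (rule mono_on_unit_measurable[OF slope_fun_mono])
  let ?k = "\<lambda>m. k (slope_fun m) * indicator {0<..<1} m"
  have km: "?k \<in> borel_measurable borel"
  proof -
    have "(\<lambda>m. k (slope_fun m)) \<in> borel_measurable unit_lborel" by measurable
    then show ?thesis by (subst (asm) borel_measurable_restrict_space_iff_ennreal) auto
  qed
  have "(\<integral>\<^sup>+ m. k (slope_fun m) \<partial>unit_lborel) = (\<integral>\<^sup>+ m. ?k m \<partial>unit_lborel)"
    by (intro nn_integral_cong) (simp add: space_unit_lborel)
  also have "\<dots> = (\<integral>\<^sup>+ m. ?k m \<partial>distr unit_lborel borel (\<lambda>m. m))"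
    using km by (subst nn_integral_distr) (auto simp: measurable_restrict_space1)
  also have "\<dots> = (\<integral>\<^sup>+ m. ?k m \<partial>distr ?N borel ?F)" by (simp only: distr_trunc_mass)
  also have "\<dots> = (\<integral>\<^sup>+ h. ?k (?F h) \<partial>?N)" using km by (subst nn_integral_distr) auto
  also have "\<dots> = (\<integral>\<^sup>+ h. ennreal (dist_fun f h) * indicator {0<..} h * ?k (?F h) \<partial>lborel)"
    using measurable_compose[OF _ km, of ?F borel] by (subst nn_integral_density) auto
  also have "\<dots> = (\<integral>\<^sup>+ h. ennreal (dist_fun f h) * indicator {0<..} h * k (1 / dist_fun f h) \<partial>lborel)"
  proof (rule nn_integral_cong)
    fix h :: real
    show "ennreal (dist_fun f h) * indicator {0<..} h * ?k (?F h) = ennreal (dist_fun f h) * indicator {0<..} h * k (1 / dist_fun f h)"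
      using inv_trunc_trunc_mass[of h] dist_fun_nonneg[of h]
      by (cases "0 < h"; cases "dist_fun f h = 0") (auto simp: slope_fun_def order.order_iff_strict)
  qed
  finally show ?thesis .
qed

end

text \<open>At a continuity point of \<open>u\<close> the difference quotients of \<open>H\<close>
  are squeezed between values of \<open>u\<close>, and a monotone \<open>u\<close> has only
  countably many other points.\<close>

lemma deriv_eq_slope:
  fixes H u :: "real \<Rightarrow> real"
  assumes mono: "mono_on {0<..<1} u"
    and lower: "\<And>m m'. m \<in> {0<..<1} \<Longrightarrow> m' \<in> {0<..<1} \<Longrightarrow> m \<le> m' \<Longrightarrow> u m * (m' - m) \<le> H m' - H m"
    and upper: "\<And>m m'. m \<in> {0<..<1} \<Longrightarrow> m' \<in> {0<..<1} \<Longrightarrow> m \<le> m' \<Longrightarrow> H m' - H m \<le> u m' * (m' - m)"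
  shows "countable {m \<in> {0<..<1}. deriv H m \<noteq> u m}"
proof (rule countable_subset)
  show "countable {m \<in> {0<..<1}. \<not> isCont u m}"
    using mono by (intro mono_on_ctble_discont_open) auto
  show "{m \<in> {0<..<1}. deriv H m \<noteq> u m} \<subseteq> {m \<in> {0<..<1}. \<not> isCont u m}"
  proof safe
    fix m :: real assume m: "m \<in> {0<..<1}" and c: "isCont u m" and "deriv H m \<noteq> u m"
    have cl: "((\<lambda>h. u (m + h)) \<longlongrightarrow> u m) (at 0)" using c by (simp add: isCont_iff)
    have ev: "\<forall>\<^sub>F h in at 0. h \<noteq> 0 \<and> m + h \<in> {0<..<1}"
    proof -
      have "\<forall>\<^sub>F h in nhds 0. m + h \<in> {0<..<1}"
        by (rule topological_tendstoD[of "\<lambda>h. m + h" m]) (use m in \<open>auto intro!: tendsto_eq_intros filterlim_ident\<close>)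
      then show ?thesis by (auto simp: eventually_at_filter elim!: eventually_mono)
    qed
    have "((\<lambda>h. (H (m + h) - H m) / h) \<longlongrightarrow> u m) (at 0)"
    proof (rule tendsto_sandwich)
      show "((\<lambda>h. min (u m) (u (m + h))) \<longlongrightarrow> u m) (at 0)"
        using tendsto_min[OF tendsto_const[of "u m"] cl] by simp
      show "((\<lambda>h. max (u m) (u (m + h))) \<longlongrightarrow> u m) (at 0)"
        using tendsto_max[OF tendsto_const[of "u m"] cl] by simp
      show "\<forall>\<^sub>F h in at 0. min (u m) (u (m + h)) \<le> (H (m + h) - H m) / h"
        using ev
      proof eventually_elim
        case (elim h)
        then show ?case
          using lower[of m "m + h"] lower[of "m + h" m] m
          by (cases "h > 0") (auto simp: field_simps min_le_iff_disj)
      qed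
      show "\<forall>\<^sub>F h in at 0. (H (m + h) - H m) / h \<le> max (u m) (u (m + h))"
        using ev
      proof eventually_elim
        case (elim h)
        then show ?case
          using upper[of m "m + h"] upper[of "m + h" m] m
          by (cases "h > 0") (auto simp: field_simps le_max_iff_disj)
      qed
    qed
    then have "(H has_real_derivative u m) (at m)" by (simp add: DERIV_def)
    then have "deriv H m = u m" by (rule DERIV_imp_deriv)
    then show False using \<open>deriv H m \<noteq> u m\<close> by simp
  qed
qed

section \<open>The law of the slope of a Sobolev height function\<close>

lemma distr_inv_vol:
  "distr (density lborel (\<lambda>x :: real ^ 'n. indicator {0<..} (inv_vol x))) borel inv_vol
    = density lborel (\<lambda>y. ennreal (1 / y\<^sup>2) * indicator {0<..} y)" (is "?M = ?N")
proof (rule measure_eqI)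
  fix A assume "A \<in> sets ?M"
  then have [measurable]: "A \<in> sets borel" by simp
  have "emeasure ?M A = (\<integral>\<^sup>+ y. indicator A y \<partial>?M)" by (rule nn_integral_indicator[symmetric]) simp
  also have "\<dots> = (\<integral>\<^sup>+ x. indicator A (inv_vol (x :: real ^ 'n)) * indicator {0<..} (inv_vol x) \<partial>lborel)"
    by (subst nn_integral_distr; simp add: nn_integral_density mult.commute)
  also have "\<dots> = (\<integral>\<^sup>+ y. indicator A y * (ennreal (1 / y\<^sup>2) * indicator {0<..} y) \<partial>lborel)"
    by (rule nn_integral_inv_vol) simp
  also have "\<dots> = emeasure ?N A" by (simp add: emeasure_density mult.commute)
  finally show "emeasure ?M A = emeasure ?N A" .
qed simp

lemma integral_inv_vol:
  fixes k :: "real \<Rightarrow> real"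
  assumes [measurable]: "k \<in> borel_measurable borel" and k: "\<And>y. y \<le> 0 \<Longrightarrow> k y = 0"
  shows "(LINT x :: real ^ 'n|lborel. k (inv_vol x)) = (LINT y|lborel. k y / y\<^sup>2)"
proof -
  have "(LINT x :: real ^ 'n|lborel. k (inv_vol x)) = (LINT x :: real ^ 'n|lborel. indicator {0<..} (inv_vol x) * k (inv_vol x))"
    using k by (intro Bochner_Integration.integral_cong) (auto simp: indicator_def)
  also have "\<dots> = (LINT x :: real ^ 'n|density lborel (\<lambda>x. ennreal (indicator {0<..} (inv_vol x))). k (inv_vol x))"
    by (subst integral_density) auto
  also have "\<dots> = (LINT x :: real ^ 'n|density lborel (\<lambda>x. indicator {0<..} (inv_vol x)). k (inv_vol x))"
    by (simp add: ennreal_indicator)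
  also have "\<dots> = (LINT y|distr (density lborel (\<lambda>x :: real ^ 'n. indicator {0<..} (inv_vol x))) borel inv_vol. k y)"
    by (subst integral_distr) auto
  also have "\<dots> = (LINT y|density lborel (\<lambda>y. ennreal (1 / y\<^sup>2) * indicator {0<..} y). k y)"
    by (simp only: distr_inv_vol)
  also have "\<dots> = (LINT y|density lborel (\<lambda>y. ennreal (1 / y\<^sup>2 * indicator {0<..} y)). k y)"
  proof -
    have "(\<lambda>y::real. ennreal (1 / y\<^sup>2) * indicator {0<..} y) = (\<lambda>y. ennreal (1 / y\<^sup>2 * indicator {0<..} y))"
      by (auto simp: fun_eq_iff indicator_def)
    then show ?thesis by (simp only:)
  qed
  also have "\<dots> = (LINT y|lborel. k y / y\<^sup>2)"
    using k by (subst integral_density) (auto intro!: Bochner_Integration.integral_cong simp: indicator_def)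
  finally show ?thesis .
qed

text \<open>The squared radius of the centred ball of volume 1/y, that is, |x|^2 as a function of
  \<open>inv_vol x\<close>. The square matches the argument of the bumps in the radial test
  fields.\<close>

definition sq_radius :: "'n::finite itself \<Rightarrow> real \<Rightarrow> real" where
  "sq_radius _ y = (uvol TYPE('n) * y) powr (- 2 / real CARD('n))"

lemma sq_radius_inv_vol:
  fixes x :: "real ^ 'n"
  assumes "x \<noteq> 0"
  shows "sq_radius TYPE('n) (inv_vol x) = (norm x)\<^sup>2"
proof -
  have "sq_radius TYPE('n) (inv_vol x) = ((uvol TYPE('n) * inv_vol x) powr (1 / real CARD('n))) powr (- 2)"
    by (simp add: sq_radius_def powr_powr)
  also have "\<dots> = (1 / norm x) powr (- 2)" by (simp only: inverse_norm_eq[OF assms])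
  also have "\<dots> = (norm x)\<^sup>2" using assms by (simp add: powr_minus_divide power_divide)
  finally show ?thesis .
qed

lemma sq_radius_strict_antimono: "0 < y \<Longrightarrow> y < z \<Longrightarrow> sq_radius TYPE('n::finite) z < sq_radius TYPE('n) y"
  unfolding sq_radius_def using uvol_pos[where 'n='n] by (intro powr_less_mono2_neg mult_strict_left_mono) auto

lemma sq_radius_pos: "0 < y \<Longrightarrow> 0 < sq_radius TYPE('n::finite) y"
  unfolding sq_radius_def using uvol_pos[where 'n='n] by simp

lemma sq_radius_less_iff: "0 < y \<Longrightarrow> 0 < z \<Longrightarrow> sq_radius TYPE('n::finite) z < sq_radius TYPE('n) y \<longleftrightarrow> y < z"
  using sq_radius_strict_antimono[of y z, where 'n='n] sq_radius_strict_antimono[of z y, where 'n='n]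
  by (metis less_asym linorder_neqE)

lemma sq_radius_has_derivative:
  assumes "0 < y"
  shows "(sq_radius TYPE('n::finite) has_real_derivative - 2 / real CARD('n) * sq_radius TYPE('n) y / y) (at y)"
proof -
  note c = uvol_pos[where 'n='n]
  have "((\<lambda>y. (uvol TYPE('n) * y) powr (- 2 / real CARD('n))) has_real_derivative
      (- 2 / real CARD('n)) * (uvol TYPE('n) * y) powr (- 2 / real CARD('n) - 1) * uvol TYPE('n)) (at y)"
    using c assms by (auto intro!: derivative_eq_intros)
  moreover have "(uvol TYPE('n) * y) powr (- 2 / real CARD('n) - 1) = (uvol TYPE('n) * y) powr (- 2 / real CARD('n)) / (uvol TYPE('n) * y)"
    using c assms by (simp add: powr_diff)
  ultimately show ?thesis using c by (simp add: sq_radius_def[abs_def] mult_ac)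
qed

lemma test_function_derivative:
  fixes \<phi> :: "real ^ 'n \<Rightarrow> real"
  assumes "test_function \<phi>"
  shows "\<exists>B. \<forall>x. \<bar>frechet_derivative \<phi> (at x) (axis i 1)\<bar> \<le> B"
    and "(\<lambda>x. frechet_derivative \<phi> (at x) (axis i 1)) \<in> borel_measurable borel"
  using test_function_bounds[OF assms, of i] by metis+

lemma radial_test_divergence:
  fixes x :: "real ^ 'n"
  assumes b': "\<And>q. (bump k a b has_real_derivative b' q) (at q)"
  shows "(\<Sum>i\<in>UNIV. frechet_derivative (\<lambda>x :: real ^ 'n. x $ i * bump k a b ((norm x)\<^sup>2)) (at x) (axis i 1))
    = real CARD('n) * bump k a b ((norm x)\<^sup>2) + 2 * (norm x)\<^sup>2 * b' ((norm x)\<^sup>2)"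
proof -
  have fd: "frechet_derivative (\<lambda>x :: real ^ 'n. x $ i * bump k a b ((norm x)\<^sup>2)) (at x) (axis i 1)
      = bump k a b ((norm x)\<^sup>2) + 2 * (x $ i)\<^sup>2 * b' ((norm x)\<^sup>2)" for i
  proof -
    have n: "((\<lambda>x :: real ^ 'n. (norm x)\<^sup>2) has_derivative (\<lambda>h. 2 * inner x h)) (at x)"
      unfolding power2_norm_eq_inner
      by (auto intro!: derivative_eq_intros simp: inner_commute)
    have "((\<lambda>x :: real ^ 'n. bump k a b ((norm x)\<^sup>2)) has_derivative (\<lambda>h. b' ((norm x)\<^sup>2) * (2 * inner x h))) (at x)"
      using has_derivative_compose[OF n b'[unfolded has_field_derivative_def]] .
    moreover have "((\<lambda>x :: real ^ 'n. x $ i) has_derivative (\<lambda>h. h $ i)) (at x)"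
      by (rule bounded_linear_imp_has_derivative[OF bounded_linear_vec_nth])
    ultimately have "((\<lambda>x :: real ^ 'n. x $ i * bump k a b ((norm x)\<^sup>2)) has_derivative
        (\<lambda>h. x $ i * (b' ((norm x)\<^sup>2) * (2 * inner x h)) + h $ i * bump k a b ((norm x)\<^sup>2))) (at x)"
      by (rule has_derivative_mult[rotated])
    from frechet_derivative_at[OF this, symmetric] show ?thesis
      by (simp add: inner_axis power2_eq_square mult_ac)
  qed
  have "(\<Sum>i\<in>UNIV. (x $ i)\<^sup>2) = (norm x)\<^sup>2"
    unfolding power2_norm_eq_inner inner_vec_def by (simp add: power2_eq_square)
  then show ?thesis
    by (simp add: fd sum.distrib sum_distrib_left[symmetric] sum_distrib_right[symmetric])
qed

text \<open>This is the divergence theorem on the ball of volume 1/y: on the bounding sphere of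
  radius R the normal component of the field is R b(R^2), and R times the surface area is n times
  the volume. In the variable z = inv_vol x, with q the squared radius, it becomes the fundamental
  theorem of calculus for -n b(q(z)) / z.\<close>

lemma integral_radial_test_divergence:
  assumes b': "\<And>q. (bump k a b has_real_derivative b' q) (at q)" "continuous_on UNIV b'"
    and a: "0 < a" and y: "0 < y"
  shows "(LINT x :: real ^ 'n|lborel. (if y < inv_vol x then
      real CARD('n) * bump k a b ((norm x)\<^sup>2) + 2 * (norm x)\<^sup>2 * b' ((norm x)\<^sup>2) else 0))
    = real CARD('n) / y * bump k a b (sq_radius TYPE('n) y)"
proof -
  let ?n = "real CARD('n)" and ?q = "sq_radius TYPE('n)" and ?b = "bump k a b"
  note c = uvol_pos[where 'n='n]
  let ?D = "\<lambda>q. ?n * ?b q + 2 * q * b' q"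
  have b'_0: "b' q = 0" if "q < a" for q
  proof -
    have "((\<lambda>q. 0) has_real_derivative 0) (at q)" by simp
    then have "(?b has_real_derivative 0) (at q)"
      by (rule has_field_derivative_transform_within_open[where S="{..<a}"]) (use that in \<open>auto simp: bump_eq_0\<close>)
    then show ?thesis using b'(1) DERIV_unique by blast
  qed
  \<comment> \<open>Beyond \<open>Z\<close> the squared radius is below \<open>a\<close>, where the
    bump vanishes; so the half-line is cut to [y, Z] and the boundary term at \<open>Z\<close> is
    zero. The witness comes from the point \<open>w\<close> whose squared radius is a/2.\<close>
  obtain Z where Z: "y < Z" "?q Z < a"
  proof
    define w where "w = (a / 2) powr (- ?n / 2) / uvol TYPE('n)"
    have w: "w > 0" using a c by (simp add: w_def)
    have "?q w = ((a / 2) powr (- ?n / 2)) powr (- 2 / ?n)" using c by (simp add: sq_radius_def w_def)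
    also have "\<dots> = a / 2" using a by (simp add: powr_powr)
    finally have qw: "?q w = a / 2" .
    show "y < y + w" using w by simp
    have "?q (y + w) < ?q w" using w y by (intro sq_radius_strict_antimono) auto
    then show "?q (y + w) < a" using qw a by simp
  qed
  have DZ: "?D (?q z) = 0" if "Z < z" for z
  proof -
    have "?q z < a" using sq_radius_strict_antimono[of Z z, where 'n='n] that Z y by simp
    then show ?thesis by (simp add: b'_0 bump_eq_0)
  qed
  have bcont: "isCont ?b q" for q by (rule DERIV_isCont[OF b'(1)])
  have b'cont: "isCont b' q" for q using b'(2) by (simp add: continuous_on_eq_continuous_at)
  have qcont: "isCont ?q z" if "0 < z" for z by (rule DERIV_isCont[OF sq_radius_has_derivative[OF that]])
  have Dm: "(\<lambda>z. if y < z then ?D (?q z) else 0) \<in> borel_measurable borel"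
  proof -
    have [measurable]: "?b \<in> borel_measurable borel" "b' \<in> borel_measurable borel"
      using bcont b'(2) by (auto intro!: borel_measurable_continuous_onI continuous_at_imp_continuous_on)
    have [measurable]: "?q \<in> borel_measurable borel" unfolding sq_radius_def[abs_def] by measurable
    show ?thesis by measurable
  qed
  have "(LINT x :: real ^ 'n|lborel. (if y < inv_vol x then ?n * ?b ((norm x)\<^sup>2) + 2 * (norm x)\<^sup>2 * b' ((norm x)\<^sup>2) else 0))
      = (LINT x :: real ^ 'n|lborel. (\<lambda>z. if y < z then ?D (?q z) else 0) (inv_vol x))"
  proof (rule Bochner_Integration.integral_cong[OF refl])
    fix x :: "real ^ 'n"
    show "(if y < inv_vol x then ?n * ?b ((norm x)\<^sup>2) + 2 * (norm x)\<^sup>2 * b' ((norm x)\<^sup>2) else 0)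
       = (if y < inv_vol x then ?D (?q (inv_vol x)) else 0)"
      using y by (cases "x = 0") (simp_all add: sq_radius_inv_vol)
  qed
  also have "\<dots> = (LINT z|lborel. (if y < z then ?D (?q z) else 0) / z\<^sup>2)"
    by (rule integral_inv_vol[OF Dm]) (use y in auto)
  also have "\<dots> = (LINT z|lborel. (?D (?q z) / z\<^sup>2) * indicator {y..Z} z)"
  proof (rule integral_cong_AE)
    have [measurable]: "(\<lambda>z. if y < z then ?D (?q z) else 0) \<in> borel_measurable borel" by (rule Dm)
    show "(\<lambda>z. (if y < z then ?D (?q z) else 0) / z\<^sup>2) \<in> borel_measurable lborel" by simp
    have "continuous_on {y..Z} (\<lambda>z. ?D (?q z) / z\<^sup>2)"
      using y by (intro continuous_at_imp_continuous_on ballI continuous_intros isCont_o2[OF qcont bcont] isCont_o2[OF qcont b'cont] qcont) auto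
    then have "set_integrable lborel {y..Z} (\<lambda>z. ?D (?q z) / z\<^sup>2)" by (rule borel_integrable_atLeastAtMost')
    then show "(\<lambda>z. (?D (?q z) / z\<^sup>2) * indicator {y..Z} z) \<in> borel_measurable lborel"
      unfolding set_integrable_def by (auto simp: mult.commute dest: borel_measurable_integrable)
    show "AE z in lborel. (if y < z then ?D (?q z) else 0) / z\<^sup>2 = (?D (?q z) / z\<^sup>2) * indicator {y..Z} z"
      using AE_lborel_singleton[of y]
    proof eventually_elim
      case (elim z)
      then show ?case using DZ[of z] Z by (auto simp: indicator_def not_le)
    qed
  qed
  also have "\<dots> = (- ?n * ?b (?q Z) / Z) - (- ?n * ?b (?q y) / y)"
  proof (rule integral_FTC_Icc_real)
    fix z assume z: "y \<le> z" "z \<le> Z"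
    then have z0: "0 < z" using y by simp
    have "((\<lambda>z. - ?n * ?b (?q z) / z) has_real_derivative
        ((- ?n * (b' (?q z) * (- 2 / ?n * ?q z / z))) * z - (- ?n * ?b (?q z)) * 1) / (z * z)) (at z)"
      by (intro DERIV_divide DERIV_cmult DERIV_chain2[OF b'(1)] sq_radius_has_derivative DERIV_ident) (use z0 in auto)
    moreover have "((- ?n * (b' (?q z) * (- 2 / ?n * ?q z / z))) * z - (- ?n * ?b (?q z)) * 1) / (z * z) = ?D (?q z) / z\<^sup>2"
      using z0 by (simp add: field_simps power2_eq_square)
    ultimately show "((\<lambda>z. - ?n * ?b (?q z) / z) has_real_derivative ?D (?q z) / z\<^sup>2) (at z)" by simp
    show "isCont (\<lambda>z. ?D (?q z) / z\<^sup>2) z"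
      using z0 by (intro continuous_intros isCont_o2[OF qcont bcont] isCont_o2[OF qcont b'cont] qcont) auto
  qed (use Z in simp)
  also have "\<dots> = ?n / y * ?b (?q y)" using Z by (simp add: bump_eq_0)
  finally show ?thesis .
qed

text \<open>The profile decreases, so the radii in \<open>S\<close> form an interval starting at 0,
  and the superlevel set is the ball of radius Sup S up to the bounding sphere and the origin. Its
  volume \<open>dist_fun f h\<close> then identifies the radius.\<close>

lemma superlevel_set_radial:
  fixes f :: "real ^ 'n \<Rightarrow> real"
  assumes [measurable]: "f \<in> borel_measurable borel" and nonneg: "\<And>x. 0 \<le> f x"
    and int: "integrable lborel f" and mass: "(LINT x|lborel. f x) = 1"
    and anti: "antimono_on {0<..} \<Phi>" and f: "AE x in lborel. f x = \<Phi> (norm x)"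
    and h: "0 < h" "0 < dist_fun f h"
  shows "AE x in lborel. h < f x \<longleftrightarrow> 1 / dist_fun f h < inv_vol x"
proof -
  note c = uvol_pos[where 'n='n]
  define S where "S = {r. 0 < r \<and> h < \<Phi> r}"
  have down: "r \<in> S" if "s \<in> S" "0 < r" "r \<le> s" for r s
    using monotone_onD[OF anti, of r s] that by (auto simp: S_def)
  have fS: "AE x in lborel. h < f x \<longleftrightarrow> norm x \<in> S"
    using f AE_lborel_singleton[of "0 :: real ^ 'n"] by eventually_elim (auto simp: S_def)
  have em: "emeasure lborel {x. h < f x} = ennreal (dist_fun f h)"
    using assms(1-4) h(1) by (rule emeasure_superlevel)
  have "S \<noteq> {}"
  proof
    assume "S = {}"
    then have "AE x in lborel. \<not> h < f x" using fS by simp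
    then have "emeasure lborel {x. h < f x} = 0"
      by (subst (asm) AE_iff_measurable[where N="{x. h < f x}"]) auto
    then show False using em h by (simp add: ennreal_eq_0_iff)
  qed
  moreover have bdd: "bdd_above S"
  proof (rule ccontr)
    assume nb: "\<not> bdd_above S"
    have all: "r \<in> S" if "0 < r" for r
    proof -
      obtain s where "s \<in> S" "r < s" using nb by (auto simp: bdd_above_def not_le)
      then show ?thesis using down[of s r] that by simp
    qed
    have "AE x in lborel. h < f x"
      using fS AE_lborel_singleton[of "0 :: real ^ 'n"] by eventually_elim (auto simp: all)
    then have "emeasure lborel {x. h < f x} = emeasure lborel (UNIV :: (real ^ 'n) set)"
      by (intro emeasure_eq_AE) auto
    then show False using em by simp
  qed
  moreover define R where "R = Sup S"
  ultimately have R: "\<And>r. r \<in> S \<Longrightarrow> r \<le> R" "\<And>r. 0 < r \<Longrightarrow> r < R \<Longrightarrow> r \<in> S" "0 < R"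
  proof -
    show le: "r \<le> R" if "r \<in> S" for r unfolding R_def using that bdd by (rule cSup_upper)
    show "r \<in> S" if r: "0 < r" "r < R" for r
    proof -
      obtain s where "s \<in> S" "r < s" using r(2) \<open>S \<noteq> {}\<close> bdd unfolding R_def by (meson less_cSup_iff)
      then show ?thesis using down[of s r] r by simp
    qed
    obtain s where "s \<in> S" using \<open>S \<noteq> {}\<close> by blast
    then show "0 < R" using le[of s] by (auto simp: S_def)
  qed
  have "sphere (0 :: real ^ 'n) R \<in> null_sets lborel"
    using negligible_sphere[of "0 :: real ^ 'n" R] by (simp add: negligible_iff_null_sets null_sets_completion_iff)
  then have sph: "AE x :: real ^ 'n in lborel. norm x \<noteq> R"
    by (auto dest!: AE_not_in)
  have fR: "AE x in lborel. h < f x \<longleftrightarrow> norm x < R"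
    using fS AE_lborel_singleton[of "0 :: real ^ 'n"] sph
    by eventually_elim (use R(1,2) in \<open>force simp: order.order_iff_strict\<close>)
  have "dist_fun f h = measure lborel (ball (0 :: real ^ 'n) R)"
    unfolding dist_fun_def using fR by (intro measure_eq_AE) (auto elim!: eventually_mono)
  also have "\<dots> = uvol TYPE('n) * R ^ CARD('n)"
    using content_ball_conv_unit_ball[of R "0 :: real ^ 'n"] R(3) by simp
  finally have d: "dist_fun f h = uvol TYPE('n) * R ^ CARD('n)" .
  show ?thesis
    using fR AE_lborel_singleton[of "0 :: real ^ 'n"]
  proof eventually_elim
    case (elim x)
    have "1 / dist_fun f h < inv_vol x \<longleftrightarrow> norm x ^ CARD('n) < R ^ CARD('n)"
      using elim(2) c R(3) by (simp add: d inv_vol_def field_simps)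
    also have "\<dots> \<longleftrightarrow> norm x < R"
      using power_strict_mono[of "norm x" R "CARD('n)"] power_less_imp_less_base[of "norm x" "CARD('n)" R] R(3) by auto
    finally show ?case using elim(1) by simp
  qed
qed

text \<open>Testing the weak gradient against the fields \<open>x b(|x|\<^sup>2)\<close> with \<open>b\<close> a bump, the layer-cake formula for
  \<open>f\<close> produces \<open>\<integral> b (slope_fun f m) dm\<close>; then \<open>b\<close> tends to an indicator.\<close>

lemma slope_fun_law_eq:
  fixes f :: "real ^ 'n \<Rightarrow> real" and g :: "real ^ 'n \<Rightarrow> real ^ 'n"
  assumes fm [measurable]: "f \<in> borel_measurable borel" and nonneg: "\<And>x. 0 \<le> f x"
    and int: "integrable lborel f" and mass: "(LINT x|lborel. f x) = 1"
    and anti: "antimono_on {0<..} \<Phi>" and f: "AE x in lborel. f x = \<Phi> (norm x)"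
    and [measurable]: "g \<in> borel_measurable borel"
    and g: "\<And>R. integrable lborel (\<lambda>x. indicator (cball 0 R) x * norm (g x))"
    and wg: "\<And>\<phi> i. test_function \<phi> \<Longrightarrow> (LINT x|lborel. f x * frechet_derivative \<phi> (at x) (axis i 1))
        = - (LINT x|lborel. g x $ i * \<phi> x)"
    and y: "0 < y1" "y1 < y2"
  shows "(LINT m|unit_lborel. indicator {y1<..<y2} (slope_fun f m))
    = (LINT x|lborel. indicator {y1<..<y2} (inv_vol x) * - (inner (g x) x / real CARD('n)))"
proof -
  let ?n = "real CARD('n)" and ?q = "sq_radius TYPE('n)"
  \<comment> \<open>The squared radius decreases as the inverse volume grows, hence the end points
    swap.\<close>
  define a where "a = ?q y2"
  define b where "b = ?q y1"
  have ab: "0 < a" "a < b"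
    using sq_radius_pos[of y2, where 'n='n] sq_radius_strict_antimono[OF y, where 'n='n] y by (auto simp: a_def b_def)
  have q_mem: "?q z \<in> {a<..<b} \<longleftrightarrow> z \<in> {y1<..<y2}" if "0 < z" for z
    using that y by (auto simp: a_def b_def sq_radius_less_iff)
  let ?b = "\<lambda>k x. bump k a b ((norm (x :: real ^ 'n))\<^sup>2)"
  let ?\<mu> = "dist_fun f"
  have [measurable]: "?\<mu> \<in> borel_measurable borel" by (rule dist_fun_measurable[OF fm nonneg int mass])
  \<comment> \<open>The integral of the divergence of the test field over the set where f > h, which
    up to a null set is the ball of volume \<open>dist_fun f h\<close>.\<close>
  let ?J = "\<lambda>k h. if 0 < h \<and> 0 < ?\<mu> h then ?n * ?\<mu> h * bump k a b (?q (1 / ?\<mu> h)) else 0"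
  have small: "norm x \<le> sqrt b" if "?b k x \<noteq> 0" for k x
    using bump_eq_0[of "(norm x)\<^sup>2" a b k] that by (intro real_le_rsqrt) force
  have bm [measurable]: "bump k a b \<in> borel_measurable borel" for k
  proof -
    obtain b' where "\<And>q. (bump k a b has_real_derivative b' q) (at q)" using bump_C1[of k a b] by metis
    then have "continuous_on UNIV (bump k a b)"
      by (intro continuous_at_imp_continuous_on) (blast intro: DERIV_isCont)
    then show ?thesis by (rule borel_measurable_continuous_onI)
  qed
  have step: "(LINT h|lborel. ?J k h) = - (LINT x|lborel. inner (g x) x * ?b k x)" for k
  proof -
    let ?\<phi> = "\<lambda>i x :: real ^ 'n. x $ i * ?b k x"
    have \<phi>: "test_function (?\<phi> i)" for i by (rule test_function_radial)
    obtain b' where b': "\<And>q. (bump k a b has_real_derivative b' q) (at q)" "continuous_on UNIV b'"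
      using bump_C1[of k a b] by metis
    have [measurable]: "b' \<in> borel_measurable borel" by (rule borel_measurable_continuous_onI[OF b'(2)])
    let ?D = "\<lambda>x :: real ^ 'n. ?n * ?b k x + 2 * (norm x)\<^sup>2 * b' ((norm x)\<^sup>2)"
    have D: "?D x = (\<Sum>i\<in>UNIV. frechet_derivative (?\<phi> i) (at x) (axis i 1))" for x
      by (rule radial_test_divergence[OF b'(1), symmetric])
    have "\<forall>i. \<exists>B. \<forall>x. \<bar>frechet_derivative (?\<phi> i) (at x) (axis i 1)\<bar> \<le> B"
      by (rule allI, rule test_function_derivative(1)[OF \<phi>])
    from choice[OF this] obtain B where B: "\<And>i x. \<bar>frechet_derivative (?\<phi> i) (at x) (axis i 1)\<bar> \<le> B i" by blast
    have [measurable]: "(\<lambda>x. frechet_derivative (?\<phi> i) (at x) (axis i 1)) \<in> borel_measurable borel" for i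
      by (rule test_function_derivative(2)[OF \<phi>])
    have Dm [measurable]: "?D \<in> borel_measurable borel" unfolding D by measurable
    have DB: "\<bar>?D x\<bar> \<le> sum B UNIV" for x
      unfolding D by (rule order_trans[OF sum_abs sum_mono[OF B]])
    have ifd: "integrable lborel (\<lambda>x. f x * d x)" if "d \<in> borel_measurable borel" "\<And>x. \<bar>d x\<bar> \<le> C" for d C
    proof (rule Bochner_Integration.integrable_bound)
      show "integrable lborel (\<lambda>x. C * f x)" using int by simp
      have "\<bar>f x * d x\<bar> \<le> \<bar>C * f x\<bar>" for x
        using that(2)[of x] nonneg[of x] mult_left_mono[of "\<bar>d x\<bar>" "\<bar>C\<bar>" "f x"] by (simp add: abs_mult mult.commute)
      then show "AE x in lborel. norm (f x * d x) \<le> norm (C * f x)" by simp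
    qed (use that in measurable)
    have gi: "integrable lborel (\<lambda>x. g x $ i * ?\<phi> i x)" for i
    proof (rule Bochner_Integration.integrable_bound)
      show "integrable lborel (\<lambda>x. sqrt b * (indicator (cball 0 (sqrt b)) x * norm (g x)))"
        using g by (rule integrable_mult_right)
      have [measurable]: "(\<lambda>x. g x $ i) \<in> borel_measurable borel" by (simp add: cart_eq_inner_axis)
      note [measurable] = test_function_borel[OF \<phi>]
      show "(\<lambda>x. g x $ i * ?\<phi> i x) \<in> borel_measurable lborel" by measurable
      have "\<bar>g x $ i * ?\<phi> i x\<bar> \<le> sqrt b * (indicator (cball 0 (sqrt b)) x * norm (g x))" for x
      proof (cases "?b k x = 0")
        case False
        then have nx: "norm x \<le> sqrt b" by (rule small)
        have "\<bar>g x $ i\<bar> * (\<bar>x $ i\<bar> * \<bar>?b k x\<bar>) \<le> norm (g x) * (sqrt b * 1)"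
          using nx ab component_le_norm_cart[of x i] component_le_norm_cart[of "g x" i] bump_bounds[of k a b "(norm x)\<^sup>2"]
          by (intro mult_mono) auto
        then show ?thesis using nx by (simp add: abs_mult mult.commute)
      qed (use ab in simp)
      then show "AE x in lborel. norm (g x $ i * ?\<phi> i x) \<le> norm (sqrt b * (indicator (cball 0 (sqrt b)) x * norm (g x)))"
        by (intro AE_I2) (metis abs_ge_self order_trans real_norm_def)
    qed
    have "(LINT x|lborel. f x * ?D x) = (\<Sum>i\<in>UNIV. LINT x|lborel. f x * frechet_derivative (?\<phi> i) (at x) (axis i 1))"
      unfolding D sum_distrib_left using ifd[OF _ B] by (intro Bochner_Integration.integral_sum) simp
    also have "\<dots> = - (\<Sum>i\<in>UNIV. LINT x|lborel. g x $ i * ?\<phi> i x)"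
      using wg[OF \<phi>] by (simp add: sum_negf)
    also have "(\<Sum>i\<in>UNIV. LINT x|lborel. g x $ i * ?\<phi> i x) = (LINT x|lborel. (\<Sum>i\<in>UNIV. g x $ i * ?\<phi> i x))"
      using gi by (intro Bochner_Integration.integral_sum[symmetric]) simp
    also have "(\<lambda>x. \<Sum>i\<in>UNIV. g x $ i * ?\<phi> i x) = (\<lambda>x. inner (g x) x * ?b k x)"
      by (rule ext) (simp add: inner_vec_def sum_distrib_left mult_ac)
    finally have fD: "(LINT x|lborel. f x * ?D x) = - (LINT x|lborel. inner (g x) x * ?b k x)" .
    let ?F = "\<lambda>(x, h). if 0 < h \<and> h < f x then ?D x else 0"
    have iF: "integrable (lborel \<Otimes>\<^sub>M lborel) ?F"
    proof (rule integrableI_bounded)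
      have "(\<integral>\<^sup>+ z. ennreal (norm (?F z)) \<partial>(lborel \<Otimes>\<^sub>M lborel))
          = (\<integral>\<^sup>+ x. \<integral>\<^sup>+ h. ennreal (norm (?F (x, h))) \<partial>lborel \<partial>lborel)"
        by (rule lborel.nn_integral_fst[symmetric]) measurable
      also have "\<dots> = (\<integral>\<^sup>+ x. ennreal \<bar>f x * ?D x\<bar> \<partial>lborel)"
      proof (rule nn_integral_cong)
        fix x
        have "(\<integral>\<^sup>+ h. ennreal (norm (?F (x, h))) \<partial>lborel) = (\<integral>\<^sup>+ h. ennreal \<bar>?D x\<bar> * indicator {0<..<f x} h \<partial>lborel)"
          by (intro nn_integral_cong) (auto simp: indicator_def)
        also have "\<dots> = ennreal \<bar>?D x\<bar> * ennreal (f x)"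
          using nonneg[of x] by (simp add: nn_integral_cmult_indicator)
        also have "\<dots> = ennreal \<bar>f x * ?D x\<bar>"
          using nonneg[of x] by (simp only: ennreal_mult[symmetric] abs_ge_zero abs_mult abs_of_nonneg mult.commute)
        finally show "(\<integral>\<^sup>+ h. ennreal (norm (?F (x, h))) \<partial>lborel) = ennreal \<bar>f x * ?D x\<bar>" .
      qed
      also have "\<dots> < \<infinity>"
        using ifd[OF Dm DB] by (simp only: integrable_iff_bounded real_norm_def)
      finally show "(\<integral>\<^sup>+ z. ennreal (norm (?F z)) \<partial>(lborel \<Otimes>\<^sub>M lborel)) < \<infinity>" .
    qed measurable
    have "(LINT x|lborel. f x * ?D x) = (LINT x|lborel. LINT h|lborel. ?F (x, h))"
    proof (rule Bochner_Integration.integral_cong[OF refl])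
      fix x
      have "(LINT h|lborel. ?F (x, h)) = (LINT h|lborel. ?D x * indicator {0<..<f x} h)"
        by (intro Bochner_Integration.integral_cong) (auto simp: indicator_def)
      also have "\<dots> = ?D x * f x" using nonneg[of x] by simp
      finally show "f x * ?D x = (LINT h|lborel. ?F (x, h))" by (simp only: mult.commute)
    qed
    also have "\<dots> = (LINT h|lborel. LINT x|lborel. ?F (x, h))"
      using lborel_pair.Fubini_integral[of "\<lambda>x h. ?F (x, h)"] iF by simp
    also have "\<dots> = (LINT h|lborel. ?J k h)"
    proof (rule Bochner_Integration.integral_cong[OF refl])
      fix h :: real
      consider "h \<le> 0" | "0 < h" "?\<mu> h = 0" | "0 < h" "0 < ?\<mu> h"
        using dist_fun_nonneg[OF fm nonneg int mass, of h] by linarith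
      then show "(LINT x|lborel. ?F (x, h)) = ?J k h"
      proof cases
        case 1
        then show ?thesis by simp
      next
        case 2
        have "emeasure lborel {x. h < f x} = 0"
          using emeasure_superlevel[OF fm nonneg int mass 2(1)] 2(2) by simp
        then have "AE x in lborel. \<not> h < f x"
          by (subst AE_iff_measurable[where N="{x. h < f x}"]) auto
        then have "(LINT x|lborel. ?F (x, h)) = (LINT x|(lborel :: (real ^ 'n) measure). 0)"
          by (intro integral_cong_AE) (auto elim!: eventually_mono)
        then show ?thesis using 2 by simp
      next
        case 3
        have "(LINT x|lborel. ?F (x, h)) = (LINT x|lborel. (if 1 / ?\<mu> h < inv_vol x then ?D x else 0))"
          unfolding prod.case
        proof (rule integral_cong_AE)
          show "AE x in lborel. (if 0 < h \<and> h < f x then ?D x else 0) = (if 1 / ?\<mu> h < inv_vol x then ?D x else 0)"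
            using superlevel_set_radial[OF fm nonneg int mass anti f 3] by eventually_elim (use 3 in simp)
        qed measurable
        also have "\<dots> = ?n / (1 / ?\<mu> h) * bump k a b (?q (1 / ?\<mu> h))"
          by (rule integral_radial_test_divergence[OF b' ab(1)]) (use 3 in simp)
        finally show ?thesis using 3 by simp
      qed
    qed
    finally show ?thesis using fD by simp
  qed
  let ?I = "\<lambda>h. if 0 < h \<and> 0 < ?\<mu> h then ?n * ?\<mu> h * indicator {y1<..<y2} (1 / ?\<mu> h) else 0"
  have i\<mu>: "integrable lborel (\<lambda>h. ?\<mu> h * indicator {0<..} h)"
  proof (rule integrableI_bounded)
    have "(\<integral>\<^sup>+ h. ennreal (norm (?\<mu> h * indicator {0<..} h)) \<partial>lborel) = (\<integral>\<^sup>+ h. ennreal (?\<mu> h) * indicator {0<..} h \<partial>lborel)"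
      using dist_fun_nonneg[OF fm nonneg int mass] by (intro nn_integral_cong) (auto simp: indicator_def)
    also have "\<dots> = 1"
      using nn_integral_dist_fun[OF fm nonneg int mass, of 0] nn_integral_eq_integral[OF int] nonneg mass by simp
    finally show "(\<integral>\<^sup>+ h. ennreal (norm (?\<mu> h * indicator {0<..} h)) \<partial>lborel) < \<infinity>" by simp
  qed measurable
  have [measurable]: "?q \<in> borel_measurable borel" unfolding sq_radius_def[abs_def] by measurable
  have "(\<lambda>k. LINT h|lborel. ?J k h) \<longlonglongrightarrow> (LINT h|lborel. ?I h)"
  proof (rule integral_dominated_convergence[where w="\<lambda>h. ?n * (?\<mu> h * indicator {0<..} h)"])
    show "integrable lborel (\<lambda>h. ?n * (?\<mu> h * indicator {0<..} h))" using i\<mu> by (rule integrable_mult_right)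
    show "AE h in lborel. (\<lambda>k. ?J k h) \<longlonglongrightarrow> ?I h"
    proof (rule AE_I2)
      fix h
      have "(indicator {a<..<b} (?q (1 / ?\<mu> h)) :: real) = indicator {y1<..<y2} (1 / ?\<mu> h)" if "0 < ?\<mu> h"
        using q_mem[of "1 / ?\<mu> h"] that by (simp add: indicator_def)
      then show "(\<lambda>k. ?J k h) \<longlonglongrightarrow> ?I h"
        using tendsto_mult[OF tendsto_const[of "?n * ?\<mu> h"] bump_tendsto[of a b "?q (1 / ?\<mu> h)"]] by auto
    qed
    show "AE h in lborel. norm (?J k h) \<le> ?n * (?\<mu> h * indicator {0<..} h)" for k
    proof (rule AE_I2)
      fix h
      show "norm (?J k h) \<le> ?n * (?\<mu> h * indicator {0<..} h)"
        using bump_bounds[of k a b "?q (1 / ?\<mu> h)"] dist_fun_nonneg[OF fm nonneg int mass, of h]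
        by (auto simp: abs_mult mult_left_le)
    qed
  qed measurable
  moreover have "(\<lambda>k. - (LINT x|lborel. inner (g x) x * ?b k x)) \<longlonglongrightarrow> - (LINT x|lborel. inner (g x) x * indicator {y1<..<y2} (inv_vol x))"
  proof (intro tendsto_minus, rule integral_dominated_convergence[where w="\<lambda>x. sqrt b * (indicator (cball 0 (sqrt b)) x * norm (g x))"])
    show "integrable lborel (\<lambda>x. sqrt b * (indicator (cball 0 (sqrt b)) x * norm (g x)))"
      using g by (rule integrable_mult_right)
    show "AE x in lborel. (\<lambda>k. inner (g x) x * ?b k x) \<longlonglongrightarrow> inner (g x) x * indicator {y1<..<y2} (inv_vol x)"
      using AE_lborel_singleton[of "0 :: real ^ 'n"]
    proof eventually_elim
      case (elim x)
      have "(indicator {a<..<b} ((norm x)\<^sup>2) :: real) = indicator {y1<..<y2} (inv_vol x)"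
        using q_mem[of "inv_vol x"] elim by (simp add: indicator_def sq_radius_inv_vol inv_vol_pos)
      then show ?case
        using tendsto_mult[OF tendsto_const[of "inner (g x) x"] bump_tendsto[of a b "(norm x)\<^sup>2"]] by simp
    qed
    show "AE x in lborel. norm (inner (g x) x * ?b k x) \<le> sqrt b * (indicator (cball 0 (sqrt b)) x * norm (g x))" for k
    proof (rule AE_I2)
      fix x
      show "norm (inner (g x) x * ?b k x) \<le> sqrt b * (indicator (cball 0 (sqrt b)) x * norm (g x))"
      proof (cases "?b k x = 0")
        case False
        then have nx: "norm x \<le> sqrt b" by (rule small)
        have "\<bar>inner (g x) x\<bar> * \<bar>?b k x\<bar> \<le> (norm (g x) * sqrt b) * 1"
          using nx bump_bounds[of k a b "(norm x)\<^sup>2"] ab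
          by (intro mult_mono order_trans[OF Cauchy_Schwarz_ineq2 mult_left_mono]) auto
        then show ?thesis using nx by (simp add: abs_mult mult.commute)
      qed (use ab in simp)
    qed
  qed measurable
  ultimately have lim: "(LINT h|lborel. ?I h) = - (LINT x|lborel. inner (g x) x * indicator {y1<..<y2} (inv_vol x))"
    unfolding step by (rule LIMSEQ_unique)
  have [measurable]: "slope_fun f \<in> borel_measurable unit_lborel"
    by (rule mono_on_unit_measurable[OF slope_fun_mono[OF fm nonneg int mass]])
  \<comment> \<open>The height integral is read as an integral over masses:
    \<open>dist_fun f h\<close> is the Jacobian of the substitution and its reciprocal is the
    slope.\<close>
  have "ennreal ?n * (\<integral>\<^sup>+ m. indicator {y1<..<y2} (slope_fun f m) \<partial>unit_lborel)
      = (\<integral>\<^sup>+ h. ennreal ?n * (ennreal (?\<mu> h) * indicator {0<..} h * indicator {y1<..<y2} (1 / ?\<mu> h)) \<partial>lborel)"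
    by (subst nn_integral_inv_trunc[OF fm nonneg int mass]) (simp_all add: nn_integral_cmult)
  also have "\<dots> = (\<integral>\<^sup>+ h. ennreal (?I h) \<partial>lborel)"
    using dist_fun_nonneg[OF fm nonneg int mass]
    by (intro nn_integral_cong) (auto simp: indicator_def ennreal_mult' order.order_iff_strict)
  finally have "?n * (LINT m|unit_lborel. indicator {y1<..<y2} (slope_fun f m)) = (LINT h|lborel. ?I h)"
    by (subst (1 2) integral_eq_nn_integral)
      (auto simp: ennreal_indicator enn2real_mult dest: arg_cong[where f=enn2real])
  then have "(LINT m|unit_lborel. indicator {y1<..<y2} (slope_fun f m))
      = - (LINT x|lborel. inner (g x) x * indicator {y1<..<y2} (inv_vol x)) / ?n"
    unfolding lim by (simp add: field_simps)
  also have "\<dots> = (LINT x|lborel. (inner (g x) x * indicator {y1<..<y2} (inv_vol x)) * (- 1 / ?n))"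
    by (simp only: integral_mult_left_zero) simp
  also have "\<dots> = (LINT x|lborel. indicator {y1<..<y2} (inv_vol x) * - (inner (g x) x / ?n))"
    by (intro Bochner_Integration.integral_cong) auto
  finally show ?thesis .
qed

text \<open>The law of \<open>u\<close> is the image under \<open>inv_vol\<close> of the signed
  weight -<g, x>/n, hence absolutely continuous. The energy bound is a duality argument: integrate
  y^a rho^(p-1) against the law, estimate the weight by the Cauchy-Schwarz and Young inequalities,
  and absorb the part that reproduces the energy.\<close>

lemma law_of_flux:
  fixes g :: "real ^ 'n \<Rightarrow> real ^ 'n"
  assumes um [measurable]: "u \<in> borel_measurable unit_lborel" and pos: "\<And>m. m \<in> {0<..<1} \<Longrightarrow> 0 < u m"
    and [measurable]: "g \<in> borel_measurable borel"
    and g: "\<And>R. integrable lborel (\<lambda>x. indicator (cball 0 R) x * norm (g x))"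
    and p: "1 < p" and gp: "integrable lborel (\<lambda>x. norm (g x) powr p)"
    and eq: "\<And>y1 y2. 0 < y1 \<Longrightarrow> y1 < y2 \<Longrightarrow> (LINT m|unit_lborel. indicator {y1<..<y2} (u m))
      = (LINT x|lborel. indicator {y1<..<y2} (inv_vol x) * - (inner (g x) x / real CARD('n)))"
  obtains \<rho> where "has_law u \<rho>"
    "ennreal (real CARD('n) powr p * uvol TYPE('n) powr (p / real CARD('n)))
      * density_energy (2 * p - 2 + p / real CARD('n)) p \<rho> \<le> (\<integral>\<^sup>+ x. ennreal (norm (g x) powr p) \<partial>lborel)"
proof -
  interpret P: prob_space unit_lborel by (rule prob_space_unit_lborel)
  let ?n = "real CARD('n)" and ?c = "uvol TYPE('n)"
  define s where "s = (\<lambda>x. - (inner (g x) x / ?n))"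
  define a where "a = 2 * p - 2 + p / ?n"
  have a: "a > 0" using p by (simp add: a_def add_pos_pos)
  note c = uvol_pos[where 'n='n]
  have [measurable]: "s \<in> borel_measurable borel" unfolding s_def by measurable
  have sb: "\<bar>s x\<bar> \<le> norm (g x) * norm x / ?n" for x
    unfolding s_def using Cauchy_Schwarz_ineq2[of "g x" x] by (simp add: divide_right_mono)
  have s_int: "integrable lborel (\<lambda>x. indicator {y1<..<y2} (inv_vol x) * s x)" if "0 < y1" for y1 y2
  proof (rule Bochner_Integration.integrable_bound)
    let ?R = "(?c * y1) powr (- 1 / ?n)"
    show "integrable lborel (\<lambda>x. ?R / ?n * (indicator (cball 0 ?R) x * norm (g x)))"
      using g by (rule integrable_mult_right)
    show "AE x in lborel. norm (indicator {y1<..<y2} (inv_vol x) * s x) \<le> norm (?R / ?n * (indicator (cball 0 ?R) x * norm (g x)))"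
    proof (rule AE_I2)
      fix x :: "real ^ 'n"
      show "norm (indicator {y1<..<y2} (inv_vol x) * s x) \<le> norm (?R / ?n * (indicator (cball 0 ?R) x * norm (g x)))"
      proof (cases "inv_vol x \<in> {y1<..<y2}")
        case True
        then have nx: "norm x \<le> ?R" using inv_vol_gt_iff[OF that, of x] by simp
        have "\<bar>s x\<bar> \<le> norm (g x) * ?R / ?n"
          using nx by (intro order_trans[OF sb] divide_right_mono mult_left_mono) auto
        then show ?thesis using True nx by (simp add: mult.commute)
      qed simp
    qed
  qed measurable
  have push: "(LINT m|unit_lborel. k (u m)) = (LINT x|lborel. k (inv_vol x) * s x)"
    if [measurable]: "k \<in> borel_measurable borel" and k: "\<And>z. 0 \<le> k z" "\<And>z. z \<le> 0 \<Longrightarrow> k z = 0"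
      and b: "\<And>z. k z \<le> B" and i: "integrable lborel (\<lambda>x. k (inv_vol x) * s x)" for k B
  proof -
    have "(LINT m|unit_lborel. k (u m) * 1) = (LINT x|lborel. k (inv_vol x) * s x)"
    proof (rule signed_pushforward[where X=u and \<alpha>="\<lambda>_. 1" and Y=inv_vol and \<beta>=s])
      show "integrable unit_lborel (\<lambda>m. indicator {a<..<b} (u m) * (1 :: real))" for a b
        by (rule P.integrable_const_bound[of _ 1]) (auto simp: indicator_def)
      show "integrable unit_lborel (\<lambda>m. k (u m) * 1)"
        by (rule P.integrable_const_bound[of _ B]) (use k(1) b in auto)
    qed (use s_int eq k i in \<open>auto simp: s_def\<close>)
    then show ?thesis by simp
  qed
  let ?N = "distr unit_lborel borel u"
  have fin: "finite_measure ?N" by (rule P.finite_measure_distr) simp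
  \<comment> \<open>A null set of values has a null preimage under \<open>inv_vol\<close> away from
    the origin, so the signed weight gives it no mass. The values of \<open>u\<close> are positive,
    hence cutting the set at 0 loses nothing.\<close>
  have ac: "absolutely_continuous lborel ?N"
    unfolding absolutely_continuous_def
  proof
    fix A :: "real set" assume A: "A \<in> null_sets lborel"
    then have [measurable]: "A \<in> sets borel" by (auto simp: null_sets_def)
    have z: "AE x :: real ^ 'n in lborel. indicator (A \<inter> {0<..}) (inv_vol x) * s x = 0"
      using AE_inv_vol_notin_null_set[OF A] by eventually_elim (auto simp: indicator_def)
    have zi: "integrable lborel (\<lambda>x. indicator (A \<inter> {0<..}) (inv_vol x) * s x)"
      using z by (subst integrable_cong_AE[where g="\<lambda>_. 0"]) auto
    have "(LINT m|unit_lborel. indicator (A \<inter> {0<..}) (u m)) = (LINT x|lborel. indicator (A \<inter> {0<..}) (inv_vol x) * s x)"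
      by (rule push[of "indicator (A \<inter> {0<..})" 1]) (use zi in \<open>auto simp: indicator_def\<close>)
    also have "\<dots> = 0" using z by (intro integral_eq_zero_AE)
    finally have "(LINT m|unit_lborel. indicator (A \<inter> {0<..}) (u m) :: real) = 0" .
    then have "AE m in unit_lborel. (indicator (A \<inter> {0<..}) (u m) :: real) = 0"
      by (subst (asm) integral_nonneg_eq_0_iff_AE) (auto intro!: P.integrable_const_bound[of _ 1] simp: indicator_def)
    then have "AE m in unit_lborel. u m \<notin> A"
      using AE_space
      by eventually_elim (use pos in \<open>auto simp: space_unit_lborel indicator_def split: if_splits\<close>)
    then have "AE y in ?N. y \<notin> A" by (subst AE_distr_iff) auto
    then show "A \<in> null_sets ?N" by (subst (asm) AE_iff_null_sets[symmetric]) auto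
  qed
  obtain \<rho> where [measurable]: "\<rho> \<in> borel_measurable borel"
    and D: "AE y in lborel. RN_deriv lborel ?N y = ennreal (\<rho> y)" and \<rho>: "\<And>y. 0 \<le> \<rho> y"
    using sigma_finite_measure.real_RN_deriv[OF sigma_finite_lborel fin ac] by auto
  have d: "?N = density lborel (\<lambda>y. ennreal (\<rho> y))"
  proof -
    have "?N = density lborel (RN_deriv lborel ?N)"
      by (rule sigma_finite_measure.density_RN_deriv[OF sigma_finite_lborel ac, symmetric]) simp
    also have "\<dots> = density lborel (\<lambda>y. ennreal (\<rho> y))"
      using D by (intro density_cong) auto
    finally show ?thesis .
  qed
  have law: "has_law u \<rho>" using d \<rho> by (auto simp: has_law_def)
  define G where "G = (LINT x|lborel. norm (g x) powr p)"
  \<comment> \<open>The p-th power of \<open>\<kappa>\<close> is the reciprocal of the constant in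
    \<open>nn_integral_radial_gradient\<close>, so the two cancel at the end.\<close>
  define \<kappa> where "\<kappa> = 1 / (?n * ?c powr (1 / ?n))"
  have \<kappa>: "\<kappa> > 0" using c by (simp add: \<kappa>_def)
  \<comment> \<open>The truncation makes the energy finite, so that Young's inequality can absorb it.\<close>
  define r where "r = (\<lambda>j y. min (\<rho> y) (real (Suc j)))"
  define W where "W = (\<lambda>j::nat. {1 / real (Suc j)<..<real (Suc j)})"
  define w where "w = (\<lambda>j y. indicator (W j) y * (y powr a * r j y powr p))"
  define k where "k = (\<lambda>j y. indicator (W j) y * (y powr a * r j y powr (p - 1)))"
  have [measurable]: "r j \<in> borel_measurable borel" "W j \<in> sets borel" for j
    unfolding r_def W_def by measurable
  have [measurable]: "w j \<in> borel_measurable borel" "k j \<in> borel_measurable borel" for j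
    unfolding w_def k_def by measurable
  have r: "0 \<le> r j y" "r j y \<le> real (Suc j)" "r j y \<le> \<rho> y" for j y
    using \<rho> by (auto simp: r_def)
  have Wpos: "0 < y" if "y \<in> W j" for y j
    using that unfolding W_def by (auto intro: less_trans[rotated])
  have wk: "w j y = r j y * k j y" for j y
    using r(1)[of j y] by (cases "r j y = 0") (auto simp: w_def k_def powr_diff)
  have w0: "0 \<le> w j y" and k0: "0 \<le> k j y" for j y by (auto simp: w_def k_def)
  have kB: "k j y \<le> real (Suc j) powr a * real (Suc j) powr (p - 1)" for j y
    using Wpos[of y j] r[of j y] a p
    by (cases "y \<in> W j") (auto simp: k_def W_def intro!: mult_mono powr_mono2)
  have main: "(LINT y|lborel. w j y) \<le> \<kappa> powr p * G" "integrable lborel (w j)" for j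
  proof -
    let ?B = "real (Suc j) powr a * real (Suc j) powr (p - 1)"
    show iw: "integrable lborel (w j)"
    proof (rule integrable_bounded_cball[where R="real (Suc j)" and C="real (Suc j) * ?B"])
      fix y
      show "\<bar>w j y\<bar> \<le> indicator (cball 0 (real (Suc j))) y * (real (Suc j) * ?B)"
      proof (cases "y \<in> W j")
        case True
        have "w j y \<le> real (Suc j) * ?B"
          unfolding wk using r[of j y] kB[of j y] k0[of j y] by (intro mult_mono) auto
        then show ?thesis using True Wpos[OF True] w0[of j y] by (auto simp: W_def dist_real_def)
      qed (simp add: w_def)
    qed simp
    have wT: "(\<integral>\<^sup>+ x. ennreal (w j (inv_vol (x :: real ^ 'n)) * (inv_vol x)\<^sup>2) \<partial>lborel) = ennreal (LINT y|lborel. w j y)"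
    proof -
      have "(\<integral>\<^sup>+ x. ennreal (w j (inv_vol (x :: real ^ 'n)) * (inv_vol x)\<^sup>2) \<partial>lborel)
          = (\<integral>\<^sup>+ x. ennreal (w j (inv_vol (x :: real ^ 'n)) * (inv_vol x)\<^sup>2) * indicator {0<..} (inv_vol x) \<partial>lborel)"
        using Wpos by (intro nn_integral_cong) (auto simp: indicator_def w_def)
      also have "\<dots> = (\<integral>\<^sup>+ y. ennreal (w j y * y\<^sup>2) * (ennreal (1 / y\<^sup>2) * indicator {0<..} y) \<partial>lborel)"
        by (rule nn_integral_inv_vol[where k="\<lambda>y. ennreal (w j y * y\<^sup>2)"]) measurable
      also have "\<dots> = (\<integral>\<^sup>+ y. ennreal (w j y) \<partial>lborel)"
        using Wpos w0 by (intro nn_integral_cong) (auto simp: indicator_def w_def ennreal_mult'[symmetric])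
      also have "\<dots> = ennreal (LINT y|lborel. w j y)"
        using iw w0 by (intro nn_integral_eq_integral) auto
      finally show ?thesis .
    qed
    have iT: "integrable lborel (\<lambda>x :: real ^ 'n. w j (inv_vol x) * (inv_vol x)\<^sup>2)"
      by (rule integrableI_nonneg) (use w0 wT in auto)
    have eT: "(LINT x :: real ^ 'n|lborel. w j (inv_vol x) * (inv_vol x)\<^sup>2) = (LINT y|lborel. w j y)"
      using w0 wT by (subst integral_eq_nn_integral) (auto intro!: integral_nonneg_AE)
    have young: "k j (inv_vol x) * \<bar>s x\<bar> \<le> \<kappa> powr p / p * norm (g x) powr p + (1 - 1 / p) * (w j (inv_vol x) * (inv_vol x)\<^sup>2)" for x
    proof (cases "inv_vol x \<in> W j")
      case False
      then show ?thesis using p by (simp add: k_def w_def)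
    next
      case True
      let ?T = "inv_vol x" and ?q = "p / (p - 1)"
      have T: "?T > 0" using Wpos[OF True] .
      then have x: "x \<noteq> 0" by (simp add: inv_vol_pos)
      \<comment> \<open>The factor \<open>norm x\<close> supplies T^(-1/n) and
        \<open>\<kappa>\<close> collects the constants, so the bound for k |s| is the product of
        kappa |g| and \<open>b\<close>, to which Young's inequality with exponents p and p/(p-1)
        applies.\<close>
      define b where "b = ?T powr (a - 1 / ?n) * r j ?T powr (p - 1)"
      have nx: "norm x = ?c powr (- 1 / ?n) * ?T powr (- 1 / ?n)"
      proof -
        have "norm x = 1 / (1 / norm x)" by simp
        also have "\<dots> = 1 / (?c powr (1 / ?n) * ?T powr (1 / ?n))"
          using c T by (simp only: inverse_norm_eq[OF x] powr_mult less_imp_le)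
        finally show ?thesis by (simp add: powr_minus_divide)
      qed
      have "k j ?T * \<bar>s x\<bar> \<le> k j ?T * (norm (g x) * norm x / ?n)"
        by (intro mult_left_mono sb k0)
      also have "\<dots> = (\<kappa> * norm (g x)) * b"
        using T c True by (simp add: k_def \<kappa>_def b_def nx powr_diff powr_minus_divide mult_ac)
      also have "\<dots> \<le> (\<kappa> * norm (g x)) powr p / p + b powr ?q / ?q"
        using p \<kappa> by (intro Youngs_inequality) (auto simp: b_def field_simps)
      also have "(\<kappa> * norm (g x)) powr p = \<kappa> powr p * norm (g x) powr p"
        using \<kappa> by (simp add: powr_mult)
      also have "b powr ?q = w j ?T * ?T\<^sup>2"
      proof -
        \<comment> \<open>The two extra powers are what the push-forward under
          \<open>inv_vol\<close> divides out, so the second Young term integrates back to the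
          integral of \<open>w\<close>.\<close>
        have e: "(a - 1 / ?n) * ?q = a + 2"
        proof -
          have "a - 1 / ?n = (p - 1) * (2 + 1 / ?n)" by (simp add: a_def field_simps)
          then have "(a - 1 / ?n) * ?q = p * (2 + 1 / ?n)" using p by simp
          then show ?thesis by (simp add: a_def field_simps)
        qed
        have "b powr ?q = ?T powr ((a - 1 / ?n) * ?q) * r j ?T powr ((p - 1) * ?q)"
          unfolding b_def using r(1) by (simp add: powr_mult powr_powr)
        also have "(p - 1) * ?q = p" using p by simp
        also have "?T powr ((a - 1 / ?n) * ?q) = ?T powr a * ?T\<^sup>2"
          unfolding e using T by (simp add: powr_add)
        finally show ?thesis using True by (simp add: w_def)
      qed
      finally show ?thesis using p by (simp add: field_simps)
    qed
    have iY: "integrable lborel (\<lambda>x. \<kappa> powr p / p * norm (g x) powr p + (1 - 1 / p) * (w j (inv_vol x) * (inv_vol x)\<^sup>2))"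
      using gp iT by (intro Bochner_Integration.integrable_add integrable_mult_right)
    have ik: "integrable lborel (\<lambda>x. k j (inv_vol x) * s x)"
      by (rule Bochner_Integration.integrable_bound[OF iY])
        (use young k0 in \<open>auto simp: abs_mult intro!: AE_I2 intro: order_trans[OF _ abs_ge_self]\<close>)
    have iku: "integrable unit_lborel (\<lambda>m. k j (u m))"
      by (rule P.integrable_const_bound[of _ ?B]) (use k0 kB in auto)
    have k\<rho>: "integrable lborel (\<lambda>y. \<rho> y * k j y)" "(LINT m|unit_lborel. k j (u m)) = (LINT y|lborel. \<rho> y * k j y)"
    proof -
      have "integrable ?N (k j)" using iku by (subst integrable_distr_eq) auto
      then show "integrable lborel (\<lambda>y. \<rho> y * k j y)"
        unfolding d using \<rho> by (subst (asm) integrable_density) auto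
      have "(LINT m|unit_lborel. k j (u m)) = (LINT y|?N. k j y)" by (subst integral_distr) auto
      also have "\<dots> = (LINT y|lborel. \<rho> y * k j y)"
        unfolding d using \<rho> by (subst integral_density) auto
      finally show "(LINT m|unit_lborel. k j (u m)) = (LINT y|lborel. \<rho> y * k j y)" .
    qed
    \<comment> \<open>\<open>w j\<close> is r k, with r the truncation of \<open>\<rho>\<close>;
      restoring the full density in the first factor makes the right side an integral against the
      law of \<open>u\<close>.\<close>
    have "(LINT y|lborel. w j y) \<le> (LINT y|lborel. \<rho> y * k j y)"
    proof (rule integral_mono[OF iw k\<rho>(1)])
      show "w j y \<le> \<rho> y * k j y" for y unfolding wk by (intro mult_right_mono r k0)
    qed
    also have "\<dots> = (LINT x|lborel. k j (inv_vol x) * s x)"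
      unfolding k\<rho>(2)[symmetric]
    proof (rule push)
      show "k j z = 0" if "z \<le> 0" for z using Wpos[of z j] that by (cases "z \<in> W j") (auto simp: k_def)
    qed (use k0 kB ik in auto)
    also have "\<dots> \<le> (LINT x|lborel. \<kappa> powr p / p * norm (g x) powr p + (1 - 1 / p) * (w j (inv_vol x) * (inv_vol x)\<^sup>2))"
    proof (rule integral_mono[OF ik iY])
      fix x
      have "k j (inv_vol x) * s x \<le> k j (inv_vol x) * \<bar>s x\<bar>" by (intro mult_left_mono k0) simp
      then show "k j (inv_vol x) * s x \<le> \<kappa> powr p / p * norm (g x) powr p + (1 - 1 / p) * (w j (inv_vol x) * (inv_vol x)\<^sup>2)"
        using young[of x] by simp
    qed
    also have "\<dots> = \<kappa> powr p / p * G + (1 - 1 / p) * (LINT y|lborel. w j y)"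
      using gp iT by (simp add: G_def eT)
    \<comment> \<open>The Young term returns the integral of \<open>w\<close> with coefficient 1 -
      1/p; moving it to the left leaves the fraction 1/p.\<close>
    finally have "(LINT y|lborel. w j y) / p \<le> \<kappa> powr p * G / p" by (simp add: algebra_simps)
    then show "(LINT y|lborel. w j y) \<le> \<kappa> powr p * G" using p by (simp add: divide_le_cancel)
  qed
  \<comment> \<open>Fatou's lemma removes the truncation: for fixed y > 0 the values
    \<open>w j y\<close> are eventually constant in \<open>j\<close>.\<close>
  have "density_energy a p \<rho> \<le> (\<integral>\<^sup>+ y. liminf (\<lambda>j. ennreal (w j y)) \<partial>lborel)"
    unfolding density_energy_def
  proof (rule nn_integral_mono)
    fix y :: real
    show "indicator {0<..} y * ennreal (y powr a * \<rho> y powr p) \<le> liminf (\<lambda>j. ennreal (w j y))"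
    proof (cases "0 < y")
      case True
      obtain J :: nat where J: "\<rho> y + y + 1 / y \<le> real J" using real_arch_simple by blast
      have "\<forall>\<^sub>F j in sequentially. ennreal (w j y) = ennreal (y powr a * \<rho> y powr p)"
      proof (rule eventually_sequentiallyI)
        fix j assume "J \<le> j"
        then have j: "\<rho> y + y + 1 / y < real (Suc j)" using J by simp
        then have "\<rho> y < real (Suc j)" "y < real (Suc j)" "1 / y < real (Suc j)"
          using \<rho>[of y] True by (auto intro: le_less_trans[rotated])
        then have "y \<in> W j" "r j y = \<rho> y"
          using True by (auto simp: W_def r_def divide_less_eq mult.commute)
        then show "ennreal (w j y) = ennreal (y powr a * \<rho> y powr p)" by (simp add: w_def)
      qed
      then have "(\<lambda>j. ennreal (w j y)) \<longlonglongrightarrow> ennreal (y powr a * \<rho> y powr p)" by (rule tendsto_eventually)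
      then have "liminf (\<lambda>j. ennreal (w j y)) = ennreal (y powr a * \<rho> y powr p)"
        by (intro lim_imp_Liminf) auto
      then show ?thesis using True by simp
    qed simp
  qed
  also have "\<dots> \<le> liminf (\<lambda>j. \<integral>\<^sup>+ y. ennreal (w j y) \<partial>lborel)"
    by (rule nn_integral_liminf) measurable
  also have "\<dots> \<le> ennreal (\<kappa> powr p * G)"
  proof (rule order_trans[OF Liminf_le_Limsup Limsup_bounded], simp, rule always_eventually, rule allI)
    fix j
    have "(\<integral>\<^sup>+ y. ennreal (w j y) \<partial>lborel) = ennreal (LINT y|lborel. w j y)"
      using main(2) w0 by (intro nn_integral_eq_integral) auto
    then show "(\<integral>\<^sup>+ y. ennreal (w j y) \<partial>lborel) \<le> ennreal (\<kappa> powr p * G)"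
      using main(1) by (simp add: ennreal_leI)
  qed
  finally have "ennreal (?n powr p * ?c powr (p / ?n)) * density_energy a p \<rho>
      \<le> ennreal (?n powr p * ?c powr (p / ?n)) * ennreal (\<kappa> powr p * G)"
    by (rule mult_left_mono) simp
  also have "\<dots> = ennreal G"
  proof -
    have "\<kappa> powr p = 1 / (?n powr p * ?c powr (p / ?n))"
      using c by (simp add: \<kappa>_def powr_divide powr_mult powr_powr)
    then have "(?n powr p * ?c powr (p / ?n)) * (\<kappa> powr p * G) = G" using c by simp
    then show ?thesis by (subst ennreal_mult'[symmetric]) (simp_all only: powr_ge_zero mult_nonneg_nonneg)
  qed
  also have "\<dots> = (\<integral>\<^sup>+ x. ennreal (norm (g x) powr p) \<partial>lborel)"
    unfolding G_def using gp by (intro nn_integral_eq_integral[symmetric]) auto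
  finally show ?thesis using that[OF law] by (simp add: a_def)
qed

section \<open>Height function interpolation\<close>

lemma borel_measurable_lebesgue_AE:
  fixes f g :: "'a :: euclidean_space \<Rightarrow> 'b :: topological_space"
  assumes g: "g \<in> borel_measurable lebesgue" and fg: "AE x in lebesgue. f x = g x"
  shows "f \<in> borel_measurable lebesgue"
proof (rule measurableI)
  fix A :: "'b set" assume A: "A \<in> sets borel"
  show "f -` A \<inter> space lebesgue \<in> sets lebesgue"
  proof (rule completion.in_sets_AE)
    show "AE x in lebesgue. (x \<in> g -` A \<inter> space lebesgue) = (x \<in> f -` A \<inter> space lebesgue)"
      using fg by eventually_elim simp
    show "g -` A \<inter> space lebesgue \<in> sets lebesgue" using measurable_sets[OF g A] .
  qed simp
qed simp

text \<open>\<open>deriv H\<close> agrees with \<open>u\<close> only off a countable set, so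
  measurability of the integrand, too, comes from almost everywhere equality. The ball condition is
  u m < inv_vol x by \<open>inv_vol_gt_iff\<close>; the origin is excluded because of the default
  values there.\<close>

lemma from_height_eq_layer_fun:
  fixes x :: "real ^ 'n"
  assumes mono: "mono_on {0<..<1} u" and pos: "\<And>m. m \<in> {0<..<1} \<Longrightarrow> 0 < u m"
    and H: "countable {m \<in> {0<..<1}. deriv H m \<noteq> u m}" and x: "x \<noteq> 0"
  shows "from_height H x = layer_fun u x"
proof -
  let ?k = "\<lambda>m. if u m < inv_vol x then u m else 0"
  let ?l = "\<lambda>m. indicator (ball 0 ((measure lebesgue (ball (0 :: real ^ 'n) 1) * deriv H m) powr (- 1 / real CARD('n)))) x * deriv H m"
  have [measurable]: "u \<in> borel_measurable unit_lborel" by (rule mono_on_unit_measurable[OF mono])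
  have "?k \<in> borel_measurable unit_lborel" by measurable
  then have km: "(\<lambda>m. indicator {0<..<1} m *\<^sub>R ?k m) \<in> borel_measurable lborel"
    by (subst (asm) borel_measurable_restrict_space_iff) auto
  have "{m \<in> {0<..<1}. deriv H m \<noteq> u m} \<in> null_sets lebesgue"
    using countable_imp_null_set_lborel[OF H] by (rule null_sets_completionI)
  then have "AE m in lebesgue. m \<notin> {m \<in> {0<..<1}. deriv H m \<noteq> u m}" by (rule AE_not_in)
  then have ae: "AE m in lebesgue. indicator {0<..<1} m *\<^sub>R ?l m = indicator {0<..<1} m *\<^sub>R ?k m"
  proof eventually_elim
    case (elim m)
    show ?case
    proof (cases "m \<in> {0<..<1}")
      case True
      then have "deriv H m = u m" "0 < u m" using elim pos by auto
      then show ?thesis using inv_vol_gt_iff[of "u m" x] x True by (simp add: indicator_def)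
    qed simp
  qed
  have kl: "(\<lambda>m. indicator {0<..<1} m *\<^sub>R ?k m) \<in> borel_measurable lebesgue"
    using km by (rule measurable_completion)
  have "from_height H x = (LINT m|lebesgue. indicator {0<..<1} m *\<^sub>R ?l m)"
    by (simp add: from_height_def set_lebesgue_integral_def)
  also have "\<dots> = (LINT m|lebesgue. indicator {0<..<1} m *\<^sub>R ?k m)"
    by (intro integral_cong_AE borel_measurable_lebesgue_AE[OF kl ae] kl ae)
  also have "\<dots> = (LINT m|lborel. indicator {0<..<1} m *\<^sub>R ?k m)"
    by (rule integral_completion[OF km])
  also have "\<dots> = layer_fun u x"
    unfolding layer_fun_def by (rule integral_restrict_space[symmetric]) simp
  finally show ?thesis .
qed

text \<open>\<open>u\<close> is a positive increasing choice of subgradients of the convex function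
  \<open>H\<close>, encoded by chord inequalities. These pass to convex combinations at every point,
  whereas the derivatives of different height functions fail to exist on different countable
  sets.\<close>

definition slope_of :: "(real \<Rightarrow> real) \<Rightarrow> (real \<Rightarrow> real) \<Rightarrow> bool" where
  "slope_of H u \<longleftrightarrow> mono_on {0<..<1} u \<and> (\<forall>m\<in>{0<..<1}. 0 < u m) \<and>
     (\<forall>m\<in>{0<..<1}. \<forall>m'\<in>{0<..<1}. m \<le> m' \<longrightarrow>
       u m * (m' - m) \<le> H m' - H m \<and> H m' - H m \<le> u m' * (m' - m))"

lemma slope_of_convex_combination:
  assumes "slope_of H0 u0" "slope_of H1 u1" "0 \<le> s0" "0 \<le> s1" "s0 + s1 = 1"
  shows "slope_of (\<lambda>m. s0 * H0 m + s1 * H1 m) (\<lambda>m. s0 * u0 m + s1 * u1 m)"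
  unfolding slope_of_def
proof (intro conjI ballI impI mono_onI)
  fix m m' :: real assume m: "m \<in> {0<..<1}" "m' \<in> {0<..<1}" "m \<le> m'"
  have 0: "u0 m \<le> u0 m'" "u0 m * (m' - m) \<le> H0 m' - H0 m" "H0 m' - H0 m \<le> u0 m' * (m' - m)"
    and 1: "u1 m \<le> u1 m'" "u1 m * (m' - m) \<le> H1 m' - H1 m" "H1 m' - H1 m \<le> u1 m' * (m' - m)"
    using assms(1,2) m mono_onD[of "{0<..<1}" u0 m m'] mono_onD[of "{0<..<1}" u1 m m']
    unfolding slope_of_def by auto
  show "s0 * u0 m + s1 * u1 m \<le> s0 * u0 m' + s1 * u1 m'"
    using 0 1 assms by (intro add_mono mult_left_mono) auto
  show "(s0 * u0 m + s1 * u1 m) * (m' - m) \<le> s0 * H0 m' + s1 * H1 m' - (s0 * H0 m + s1 * H1 m)"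
    using mult_left_mono[OF 0(2) assms(3)] mult_left_mono[OF 1(2) assms(4)] by (simp add: algebra_simps)
  show "s0 * H0 m' + s1 * H1 m' - (s0 * H0 m + s1 * H1 m) \<le> (s0 * u0 m' + s1 * u1 m') * (m' - m)"
    using mult_left_mono[OF 0(3) assms(3)] mult_left_mono[OF 1(3) assms(4)] by (simp add: algebra_simps)
next
  fix m :: real assume "m \<in> {0<..<1}"
  then have u: "0 < u0 m" "0 < u1 m" using assms unfolding slope_of_def by auto
  show "0 < s0 * u0 m + s1 * u1 m"
  proof (cases "s0 = 0")
    case False
    then have "0 < s0 * u0 m" using u assms by simp
    moreover have "0 \<le> s1 * u1 m" using u assms by simp
    ultimately show ?thesis by simp
  qed (use u assms in simp)
qed

lemma sobolev_energy_from_height: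
  fixes p :: real
  assumes sl: "slope_of H u" and law: "has_law u \<rho>" and p: "1 < p"
    and fin: "density_energy (2 * p - 2 + p / real CARD('n)) p \<rho> < \<infinity>"
  shows "sobolev_energy p (from_height H :: real ^ 'n \<Rightarrow> real)
    = ennreal (real CARD('n) powr p * uvol TYPE('n) powr (p / real CARD('n)))
      * density_energy (2 * p - 2 + p / real CARD('n)) p \<rho>"
proof -
  have mono: "mono_on {0<..<1} u" and pos: "\<And>m. m \<in> {0<..<1} \<Longrightarrow> 0 < u m"
    using sl by (auto simp: slope_of_def)
  have "countable {m \<in> {0<..<1}. deriv H m \<noteq> u m}"
    using sl by (intro deriv_eq_slope[OF mono]) (auto simp: slope_of_def)
  note eq = from_height_eq_layer_fun[OF mono pos this]
  let ?f = "from_height H :: real ^ 'n \<Rightarrow> real" and ?g = "radial_gradient \<rho> :: real ^ 'n \<Rightarrow> real ^ 'n"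
  have "AE x :: real ^ 'n in lborel. ?f x = layer_fun u x"
    using AE_lborel_singleton[of "0 :: real ^ 'n"] by eventually_elim (rule eq)
  then have ae: "AE x in lebesgue. ?f x = layer_fun u x" by (rule AE_completion)
  have "layer_fun u \<in> borel_measurable (lebesgue :: (real ^ 'n) measure)"
    using layer_fun_measurable[OF mono_on_unit_measurable[OF mono]]
    by (intro measurable_completion) simp
  then have fm: "?f \<in> borel_measurable lebesgue" using ae by (rule borel_measurable_lebesgue_AE)
  have wg: "has_weak_gradient ?f ?g"
    by (rule layer_fun_weak_gradient[OF law pos p fin fm ae])
  then have "has_weak_gradient ?f (weak_gradient ?f)"
    unfolding weak_gradient_def by (rule someI[of "has_weak_gradient ?f"])
  then have ug: "AE x in lebesgue. weak_gradient ?f x = ?g x" using wg by (rule weak_gradient_unique)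
  have "sobolev_energy p ?f = (\<integral>\<^sup>+ x. ennreal (norm (weak_gradient ?f x) powr p) \<partial>lebesgue)"
    using wg by (auto simp: sobolev_energy_def)
  also have "\<dots> = (\<integral>\<^sup>+ x. ennreal (norm (?g x) powr p) \<partial>lebesgue)"
    using ug by (intro nn_integral_cong_AE) (auto elim!: eventually_mono)
  also have "\<dots> = (\<integral>\<^sup>+ x. ennreal (norm (?g x) powr p) \<partial>lborel)" by (rule nn_integral_completion)
  also have "\<dots> = ennreal (real CARD('n) powr p * uvol TYPE('n) powr (p / real CARD('n)))
      * density_energy (2 * p - 2 + p / real CARD('n)) p \<rho>"
    using law p by (intro nn_integral_radial_gradient) (auto simp: has_law_def)
  finally show ?thesis .
qed

lemma locally_integrable_borel_version:
  fixes g :: "real ^ 'n \<Rightarrow> real ^ 'n"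
  assumes "locally_integrable g"
  obtains g' where "g' \<in> borel_measurable borel" "AE x in lebesgue. g x = g' x"
proof -
  have "\<exists>h. h \<in> borel_measurable lborel \<and> (AE x in lborel. g x $ i = h x)" for i
  proof -
    have "(\<lambda>x. g x $ i) \<in> borel_measurable lebesgue"
    proof (rule borel_measurable_LIMSEQ_real)
      fix x
      have "\<forall>\<^sub>F k in sequentially. inner (indicator (cball 0 (real k)) x *\<^sub>R g x) (axis i 1) = g x $ i"
      proof -
        obtain N :: nat where "norm x \<le> real N" using real_arch_simple by blast
        then show ?thesis
          by (intro eventually_sequentiallyI[of N]) (auto simp: indicator_def inner_axis)
      qed
      then show "(\<lambda>k. inner (indicator (cball 0 (real k)) x *\<^sub>R g x) (axis i 1)) \<longlonglongrightarrow> g x $ i"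
        by (rule tendsto_eventually)
    next
      fix k :: nat
      have "(\<lambda>x. indicator (cball 0 (real k)) x *\<^sub>R g x) \<in> borel_measurable lebesgue"
        using assms unfolding locally_integrable_def set_integrable_def
        by (intro borel_measurable_integrable) simp
      then show "(\<lambda>x. inner (indicator (cball 0 (real k)) x *\<^sub>R g x) (axis i 1)) \<in> borel_measurable lebesgue"
        by (intro borel_measurable_inner) auto
    qed
    then show ?thesis
      using completion_ex_borel_measurable_real[of "\<lambda>x. g x $ i" lborel] by auto
  qed
  then obtain h where h: "\<And>i. h i \<in> borel_measurable lborel" "\<And>i. AE x in lborel. g x $ i = h i x"
    by metis
  have "AE x in lborel. \<forall>i. g x $ i = h i x"
    using AE_finite_allI[of UNIV "\<lambda>i x. g x $ i = h i x" lborel] h(2) by simp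
  then have "AE x in lebesgue. \<forall>i. g x $ i = h i x" by (rule AE_completion)
  then have "AE x in lebesgue. g x = (\<chi> i. h i x)" by eventually_elim (simp add: vec_eq_iff)
  moreover have "(\<lambda>x. \<chi> i. h i x) \<in> borel_measurable borel"
  proof -
    have "(\<lambda>x. \<chi> i. h i x) = (\<lambda>x. \<Sum>i\<in>UNIV. h i x *\<^sub>R axis i 1)"
      by (auto simp: fun_eq_iff vec_eq_iff axis_def if_distrib cong: if_cong)
    moreover have "(\<lambda>x. \<Sum>i\<in>UNIV. h i x *\<^sub>R axis i (1 :: real)) \<in> borel_measurable borel"
      using h(1) by (intro borel_measurable_sum borel_measurable_scaleR) auto
    ultimately show ?thesis by simp
  qed
  ultimately show ?thesis using that by blast
qed

text \<open>The analysis of height functions works with Borel functions that are nonnegative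
  everywhere. So \<open>f\<close> and its weak gradient are replaced by Borel versions
  \<open>f'\<close> and \<open>g\<close>; the masses, the essential supremum and the energy are all
  insensitive to null sets.\<close>

lemma sobolev_height_slope:
  fixes p :: real and f :: "real ^ 'n \<Rightarrow> real"
  assumes p: "1 < p" and W: "f \<in> sobolev_W1 p" and nonneg: "AE x in lebesgue. 0 \<le> f x"
    and sym: "symmetric_decreasing f" and um: "unit_mass f"
  obtains u \<rho> where "slope_of (height f) u" "has_law u \<rho>"
    "ennreal (real CARD('n) powr p * uvol TYPE('n) powr (p / real CARD('n)))
      * density_energy (2 * p - 2 + p / real CARD('n)) p \<rho> \<le> sobolev_energy p f"
    "density_energy (2 * p - 2 + p / real CARD('n)) p \<rho> < \<infinity>"
proof -
  have fm [measurable]: "f \<in> borel_measurable lebesgue" using W by (simp add: sobolev_W1_def)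
  obtain f1 where f1 [measurable]: "f1 \<in> borel_measurable lborel" and f1e: "AE x in lborel. f x = f1 x"
    using completion_ex_borel_measurable_real[OF fm] by auto
  define f' where "f' = (\<lambda>x. max 0 (f1 x))"
  have f'm [measurable]: "f' \<in> borel_measurable borel" unfolding f'_def using f1 by simp
  have f'n: "0 \<le> f' x" for x by (simp add: f'_def)
  have ff': "AE x in lebesgue. f x = f' x"
    using nonneg AE_completion[OF f1e] by eventually_elim (simp add: f'_def)
  have f'l [measurable]: "f' \<in> borel_measurable lebesgue" by (rule measurable_completion) simp
  have f'i: "integrable lborel f'" and f'1: "(LINT x|lborel. f' x) = 1"
  proof -
    have "integrable lebesgue f'" "(LINT x|lebesgue. f' x) = 1"
      using um ff' unfolding unit_mass_def by (auto simp: integrable_cong_AE[of f _ f'] integral_cong_AE[of f _ f'])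
    then show "integrable lborel f'" "(LINT x|lborel. f' x) = 1"
      by (simp_all add: integrable_completion integral_completion)
  qed
  note F = f'm f'n f'i f'1
  obtain \<Phi> where \<Phi>: "antimono_on {0<..} \<Phi>" "AE x in lebesgue. f x = \<Phi> (norm x)"
    using sym by (auto simp: symmetric_decreasing_def)
  have "AE x in lebesgue. f' x = \<Phi> (norm x)" using ff' \<Phi>(2) by eventually_elim simp
  then have f'\<Phi>: "AE x in lborel. f' x = \<Phi> (norm x)" by (simp add: AE_completion_iff)
  obtain g0 where g0: "has_weak_gradient f g0" "integrable lebesgue (\<lambda>x. norm (g0 x) powr p)"
    using W by (auto simp: sobolev_W1_def)
  have "has_weak_gradient f (weak_gradient f)"
    unfolding weak_gradient_def using g0(1) by (rule someI[of "has_weak_gradient f"])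
  then have ug: "AE x in lebesgue. weak_gradient f x = g0 x" using g0(1) by (rule weak_gradient_unique)
  obtain g where g [measurable]: "g \<in> borel_measurable borel" and g0g: "AE x in lebesgue. g0 x = g x"
    using locally_integrable_borel_version g0(1) unfolding has_weak_gradient_def by blast
  have gl [measurable]: "g \<in> borel_measurable lebesgue" by (rule measurable_completion) simp
  have g0l [measurable]: "g0 \<in> borel_measurable lebesgue" using gl g0g by (rule borel_measurable_lebesgue_AE)
  have E: "sobolev_energy p f = (\<integral>\<^sup>+ x. ennreal (norm (g x) powr p) \<partial>lborel)"
  proof -
    have "sobolev_energy p f = (\<integral>\<^sup>+ x. ennreal (norm (weak_gradient f x) powr p) \<partial>lebesgue)"
      using g0(1) by (auto simp: sobolev_energy_def)
    also have "\<dots> = (\<integral>\<^sup>+ x. ennreal (norm (g x) powr p) \<partial>lebesgue)"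
      using ug g0g by (intro nn_integral_cong_AE) (auto elim!: eventually_elim2)
    finally show ?thesis by (simp add: nn_integral_completion)
  qed
  have gp: "integrable lborel (\<lambda>x. norm (g x) powr p)"
  proof -
    have "integrable lebesgue (\<lambda>x. norm (g x) powr p)"
      using g0(2) g0g by (subst integrable_cong_AE[of _ _ "\<lambda>x. norm (g0 x) powr p"]) (auto elim!: eventually_mono)
    then show ?thesis by (simp add: integrable_completion)
  qed
  have gi: "integrable lborel (\<lambda>x. indicator (cball 0 R) x * norm (g x))" for R
  proof -
    have [measurable]: "cball (0 :: real ^ 'n) R \<in> sets borel" "cball (0 :: real ^ 'n) R \<in> sets lebesgue"
      by (auto intro: fmeasurableD)
    have "integrable lebesgue (\<lambda>x. indicator (cball 0 R) x *\<^sub>R g0 x)"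
      using g0(1) by (simp add: has_weak_gradient_def locally_integrable_def set_integrable_def)
    then have "integrable lebesgue (\<lambda>x. norm (indicator (cball 0 R) x *\<^sub>R g0 x))"
      by (rule integrable_norm)
    then have "integrable lebesgue (\<lambda>x. indicator (cball 0 R) x * norm (g x))"
      using g0g by (subst integrable_cong_AE[of _ _ "\<lambda>x. norm (indicator (cball 0 R) x *\<^sub>R g0 x)"])
        (auto elim!: eventually_mono)
    then show ?thesis by (simp add: integrable_completion)
  qed
  have wg: "(LINT x|lborel. f' x * frechet_derivative \<phi> (at x) (axis i 1)) = - (LINT x|lborel. g x $ i * \<phi> x)"
    if \<phi>: "test_function \<phi>" for \<phi> i
  proof -
    let ?d = "\<lambda>x. frechet_derivative \<phi> (at x) (axis i 1)"
    have [measurable]: "?d \<in> borel_measurable borel" by (rule test_function_derivative(2)[OF \<phi>])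
    note [measurable] = test_function_borel[OF \<phi>] test_function_lebesgue[OF \<phi>]
    have [measurable]: "?d \<in> borel_measurable lebesgue" by (rule measurable_completion) simp
    have gim: "(\<lambda>x. g x $ i) \<in> borel_measurable borel" "(\<lambda>x. g x $ i) \<in> borel_measurable lebesgue"
      "(\<lambda>x. g0 x $ i) \<in> borel_measurable lebesgue" by (simp_all add: cart_eq_inner_axis)
    note [measurable] = gim
    have "(LINT x|lborel. f' x * ?d x) = (LINT x|lebesgue. f' x * ?d x)"
      by (rule integral_completion[symmetric]) simp
    also have "\<dots> = (LINT x|lebesgue. f x * ?d x)"
      using ff' by (intro integral_cong_AE) (auto elim!: eventually_mono)
    also have "\<dots> = - (LINT x|lebesgue. g0 x $ i * \<phi> x)"
      using g0(1) \<phi> by (simp add: has_weak_gradient_def)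
    also have "(LINT x|lebesgue. g0 x $ i * \<phi> x) = (LINT x|lebesgue. g x $ i * \<phi> x)"
      using g0g by (intro integral_cong_AE) (auto elim!: eventually_mono)
    also have "\<dots> = (LINT x|lborel. g x $ i * \<phi> x)"
      by (rule integral_completion) simp
    finally show ?thesis .
  qed
  have height: "height f m = inv_trunc f' m" if m: "m \<in> {0<..<1}" for m
  proof -
    have "esssup lebesgue (\<lambda>x. ereal \<bar>f x\<bar>) = esssup lebesgue (\<lambda>x. ereal \<bar>f' x\<bar>)"
      using ff' by (intro esssup_AE_cong) (auto elim!: eventually_mono)
    also have "\<dots> = esssup lborel (\<lambda>x. ereal \<bar>f' x\<bar>)"
      by (subst (1 2) esssup_eq_AE) (simp_all add: AE_completion_iff)
    finally have es: "esssup lebesgue (\<lambda>x. ereal \<bar>f x\<bar>) = esssup lborel (\<lambda>x. ereal \<bar>f' x\<bar>)" .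
    have mi: "(LINT x|lebesgue. min (f x) h) = (LINT x|lborel. min (f' x) h)" for h
    proof -
      have "(LINT x|lebesgue. min (f x) h) = (LINT x|lebesgue. min (f' x) h)"
        using ff' by (intro integral_cong_AE) (auto elim!: eventually_mono)
      then show ?thesis by (simp add: integral_completion)
    qed
    show ?thesis
      unfolding height_def es mi by (rule height_eq_inv_trunc[OF F m])
  qed
  let ?u = "slope_fun f'"
  have sl: "slope_of (height f) ?u"
    unfolding slope_of_def
    using slope_fun_mono[OF F] slope_fun_pos[OF F] inv_trunc_diff[OF F] by (simp add: height)
  have "?u \<in> borel_measurable unit_lborel" by (rule mono_on_unit_measurable[OF slope_fun_mono[OF F]])
  from law_of_flux[OF this slope_fun_pos[OF F] g gi p gp slope_fun_law_eq[OF F \<Phi>(1) f'\<Phi> g gi wg]]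
  obtain \<rho> where \<rho>: "has_law ?u \<rho>"
    "ennreal (real CARD('n) powr p * uvol TYPE('n) powr (p / real CARD('n)))
      * density_energy (2 * p - 2 + p / real CARD('n)) p \<rho> \<le> sobolev_energy p f"
    unfolding E by blast
  have "sobolev_energy p f < \<infinity>"
    using gp unfolding E by (simp add: integrable_iff_bounded)
  then have "ennreal (real CARD('n) powr p * uvol TYPE('n) powr (p / real CARD('n)))
      * density_energy (2 * p - 2 + p / real CARD('n)) p \<rho> < \<infinity>"
    using \<rho>(2) by (rule le_less_trans[rotated])
  moreover have "0 < real CARD('n) powr p * uvol TYPE('n) powr (p / real CARD('n))"
    using uvol_pos[where 'n='n] by simp
  ultimately have "density_energy (2 * p - 2 + p / real CARD('n)) p \<rho> < \<infinity>"
    by (auto simp: ennreal_mult_less_top)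
  then show ?thesis using that sl \<rho> by blast
qed

theorem proposition5p2:
  fixes p :: real and f0 f1 :: "real ^ 'n \<Rightarrow> real"
  assumes "1 < p"
    and "f0 \<in> sobolev_W1 p" and "f1 \<in> sobolev_W1 p"
    and "\<not> (AE x in lebesgue. f0 x = f1 x)"
    and "AE x in lebesgue. 0 \<le> f0 x" and "AE x in lebesgue. 0 \<le> f1 x"
    and "symmetric_decreasing f0" and "symmetric_decreasing f1"
    and "unit_mass f0" and "unit_mass f1"
    and "p \<ge> 2 * real CARD('n) / (real CARD('n) + 1)"
  shows "(\<forall>t\<in>{0..1}. sobolev_energy p (height_interpolation f0 f1 t) < \<infinity>) \<and>
    convex_on {0..1} (\<lambda>t. enn2real (sobolev_energy p (height_interpolation f0 f1 t))) \<and>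
    (\<exists>s\<in>{0..1}.
       (\<forall>t\<in>{0..1}. sobolev_energy p (height_interpolation f0 f1 t)
                    \<le> sobolev_energy p (height_interpolation f0 f1 s)) \<and>
       sobolev_energy p (height_interpolation f0 f1 s)
         \<le> max (sobolev_energy p f0) (sobolev_energy p f1))"
proof -
  define n where "n = real CARD('n)"
  define a where "a = 2 * p - 2 + p / n"
  define C where "C = real CARD('n) powr p * uvol TYPE('n) powr (p / real CARD('n))"
  have n: "n > 0" by (simp add: n_def)
  \<comment> \<open>With a = 2p - 2 + p/n this reads p (1 + 1/n) >= 2, the assumed lower bound on
    \<open>p\<close>.\<close>
  have pa: "p \<le> a"
  proof -
    have "2 * n \<le> p * (n + 1)" using assms(11) n by (simp add: n_def divide_le_eq)
    then have "2 * n / n \<le> p * (n + 1) / n" using n by (intro divide_right_mono) auto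
    then show ?thesis using n by (simp add: a_def field_simps)
  qed
  have C: "C > 0" using uvol_pos[where 'n='n] by (simp add: C_def)
  obtain u0 \<rho>0 where 0: "slope_of (height f0) u0" "has_law u0 \<rho>0"
      "ennreal C * density_energy a p \<rho>0 \<le> sobolev_energy p f0" "density_energy a p \<rho>0 < \<infinity>"
    using sobolev_height_slope[OF assms(1,2,5,7,9)] by (auto simp: C_def a_def n_def)
  obtain u1 \<rho>1 where 1: "slope_of (height f1) u1" "has_law u1 \<rho>1"
      "ennreal C * density_energy a p \<rho>1 \<le> sobolev_energy p f1" "density_energy a p \<rho>1 < \<infinity>"
    using sobolev_height_slope[OF assms(1,3,6,8,10)] by (auto simp: C_def a_def n_def)
  define u where "u = (\<lambda>t m. (1 - t) * u0 m + t * u1 m)"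
  define en where "en = (\<lambda>t. sobolev_energy p (height_interpolation f0 f1 t))"
  have sl: "slope_of (\<lambda>m. (1 - t) * height f0 m + t * height f1 m) (u t)" if "t \<in> {0..1}" for t
    unfolding u_def using that by (intro slope_of_convex_combination 0 1) auto
  have en: "en t = ennreal C * density_energy a p \<rho>"
    if "t \<in> {0..1}" "has_law (u t) \<rho>" "density_energy a p \<rho> < \<infinity>" for t \<rho>
    using sobolev_energy_from_height[OF sl[OF that(1)] that(2) assms(1), where 'n='n] that(3)
    by (simp add: en_def height_interpolation_def C_def a_def n_def)
  \<comment> \<open>Existence of a density of finite energy is part of the claim: it holds at the
    end points by the Sobolev assumption, and \<open>step\<close> propagates it to intermediate
    times.\<close>
  define P where "P = (\<lambda>t. \<exists>\<rho>. has_law (u t) \<rho> \<and> density_energy a p \<rho> < \<infinity>)"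
  have step: "P ((1 - w) * s + w * t) \<and> en ((1 - w) * s + w * t) \<le> ennreal (1 - w) * en s + ennreal w * en t"
    if st: "s \<in> {0..1}" "t \<in> {0..1}" "P s" "P t" and w: "0 < w" "w < 1" for s t w
  proof -
    obtain \<rho>s \<rho>t where \<rho>s: "has_law (u s) \<rho>s" "density_energy a p \<rho>s < \<infinity>"
      and \<rho>t: "has_law (u t) \<rho>t" "density_energy a p \<rho>t < \<infinity>"
      using st unfolding P_def by blast
    have mono: "mono_on {0<..<1} (u s)" "mono_on {0<..<1} (u t)"
      and pos: "\<And>m. m \<in> {0<..<1} \<Longrightarrow> 0 < u s m" "\<And>m. m \<in> {0<..<1} \<Longrightarrow> 0 < u t m"
      using sl[OF st(1)] sl[OF st(2)] by (auto simp: slope_of_def)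
    obtain \<rho> where \<rho>: "has_law (\<lambda>m. (1 - w) * u s m + w * u t m) \<rho>"
      "density_energy a p \<rho> \<le> ennreal (1 - w) * density_energy a p \<rho>s + ennreal w * density_energy a p \<rho>t"
      using displacement_convexity[OF assms(1) pa mono pos \<rho>s(1) \<rho>t(1), of "1 - w" w] w by auto
    \<comment> \<open>The slope is affine in time, so interpolating between the times
      \<open>s\<close> and \<open>t\<close> stays in the same family. The estimate for two functions
      thus gives convexity on the whole interval.\<close>
    have uw: "(\<lambda>m. (1 - w) * u s m + w * u t m) = u ((1 - w) * s + w * t)"
      by (simp add: u_def fun_eq_iff algebra_simps)
    have "ennreal (1 - w) * density_energy a p \<rho>s + ennreal w * density_energy a p \<rho>t < \<infinity>"
      using \<rho>s(2) \<rho>t(2) by (simp add: ennreal_mult_less_top)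
    then have fin: "density_energy a p \<rho> < \<infinity>" using \<rho>(2) by (rule le_less_trans[rotated])
    have mem: "(1 - w) * s + w * t \<in> {0..1}"
      using convexD_alt[of "{0..1::real}" s t w] st w by simp
    have law: "has_law (u ((1 - w) * s + w * t)) \<rho>" using \<rho>(1) unfolding uw .
    have "en ((1 - w) * s + w * t) \<le> ennreal C * (ennreal (1 - w) * density_energy a p \<rho>s + ennreal w * density_energy a p \<rho>t)"
      unfolding en[OF mem law fin] by (rule mult_left_mono[OF \<rho>(2)]) simp
    also have "\<dots> = ennreal (1 - w) * en s + ennreal w * en t"
      unfolding en[OF st(1) \<rho>s] en[OF st(2) \<rho>t] by (simp add: distrib_left mult_ac)
    finally show ?thesis using law fin by (auto simp: P_def)
  qed
  have u01: "u 0 = u0" "u 1 = u1" by (simp_all add: u_def fun_eq_iff)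
  have P01: "P 0" "P 1" using 0 1 unfolding P_def u01 by blast+
  have P: "P t" and en01: "en t \<le> ennreal (1 - t) * en 0 + ennreal t * en 1" if "t \<in> {0..1}" for t
  proof -
    have "P t \<and> en t \<le> ennreal (1 - t) * en 0 + ennreal t * en 1"
    proof (cases "t = 0 \<or> t = 1")
      case True
      then show ?thesis using P01 by auto
    next
      case False
      then show ?thesis using step[of 0 1 t] P01 that by simp
    qed
    then show "P t" "en t \<le> ennreal (1 - t) * en 0 + ennreal t * en 1" by auto
  qed
  have fin: "en t < \<infinity>" if t: "t \<in> {0..1}" for t
  proof -
    obtain \<rho> where "has_law (u t) \<rho>" "density_energy a p \<rho> < \<infinity>"
      using P[OF t] unfolding P_def by blast
    then show ?thesis using en[OF t] by (simp add: ennreal_mult_less_top)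
  qed
  have "convex_on {0..1} (\<lambda>t. enn2real (en t))"
  proof (rule convex_onI)
    fix w s t :: real assume w: "0 < w" "w < 1" and st: "s \<in> {0..1}" "t \<in> {0..1}"
    obtain x y where xy: "en s = ennreal x" "0 \<le> x" "en t = ennreal y" "0 \<le> y"
      using fin[OF st(1)] fin[OF st(2)] by (cases "en s"; cases "en t") auto
    have "en ((1 - w) * s + w * t) \<le> ennreal (1 - w) * en s + ennreal w * en t"
      using step[OF st P[OF st(1)] P[OF st(2)] w] by blast
    also have "\<dots> = ennreal ((1 - w) * x + w * y)"
      using w xy by (simp add: ennreal_mult' ennreal_plus)
    finally have "enn2real (en ((1 - w) * s + w * t)) \<le> (1 - w) * x + w * y"
      using w xy by (intro enn2real_leI) auto
    then show "enn2real (en ((1 - w) *\<^sub>R s + w *\<^sub>R t)) \<le> (1 - w) * enn2real (en s) + w * enn2real (en t)"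
      using xy by simp
  qed simp
  moreover have "\<exists>s\<in>{0..1}. (\<forall>t\<in>{0..1}. en t \<le> en s) \<and> en s \<le> max (sobolev_energy p f0) (sobolev_energy p f1)"
  proof -
    \<comment> \<open>\<open>en 0\<close> and \<open>en 1\<close> are energies of reconstructed
      functions, bounded by those of \<open>f0\<close> and \<open>f1\<close>. By convexity the
      larger of the two bounds every \<open>en t\<close>, so an end point serves as the
      maximizer.\<close>
    have e0: "en 0 \<le> sobolev_energy p f0" "en 1 \<le> sobolev_energy p f1"
      using en[of 0 \<rho>0] en[of 1 \<rho>1] 0 1 by (simp_all add: u01)
    have le: "en t \<le> max (en 0) (en 1)" if "t \<in> {0..1}" for t
    proof -
      have "en t \<le> ennreal (1 - t) * max (en 0) (en 1) + ennreal t * max (en 0) (en 1)"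
        using en01[OF that] by (rule order_trans) (intro add_mono mult_left_mono; simp)
      also have "\<dots> = (ennreal (1 - t) + ennreal t) * max (en 0) (en 1)" by (simp add: distrib_right)
      also have "ennreal (1 - t) + ennreal t = 1" using that by (simp add: ennreal_plus[symmetric] del: ennreal_plus)
      finally show ?thesis by simp
    qed
    show ?thesis
    proof (cases "en 0 \<le> en 1")
      case True
      then show ?thesis using le e0 by (intro bexI[of _ 1]) (auto simp: max_def intro: order_trans le_max_iff_disj[THEN iffD2])
    next
      case False
      then show ?thesis using le e0 by (intro bexI[of _ 0]) (auto simp: max_def intro: order_trans le_max_iff_disj[THEN iffD2])
    qed
  qed
  ultimately show ?thesis using fin unfolding en_def by blast
qed

end
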